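(* Let $\frac34<\delta<1$ and $\frac12<\gamma<1$. For $n\ge1$ put $N=2n+3$, let $\alpha_n$ be a constant with $$|\alpha_n|=\left|\frac{\lambda_{\hat c}^nA_2(\hat c)}{a_{\hat c}}\right|,\qquad \arg\alpha_n=-\frac13\arg\left(\frac{\lambda_{\hat c}^nA_2(\hat c)}{a_{\hat c}}\right),$$ and set $$g_c(Z)=g_{n,c}(Z):=\alpha_nf_c^N(Z/\alpha_n),\qquad k_n:=\frac{a_{\hat c}}{\alpha_n\lambda_{c_n}^n},\qquad \rho_n(t):=k_n\overline{b_0}\,t-\overline{k_n}\,b_0^*\,\bar t.$$ Then for $|Z|=O(\Lambda^{(1-\delta)n})$ and $t=O(\Lambda^{(1-\gamma)n})$, $$g_{c_n+\rho_n(t)}(Z)\xrightarrow{\,n\to\infty\,}\bar Z^2+(|b_0|^2-|b_0^*|^2)\,t,$$ and the convergence is exponentially fast; that is, for all constants $C_1,C_2>0$ there are $C,\kappa>0$ such that for all sufficiently large $n$, all $|Z|\le C_1\Lambda^{(1-\delta)n}$ and all $|t|\le C_2\Lambda^{(1-\gamma)n}$, $$\left|g_{c_n+\rho_n(t)}(Z)-\bar Z^2-(|b_0|^2-|b_0^*|^2)t\right|\le Ce^{-\kappa n}.$$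
   Context: Let $f_c(z)=\bar z^2+c$, $Q_c(z)=z^2+c$ and $\hat c=-2$. For $N=2n+3$ let $c_n=\min\{c\in\mathbb{R}\mid Q_c^N(0)=0\}$ (equivalently with $f_c$ in place of $Q_c$); then $c_n\to\hat c$ as $n\to\infty$. For $c$ near $\hat c$ let $\beta_c$ be the fixed point of $f_c$ depending continuously on $c$ with $\beta_{\hat c}=2$ (the landing point of the dynamical ray of angle $0$), and let $\lambda_c=(f_c^2)'(\beta_c)$, where $f_c^2(z)=(z^2+\bar c)^2+c$ is holomorphic. Put $\Lambda=|\lambda_{\hat c}|=16$. Let $\mathrm{Koe}_c$ be the linearizing coordinate of $f_c^2$ at $\beta_c$: $\mathrm{Koe}_c(f_c^2(z))=\lambda_c\,\mathrm{Koe}_c(z)$, $\mathrm{Koe}_c(\beta_c)=0$, normalized by $\mathrm{Koe}_c(0)=1$; it is the inverse branch (analytically continued from $\beta_c$ along $[0,2]$) of an entire function $\mathrm{Poi}_c$, with $\mathrm{Poi}_{\hat c}(w)=2\cos(\frac{\pi}{2}\sqrt w)$. Put $a_c=\mathrm{Koe}_c'(0)\ne0$. Near $z=0$ write $\mathrm{Koe}_c\circ f_c^3(z)=\sum_{i\ge0}A_i(c)\bar z^i$; the $A_i$ are real-analytic functions of $c$ near $\hat c$, and $A_2(\hat c)=\frac{64}{\pi^2}$. One has $A_0(c)=(c-\hat c)B(c)+\overline{(c-\hat c)}B^*(c)$ with $B,B^*$ real-analytic near $\hat c$, and $$b_0:=B(\hat c)=\frac{2^7\cdot7}{15\pi^2},\qquad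 b_0^*:=B^*(\hat c)=-\frac{2^8}{15\pi^2}.$$ The condition on $\arg\alpha_n$ is understood through $3\arg\alpha_n\equiv-\arg(\lambda_{\hat c}^nA_2(\hat c)/a_{\hat c})\pmod{2\pi}$, i.e. $\frac{\alpha_n}{\overline{\alpha_n}^2}\cdot\frac{\lambda_{\hat c}^nA_2(\hat c)}{a_{\hat c}}=1$; since all constants are real one may take $\alpha_n=\lambda_{\hat c}^nA_2(\hat c)/a_{\hat c}$ $(<0)$. *)

theory Defs
  imports "HOL-Complex_Analysis.Complex_Analysis"
begin

definition acp :: "complex \<Rightarrow> complex \<Rightarrow> complex" where
  "acp c z = (cnj z)\<^sup>2 + c"

definition quadp :: "complex \<Rightarrow> complex \<Rightarrow> complex" where
  "quadp c z = z\<^sup>2 + c"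

abbreviation chat :: complex where
  "chat \<equiv> -2"

definition period :: "nat \<Rightarrow> nat" where
  "period n = 2 * n + 3"

(* The set is finite and nonempty: it is the set of real roots of a nonzero polynomial
   in c and contains 0. *)
definition cn :: "nat \<Rightarrow> real" where
  "cn n = Min {c :: real. (quadp (of_real c) ^^ period n) 0 = 0}"

(* The conditions determine the germ of beta at chat. *)
definition fixed_point_branch :: "(complex \<Rightarrow> complex) \<Rightarrow> bool" where
  "fixed_point_branch \<beta> \<longleftrightarrow> \<beta> chat = 2 \<and>
     (\<forall>\<^sub>F c in nhds chat. isCont \<beta> c \<and> acp c (\<beta> c) = \<beta> c)"

(* acp c ^^ 2 is the holomorphic map sending z to (z^2 + cnj c)^2 + c. *)
definition multiplier :: "(complex \<Rightarrow> complex) \<Rightarrow> complex \<Rightarrow> complex" where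
  "multiplier \<beta> c = deriv (acp c ^^ 2) (\<beta> c)"

definition Lam :: "(complex \<Rightarrow> complex) \<Rightarrow> real" where
  "Lam \<beta> = norm (multiplier \<beta> chat)"

(* Koe c is the linearizing coordinate at beta c.  Its analytic continuation along the segment
   [0,2] is expressed by holomorphy on one connected neighbourhood V of that segment, which is
   the same for all c near chat.  The functional equation is required only near beta c: after
   continuation the two sides may be different branches (e.g. for c = chat, where 0 is mapped
   to 2, Koe 2 = 0 but Koe 0 = 1).  By the identity theorem the conditions determine Koe c on V
   for all c near chat. *)
definition linearizer_family ::
    "(complex \<Rightarrow> complex) \<Rightarrow> (complex \<Rightarrow> complex \<Rightarrow> complex) \<Rightarrow> bool" where
  "linearizer_family \<beta> Koe \<longleftrightarrow>
     (\<exists>V. open V \<and> connected V \<and> closed_segment 0 2 \<subseteq> V \<and>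
        (\<forall>\<^sub>F c in nhds chat.
           Koe c holomorphic_on V \<and> \<beta> c \<in> V \<and>
           Koe c (\<beta> c) = 0 \<and> Koe c 0 = 1 \<and>
           (\<forall>\<^sub>F z in nhds (\<beta> c). Koe c ((acp c ^^ 2) z) = multiplier \<beta> c * Koe c z)))"

definition koe_deriv :: "(complex \<Rightarrow> complex \<Rightarrow> complex) \<Rightarrow> complex \<Rightarrow> complex" where
  "koe_deriv Koe c = deriv (Koe c) 0"

definition expansion_coeffs ::
    "(complex \<Rightarrow> complex \<Rightarrow> complex) \<Rightarrow> (nat \<Rightarrow> complex \<Rightarrow> complex) \<Rightarrow> bool" where
  "expansion_coeffs Koe A \<longleftrightarrow>
     (\<forall>\<^sub>F c in nhds chat. \<forall>\<^sub>F z in nhds 0.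
        (\<lambda>i. A i c * cnj z ^ i) sums Koe c ((acp c ^^ 3) z))"

(* Real-analyticity of a function on the real plane, written with the coordinates h and cnj h
   in place of Re h and Im h; the sum is unconditional, hence absolute.  Real-analyticity at a
   point implies it on a neighbourhood of that point. *)
definition real_analytic_at :: "(complex \<Rightarrow> complex) \<Rightarrow> complex \<Rightarrow> bool" where
  "real_analytic_at F c0 \<longleftrightarrow>
     (\<exists>a :: nat \<Rightarrow> nat \<Rightarrow> complex. \<exists>r>0. \<forall>h. norm h < r \<longrightarrow>
        ((\<lambda>(j, k). a j k * h ^ j * cnj h ^ k) has_sum F (c0 + h)) UNIV)"

(* B chat and Bs chat are determined by A0: they are its two Wirtinger derivatives at chat. *)
definition center_decomposition ::
    "(complex \<Rightarrow> complex) \<Rightarrow> (complex \<Rightarrow> complex) \<Rightarrow> (complex \<Rightarrow> complex) \<Rightarrow> bool" where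
  "center_decomposition A0 B Bs \<longleftrightarrow>
     real_analytic_at B chat \<and> real_analytic_at Bs chat \<and>
     (\<forall>\<^sub>F c in nhds chat. A0 c = (c - chat) * B c + cnj (c - chat) * Bs c)"

(* The condition on the argument is read modulo 2 pi after multiplication by 3; each of the
   three solutions is allowed. *)
definition scaling_constant :: "complex \<Rightarrow> complex \<Rightarrow> bool" where
  "scaling_constant x \<alpha> \<longleftrightarrow>
     norm \<alpha> = norm x \<and> (\<exists>k :: int. 3 * Arg \<alpha> = - Arg x + 2 * pi * of_int k)"

definition renorm :: "nat \<Rightarrow> complex \<Rightarrow> complex \<Rightarrow> complex \<Rightarrow> complex" where
  "renorm n \<alpha> c Z = \<alpha> * (acp c ^^ period n) (Z / \<alpha>)"

definition kn ::
    "(complex \<Rightarrow> complex) \<Rightarrow> (complex \<Rightarrow> complex \<Rightarrow> complex) \<Rightarrow> nat \<Rightarrow> complex \<Rightarrow> complex" where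
  "kn \<beta> Koe n \<alpha> = koe_deriv Koe chat / (\<alpha> * multiplier \<beta> (of_real (cn n)) ^ n)"

definition rho :: "complex \<Rightarrow> complex \<Rightarrow> complex \<Rightarrow> complex \<Rightarrow> complex" where
  "rho k b0 b0s t = k * cnj b0 * t - cnj k * b0s * cnj t"

end

theory Submission
  imports Defs "HOL-Real_Asymp.Real_Asymp"
begin

text \<open>
  Let \<open>G\<close> be the branch of the inverse of \<open>f_c\<^sup>2\<close> that fixes \<open>\<beta>_c\<close>.  It contracts a disc around
  \<open>[0, 2]\<close> by the factor \<open>5\<close>, and its difference quotients are explicit, so quotients of difference
  quotients of \<open>G\<^sup>n\<close> (also for two different parameters) are controlled by a product.
  Writing \<open>u = f_c\<^sup>N(Z / \<alpha>)\<close> and \<open>y = f_c\<^sup>3(Z / \<alpha>)\<close>, one has \<open>G\<^sup>n u = y\<close>, hence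
  \<open>u\<close> is, up to distortion, \<open>(y - G\<^sup>n 0) / (G\<^sup>n)'(0)\<close>.  Since \<open>G\<^sup>n 0 = f_c\<^sup>3(0)\<close> at \<open>c = c_n\<close>, the numerator
  is \<open>-16 (Z / \<alpha>)\<^sup>2\<close> (conjugated) plus the increment of \<open>f_c\<^sup>3(0) - \<beta>_c\<close> between \<open>c_n\<close> and \<open>c\<close>, whose linear
  part is \<open>-224/15 h + 64/15 cnj h\<close>.

  The linearizer enters only through its values at \<open>c = -2\<close>: with \<open>\<kappa> = Koe'(2)\<close>, the functional
  equation gives \<open>A_2 = -16 \<kappa>\<close>, \<open>b_0 = -224/15 \<kappa>\<close>, \<open>b_0\<^sup>* = 64/15 \<kappa>\<close> and
  \<open>Koe'(0) = 16\<^sup>n (G\<^sup>n)'(0) Koe'(G\<^sup>n 0)\<close>.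
\<close>

section \<open>The inverse branch of the second iterate\<close>

text \<open>Nothing is assumed about how \<open>Koe c\<close> varies with \<open>c\<close>: each
  \<open>Koe c\<close> is known only through its functional equation and its values at the fixed
  point and at 0. So no joint Taylor expansion is at hand, and two parameters are compared through
  secant slopes of inverse iterates, where contraction makes the dependence on the base points
  summable. The thresholds 3/4 and 1/2 come from a quadratic error. If S bounds |Z|^2 and |t|, then
  f_c^N(Z / \<alpha>) has order S / 16^n, and its square, rescaled by \<alpha>, has order S^2 /
  16^n. This tends to 0 for S = 4^(\<theta> n) with \<theta> < 1, that is, for 4 (1 - \<delta>) < 1
  and 2 (1 - \<gamma>) < 1.\<close>

definition disc :: "complex set" where "disc = ball 1 (3/2)"

definition inv_branch :: "complex \<Rightarrow> complex \<Rightarrow> complex" where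
  "inv_branch c z = csqrt (csqrt (z - c) - cnj c)"

text \<open>The secant slope of the quartic \<open>acp c ^^ 2\<close> between the two preimages,
  obtained by factoring a difference of squares twice.\<close>

definition slope_inv :: "complex \<Rightarrow> complex \<Rightarrow> complex \<Rightarrow> complex" where
  "slope_inv c x y = (inv_branch c x + inv_branch c y) * (csqrt (x - c) + csqrt (y - c))"

text \<open>
  For \<open>G = inv_branch c\<close>, one has \<open>G\<^sup>n x - G\<^sup>n y = (x - y) * slope c n x y\<close>; on the diagonal,
  \<open>slope c n x x\<close> is the derivative of \<open>G\<^sup>n\<close>.
\<close>

definition slope :: "complex \<Rightarrow> nat \<Rightarrow> complex \<Rightarrow> complex \<Rightarrow> complex" where
  "slope c n x y = (\<Prod>k<n. 1 / slope_inv c ((inv_branch c ^^ k) x) ((inv_branch c ^^ k) y))"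

section \<open>Invariance of the disc and contraction\<close>

lemma Re_csqrt_ge:
  assumes "a\<^sup>2 \<le> Re w" shows "a \<le> Re (csqrt w)"
proof -
  have "a\<^sup>2 \<le> (cmod w + Re w) / 2"
    using assms complex_Re_le_cmod[of w] by (simp only: le_divide_eq) auto
  then show ?thesis
    by (simp add: real_le_rsqrt)
qed

lemma norm_add_ge_Re:
  assumes "a \<le> Re x" "b \<le> Re y" shows "a + b \<le> norm (x + y)"
  using complex_Re_le_cmod[of "x + y"] assms by simp

lemma norm_disc: "z \<in> disc \<Longrightarrow> norm z < 5/2"
  using norm_triangle_ineq[of "z - 1" 1] by (simp add: disc_def dist_norm norm_minus_commute)

text \<open>\<open>inv_branch c\<close> is two such half steps, with e = c and then e = cnj c. The
  disc contains [0, 2] with margin 1/2 and still keeps Re (z - e) at least 13/10 > (9/8)^2, away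
  from the branch cut.\<close>

lemma csqrt_half_step:
  assumes "norm (e + 2) \<le> 1/5" "z \<in> disc"
  shows Re_csqrt_half_step: "9/8 \<le> Re (csqrt (z - e))" and csqrt_half_step_disc: "csqrt (z - e) \<in> disc"
proof -
  have z: "norm (z - 1) < 3/2"
    using assms(2) by (simp add: disc_def dist_norm norm_minus_commute)
  have "Re z \<ge> -1/2" using z abs_Re_le_cmod[of "z - 1"] by simp
  moreover have "Re e \<le> -2 + 1/5" using assms(1) abs_Re_le_cmod[of "e+2"] by simp
  ultimately have "(9/8)\<^sup>2 \<le> Re (z - e)" by (simp add: power2_eq_square)
  then show *: "9/8 \<le> Re (csqrt (z - e))" by (rule Re_csqrt_ge)
  \<comment> \<open>17/10 approximates sqrt 3, the image of the centre 1 for e = -2, and 11/100 = 3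
    - (17/10)^2.\<close>
  let ?w = "csqrt (z - e)"
  have "?w * ?w = z - e"
    by (simp flip: power2_eq_square)
  then have "(?w - 17/10) * (?w + 17/10) = (z - 1) - (e + 2) + 11/100"
    by (simp add: algebra_simps)
  then have "norm (?w - 17/10) * norm (?w + 17/10) = norm ((z - 1) - (e + 2) + 11/100)"
    by (simp only: norm_mult[symmetric])
  also have "\<dots> \<le> norm (z - 1) + norm (e + 2) + norm (11/100 :: complex)"
    by (intro norm_triangle_le add_mono norm_triangle_ineq4) auto
  also have "\<dots> \<le> 3/2 + 1/5 + 11/100" using z assms(1) by simp
  finally have "norm (?w - 17/10) * norm (?w + 17/10) \<le> 2" by simp
  moreover have "norm (?w + 17/10) \<ge> 9/8 + 17/10"
    by (rule norm_add_ge_Re) (use * in auto)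
  then have "norm (?w - 17/10) * (113/40) \<le> norm (?w - 17/10) * norm (?w + 17/10)"
    by (intro mult_left_mono) auto
  ultimately have "norm (?w - 17/10) \<le> 80/113" by simp
  moreover have "norm (?w - 1) \<le> norm (?w - 17/10) + norm (7/10::complex)"
    using norm_triangle_ineq[of "?w - 17/10" "7/10"] by (simp add: algebra_simps)
  ultimately have "norm (?w - 1) < 3/2" by simp
  then show "?w \<in> disc" by (simp add: disc_def dist_norm norm_minus_commute)
qed

lemma cnj_near: "norm (c + 2) \<le> r \<Longrightarrow> norm (cnj c + 2) \<le> r"
  by (metis complex_cnj_add complex_cnj_numeral complex_mod_cnj)

text \<open>The sum of the two roots has norm at least 9/8 + 9/8 = 9/4, whence the factor
  4/9.\<close>

lemma csqrt_half_step_diff: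
  assumes "norm (e + 2) \<le> 1/5" "z \<in> disc" "norm (e' + 2) \<le> 1/5" "z' \<in> disc"
  shows "norm (csqrt (z - e) - csqrt (z' - e')) \<le> 4/9 * (norm (z - z') + norm (e - e'))"
proof -
  let ?a = "csqrt (z - e)" and ?b = "csqrt (z' - e')"
  have "(?a - ?b) * (?a + ?b) = (z - z') - (e - e')"
    by (simp add: algebra_simps flip: power2_eq_square)
  then have "norm (?a - ?b) * norm (?a + ?b) = norm ((z - z') - (e - e'))"
    by (simp only: norm_mult[symmetric])
  also have "\<dots> \<le> norm (z - z') + norm (e - e')" by (rule norm_triangle_ineq4)
  finally have "norm (?a - ?b) * norm (?a + ?b) \<le> norm (z - z') + norm (e - e')" .
  moreover have "9/8 + 9/8 \<le> norm (?a + ?b)"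
    using assms by (intro norm_add_ge_Re Re_csqrt_half_step)
  then have "norm (?a - ?b) * (9/4) \<le> norm (?a - ?b) * norm (?a + ?b)"
    by (intro mult_left_mono) auto
  ultimately show ?thesis by simp
qed

lemma inv_branch_disc:
  assumes "norm (c + 2) \<le> 1/5" "z \<in> disc"
  shows "inv_branch c z \<in> disc" and "9/8 \<le> Re (inv_branch c z)"
  using csqrt_half_step[OF cnj_near[OF assms(1)] csqrt_half_step_disc[OF assms]]
  by (simp_all add: inv_branch_def)

lemma inv_branch_funpow_disc:
  assumes "norm (c + 2) \<le> 1/5" "z \<in> disc"
  shows "(inv_branch c ^^ k) z \<in> disc"
  by (induction k) (use assms inv_branch_disc in auto)

text \<open>Two half steps give (4/9)^2 < 1/5 for the points and 4/9 (4/9 + 1) < 4/5 for the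
  parameters. The weights 1/5 and 4/5 add up to 1, so under iteration the parameter error stays at
  most |c - c'| instead of accumulating.\<close>

lemma inv_branch_diff:
  assumes "norm (c + 2) \<le> 1/5" "x \<in> disc" "norm (c' + 2) \<le> 1/5" "x' \<in> disc"
  shows "norm (inv_branch c x - inv_branch c' x') \<le> norm (x - x') / 5 + 4/5 * norm (c - c')"
proof -
  have "norm (inv_branch c x - inv_branch c' x')
      \<le> 4/9 * (norm (csqrt (x - c) - csqrt (x' - c')) + norm (cnj c - cnj c'))"
    unfolding inv_branch_def using assms
    by (intro csqrt_half_step_diff cnj_near csqrt_half_step_disc)
  also have "norm (cnj c - cnj c') = norm (c - c')"
    by (metis complex_cnj_diff complex_mod_cnj)
  finally show ?thesis using csqrt_half_step_diff[OF assms] norm_ge_zero[of "x - x'"] norm_ge_zero[of "c - c'"]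
    unfolding add_divide_distrib distrib_left by linarith
qed

lemma inv_branch_funpow_diff:
  assumes "norm (c + 2) \<le> 1/5" "x \<in> disc" "norm (c' + 2) \<le> 1/5" "x' \<in> disc"
  shows "norm ((inv_branch c ^^ k) x - (inv_branch c' ^^ k) x') \<le> norm (x - x') / 5 ^ k + norm (c - c')"
proof (induction k)
  case (Suc k)
  have "norm ((inv_branch c ^^ Suc k) x - (inv_branch c' ^^ Suc k) x')
     \<le> norm ((inv_branch c ^^ k) x - (inv_branch c' ^^ k) x') / 5 + 4/5 * norm (c - c')"
    using inv_branch_diff[OF assms(1) inv_branch_funpow_disc assms(3) inv_branch_funpow_disc] assms by simp
  with Suc show ?case by simp
qed simp

section \<open>Secant slopes and their distortion\<close>

lemma norm_slope_inv_ge: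
  assumes "norm (c + 2) \<le> 1/5" "x \<in> disc" "y \<in> disc"
  shows "5 \<le> norm (slope_inv c x y)"
proof -
  have "(9/8+9/8) * (9/8+9/8) \<le> norm (slope_inv c x y)"
    unfolding slope_inv_def norm_mult using assms
    by (intro mult_mono norm_add_ge_Re inv_branch_disc Re_csqrt_half_step) auto
  then show ?thesis by simp
qed

lemma inv_branch_secant:
  "(inv_branch c x - inv_branch c y) * slope_inv c x y = x - y"
proof -
  have "(inv_branch c x - inv_branch c y) * (inv_branch c x + inv_branch c y)
     = csqrt (x - c) - csqrt (y - c)"
    unfolding inv_branch_def by (simp add: algebra_simps flip: power2_eq_square)
  then have "(inv_branch c x - inv_branch c y) * slope_inv c x y 
     = (csqrt (x - c) - csqrt (y - c)) * (csqrt (x - c) + csqrt (y - c))"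
    unfolding slope_inv_def by (metis mult.assoc)
  also have "\<dots> = x - y" by (simp add: algebra_simps flip: power2_eq_square)
  finally show ?thesis .
qed

lemma slope_inv_diff:
  assumes "norm (c + 2) \<le> 1/5" "x \<in> disc" "y \<in> disc" "norm (c' + 2) \<le> 1/5" "x' \<in> disc" "y' \<in> disc"
  shows "norm (slope_inv c x y / slope_inv c' x' y' - 1)
     \<le> norm (x - x') + norm (y - y') + 3 * norm (c - c')"
proof -
  let ?G = "inv_branch c" and ?G' = "inv_branch c'"
  let ?h = "\<lambda>x. csqrt (x - c)" and ?h' = "\<lambda>x. csqrt (x - c')"
  \<comment> \<open>The product rule AB - A'B' = A (B - B') + B' (A - A'). The factors A and B' have
    norm at most 5, which the lower bound 5 for the denominator cancels.\<close>
  have eq: "slope_inv c x y - slope_inv c' x' y' =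
     (?G x + ?G y) * ((?h x - ?h' x') + (?h y - ?h' y')) + (?h' x' + ?h' y') * ((?G x - ?G' x') + (?G y - ?G' y'))"
    unfolding slope_inv_def by algebra
  have "norm (slope_inv c x y - slope_inv c' x' y') \<le>
     (norm (?G x) + norm (?G y)) * (norm (?h x - ?h' x') + norm (?h y - ?h' y'))
     + (norm (?h' x') + norm (?h' y')) * (norm (?G x - ?G' x') + norm (?G y - ?G' y'))"
    unfolding eq by (intro norm_triangle_le add_mono order_trans[OF norm_mult_ineq] mult_mono norm_triangle_ineq) auto
  also have "\<dots> \<le> (5/2 + 5/2) * (4/9 * (norm (x - x') + norm (c - c')) + 4/9 * (norm (y - y') + norm (c - c')))
     + (5/2 + 5/2) * ((norm (x - x') / 5 + 4/5 * norm (c - c')) + (norm (y - y') / 5 + 4/5 * norm (c - c')))"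
    using assms
    by (intro add_mono mult_mono less_imp_le[OF norm_disc] csqrt_half_step_diff inv_branch_diff
        inv_branch_disc csqrt_half_step_disc) auto
  also have "\<dots> \<le> 5 * (norm (x - x') + norm (y - y') + 3 * norm (c - c'))"
    using norm_ge_zero[of "x - x'"] norm_ge_zero[of "y - y'"] norm_ge_zero[of "c - c'"] by (simp add: field_simps)
  finally have *: "norm (slope_inv c x y - slope_inv c' x' y') \<le> 5 * (norm (x - x') + norm (y - y') + 3 * norm (c - c'))" .
  have ge: "5 \<le> norm (slope_inv c' x' y')" using assms by (intro norm_slope_inv_ge)
  then have "slope_inv c' x' y' \<noteq> 0" by auto
  then have "slope_inv c x y / slope_inv c' x' y' - 1 = (slope_inv c x y - slope_inv c' x' y') / slope_inv c' x' y'"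
    by (simp add: field_simps)
  then have "norm (slope_inv c x y / slope_inv c' x' y' - 1) 
     = norm (slope_inv c x y - slope_inv c' x' y') / norm (slope_inv c' x' y')"
    by (simp add: norm_divide)
  also have "\<dots> \<le> (5 * (norm (x - x') + norm (y - y') + 3 * norm (c - c'))) / 5"
    using * ge by (intro frac_le) auto
  finally show ?thesis by simp
qed

lemma slope_nonzero:
  assumes "norm (c + 2) \<le> 1/5" "x \<in> disc" "y \<in> disc"
  shows "slope c n x y \<noteq> 0"
proof -
  have "slope_inv c ((inv_branch c ^^ k) x) ((inv_branch c ^^ k) y) \<noteq> 0" for k
    using norm_slope_inv_ge[OF assms(1) inv_branch_funpow_disc[OF assms(1,2)] inv_branch_funpow_disc[OF assms(1,3)], of k k] by auto
  then show ?thesis by (simp add: slope_def)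
qed

lemma inv_branch_funpow_secant:
  assumes "norm (c + 2) \<le> 1/5" "x \<in> disc" "y \<in> disc"
  shows "(inv_branch c ^^ n) x - (inv_branch c ^^ n) y = (x - y) * slope c n x y"
proof (induction n)
  case (Suc n)
  let ?x = "(inv_branch c ^^ n) x" and ?y = "(inv_branch c ^^ n) y"
  have "slope_inv c ?x ?y \<noteq> 0"
    using norm_slope_inv_ge[OF assms(1) inv_branch_funpow_disc[OF assms(1,2)] inv_branch_funpow_disc[OF assms(1,3)], of n n] by auto
  then have "inv_branch c ?x - inv_branch c ?y = (?x - ?y) / slope_inv c ?x ?y"
    using inv_branch_secant[of c ?x ?y] by (simp add: field_simps)
  with Suc show ?case by (simp add: slope_def)
qed (simp add: slope_def)

text \<open>This cocycle identity lets the tail of the product be estimated from a late orbit point,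
  already close to the fixed point.\<close>

lemma slope_add:
  "slope c (m + n) x y = slope c m x y * slope c n ((inv_branch c ^^ m) x) ((inv_branch c ^^ m) y)"
proof (induction n)
  case (Suc n)
  have "(inv_branch c ^^ (m + n)) z = (inv_branch c ^^ n) ((inv_branch c ^^ m) z)" for z
    by (simp add: add.commute[of m n] funpow_add)
  with Suc show ?case by (simp add: slope_def)
qed (simp add: slope_def)

text \<open>The product is compared with that of the factors 1 + e k, each at most exp (e
  k).\<close>

lemma norm_prod_minus_one_le:
  fixes f :: "nat \<Rightarrow> complex"
  assumes "\<And>k. k < n \<Longrightarrow> norm (f k - 1) \<le> e k"
  shows "norm ((\<Prod>k<n. f k) - 1) \<le> exp (\<Sum>k<n. e k) - 1"
  using assms
proof (induction n)
  case (Suc n)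
  have e: "0 \<le> e n" using Suc.prems[of n] norm_ge_zero order_trans by blast
  have IH: "norm ((\<Prod>k<n. f k) - 1) \<le> exp (\<Sum>k<n. e k) - 1" using Suc by auto
  have "(\<Prod>k<Suc n. f k) - 1 = ((\<Prod>k<n. f k) - 1) * (1 + (f n - 1)) + (f n - 1)"
    by (simp add: algebra_simps)
  then have "norm ((\<Prod>k<Suc n. f k) - 1) \<le> norm ((\<Prod>k<n. f k) - 1) * (1 + norm (f n - 1)) + norm (f n - 1)"
    by (smt (verit) mult_left_mono norm_ge_zero norm_mult norm_one norm_triangle_ineq)
  also have "\<dots> \<le> (exp (\<Sum>k<n. e k) - 1) * (1 + e n) + e n"
    using IH Suc.prems[of n] order_trans[OF norm_ge_zero IH] by (intro add_mono mult_mono) auto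
  also have "\<dots> = exp (\<Sum>k<n. e k) * (1 + e n) - 1" by (simp add: algebra_simps)
  also have "\<dots> \<le> exp (\<Sum>k<n. e k) * exp (e n) - 1"
    by (intro diff_right_mono mult_left_mono exp_ge_add_one_self) auto
  finally show ?case by (simp add: exp_add)
qed simp

text \<open>
  All asymptotic comparisons below are instances of this distortion bound.  It is uniform in \<open>n\<close>
  apart from the term \<open>n * norm (c - c')\<close>, which is exponentially small for the parameters that
  occur.
\<close>

lemma slope_distortion:
  assumes "norm (c + 2) \<le> 1/5" "x \<in> disc" "y \<in> disc" "norm (c' + 2) \<le> 1/5" "x' \<in> disc" "y' \<in> disc"
  shows "norm (slope c n x y / slope c' n x' y' - 1)
     \<le> exp (2 * (norm (x - x') + norm (y - y')) + 5 * real n * norm (c - c')) - 1"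
proof -
  let ?s = "\<lambda>k. slope_inv c ((inv_branch c ^^ k) x) ((inv_branch c ^^ k) y)"
  let ?s' = "\<lambda>k. slope_inv c' ((inv_branch c' ^^ k) x') ((inv_branch c' ^^ k) y')"
  \<comment> \<open>The 5 is 1 + 1 + 3: one |c - c'| from each of the two orbits and three from
    \<open>slope_inv_diff\<close>. This part does not decay in k and causes the factor n.\<close>
  let ?e = "\<lambda>k. (norm (x - x') + norm (y - y')) / 5 ^ k + 5 * norm (c - c')"
  \<comment> \<open>Slopes are products of reciprocals, so the primed factors end up in the
    numerator.\<close>
  have *: "norm (?s' k / ?s k - 1) \<le> ?e k" for k
  proof -
    have "norm (?s' k / ?s k - 1) \<le> norm ((inv_branch c' ^^ k) x' - (inv_branch c ^^ k) x) + norm ((inv_branch c' ^^ k) y' - (inv_branch c ^^ k) y) + 3 * norm (c' - c)"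
      using assms by (intro slope_inv_diff inv_branch_funpow_disc)
    also have "\<dots> \<le> (norm (x' - x) / 5 ^ k + norm (c' - c)) + (norm (y' - y) / 5 ^ k + norm (c' - c)) + 3 * norm (c' - c)"
      using assms by (intro add_mono inv_branch_funpow_diff order_refl)
    finally show ?thesis by (simp add: norm_minus_commute add_divide_distrib)
  qed
  have eq: "slope c n x y / slope c' n x' y' = (\<Prod>k<n. ?s' k / ?s k)"
    unfolding slope_def by (simp add: prod_dividef[symmetric])
  have 1: "norm (slope c n x y / slope c' n x' y' - 1) \<le> exp (\<Sum>k<n. ?e k) - 1"
    unfolding eq by (rule norm_prod_minus_one_le[where f = "\<lambda>k. ?s' k / ?s k" and e = ?e]) (rule *)
  have 2: "(\<Sum>k<n. ?e k) \<le> 2 * (norm (x - x') + norm (y - y')) + 5 * real n * norm (c - c')"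
  proof -
    have "(\<Sum>k<n. ?e k) = (norm (x - x') + norm (y - y')) * (\<Sum>k<n. (1/5) ^ k) + 5 * real n * norm (c - c')"
      by (simp add: sum.distrib sum_distrib_left power_divide)
    moreover have "(\<Sum>k<n. (1/5::real) ^ k) \<le> 2"
      unfolding sum_gp_strict by (simp add: diff_le_eq)
    then have "(norm (x - x') + norm (y - y')) * (\<Sum>k<n. (1/5) ^ k) \<le> (norm (x - x') + norm (y - y')) * 2"
      by (intro mult_left_mono) auto
    ultimately show ?thesis by simp
  qed
  show ?thesis
    by (rule order_trans[OF 1 diff_right_mono]) (use 2 in simp)
qed

lemma exp_minus_one_le: "0 \<le> x \<Longrightarrow> x \<le> 1 \<Longrightarrow> exp x - 1 \<le> 2 * (x::real)"
proof -
  assume a: "0 \<le> x" "x \<le> 1"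
  have "exp x \<le> 1 + x + x\<^sup>2" using a exp_bound by blast
  moreover have "x\<^sup>2 \<le> x" using a by (simp add: power2_eq_square mult_left_le)
  ultimately show ?thesis by linarith
qed

lemma slope_distortion_linear:
  assumes "norm (c + 2) \<le> 1/5" "x \<in> disc" "y \<in> disc" "norm (c' + 2) \<le> 1/5" "x' \<in> disc" "y' \<in> disc"
    and "2 * (norm (x - x') + norm (y - y')) + 5 * real n * norm (c - c') \<le> d" "d \<le> 1"
  shows "norm (slope c n x y / slope c' n x' y' - 1) \<le> 2 * d"
proof -
  have "norm (slope c n x y / slope c' n x' y' - 1) \<le> exp d - 1"
    using slope_distortion[OF assms(1-6), of n] assms(7) by (smt (verit) exp_le_cancel_iff)
  also have "\<dots> \<le> 2 * d"
    by (intro exp_minus_one_le assms(8) order_trans[OF _ assms(7)]) auto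
  finally show ?thesis .
qed

section \<open>Iterates of f_c and the fixed point\<close>

lemma acp2: "(acp c ^^ 2) z = (z\<^sup>2 + cnj c)\<^sup>2 + c"
  by (simp add: numeral_2_eq_2 acp_def)

lemma acp2_inv_branch: "(acp c ^^ 2) (inv_branch c z) = z"
  unfolding acp2 inv_branch_def by simp

lemma acp2_funpow_inv_branch: "(acp c ^^ (2 * n)) ((inv_branch c ^^ n) z) = z"
proof (induction n)
  case (Suc n)
  have "(acp c ^^ (2 * Suc n)) ((inv_branch c ^^ Suc n) z)
      = (acp c ^^ (2 * n)) ((acp c ^^ 2) (inv_branch c ((inv_branch c ^^ n) z)))"
    by (simp add: funpow_swap1 numeral_2_eq_2)
  then show ?case using Suc acp2_inv_branch by simp
qed simp

lemma inv_branch_acp2: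
  assumes "0 < Re z" "0 < Re (z\<^sup>2 + cnj c)"
  shows "inv_branch c ((acp c ^^ 2) z) = z"
  unfolding acp2 inv_branch_def using assms by (simp add: csqrt_square)

text \<open>The third iterate in the variable w = (cnj z)^2, in which it is a polynomial; the
  antiholomorphic dependence on z is confined to w.\<close>

definition third :: "complex \<Rightarrow> complex \<Rightarrow> complex" where
  "third c w = ((w + c)\<^sup>2 + cnj c)\<^sup>2 + c"

lemma acp3: "(acp c ^^ 3) z = third c ((cnj z)\<^sup>2)"
  by (simp add: numeral_3_eq_3 acp_def third_def)

text \<open>The radius 1/8 keeps b in the disc and in the right half plane, where
  \<open>inv_branch\<close> inverts, and makes b unique: take c = c' in
  \<open>fixpt_Lipschitz\<close>.\<close>

definition fixpt :: "complex \<Rightarrow> complex \<Rightarrow> bool" where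
  "fixpt c b \<longleftrightarrow> acp c b = b \<and> norm (b - 2) \<le> 1/8"

lemma fixpt_disc: "fixpt c b \<Longrightarrow> b \<in> disc"
  using norm_triangle_ineq[of "b - 2" 1] by (simp add: fixpt_def disc_def dist_norm norm_minus_commute)

lemma fixpt_Re: "fixpt c b \<Longrightarrow> 0 < Re b"
  using abs_Re_le_cmod[of "b - 2"] unfolding fixpt_def by auto

lemma fixpt_cnj: "fixpt c b \<Longrightarrow> b\<^sup>2 + cnj c = cnj b"
  by (metis acp_def complex_cnj_add complex_cnj_cnj complex_cnj_power fixpt_def)

lemma inv_branch_fixpt: assumes "fixpt c b" shows "inv_branch c b = b"
proof -
  have "0 < Re (b\<^sup>2 + cnj c)"
    by (simp only: fixpt_cnj[OF assms] cnj.sel fixpt_Re[OF assms])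
  then have "inv_branch c ((acp c ^^ 2) b) = b"
    by (intro inv_branch_acp2 fixpt_Re[OF assms])
  moreover have "(acp c ^^ 2) b = b"
    using assms by (simp add: fixpt_def numeral_2_eq_2)
  ultimately show ?thesis by simp
qed

lemma inv_branch_funpow_fixpt: assumes "fixpt c b" shows "(inv_branch c ^^ n) b = b"
  by (induction n) (simp_all add: inv_branch_fixpt[OF assms])

text \<open>Since 4 b cnj b is the multiplier at b, powers of multipliers at different parameters
  can be compared by the distortion bound.\<close>

lemma slope_fixpt: assumes "fixpt c b" shows "slope c n b b = 1 / (4 * b * cnj b) ^ n"
proof -
  have "csqrt (b - c) = cnj b"
  proof -
    have "b - c = (cnj b)\<^sup>2"
      using assms unfolding fixpt_def acp_def by (metis add_diff_cancel_right')
    then show ?thesis using fixpt_Re[OF assms] by (simp add: csqrt_square)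
  qed
  then show ?thesis
    by (simp add: slope_def inv_branch_funpow_fixpt[OF assms] slope_inv_def inv_branch_fixpt[OF assms]
        power_one_over power_mult_distrib flip: power_add)
qed

lemma fixpt_chat: "fixpt (-2) 2"
  by (simp add: fixpt_def acp_def)

text \<open>Subtracting the fixed point equations gives |b - b'| |b + b'| \<le> |b - b'| + |c - c'|,
  and |b + b'| is close to 4, hence at least 3.\<close>

lemma fixpt_Lipschitz:
  assumes "fixpt c b" "fixpt c' b'"
  shows "norm (b - b') \<le> norm (c - c') / 2"
proof -
  have "b - b' = cnj ((b - b') * (b + b')) + (c - c')"
    using assms unfolding fixpt_def acp_def by (simp add: algebra_simps power2_eq_square) 
  then have "norm ((b - b') * (b + b')) = norm ((b - b') - (c - c'))"
    by (metis add_diff_cancel_right' complex_mod_cnj)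
  also have "\<dots> \<le> norm (b - b') + norm (c - c')" by (rule norm_triangle_ineq4)
  finally have "norm (b - b') * norm (b + b') \<le> norm (b - b') + norm (c - c')" by (simp add: norm_mult)
  moreover have "15/8 + 15/8 \<le> norm (b + b')"
    using assms abs_Re_le_cmod[of "b - 2"] abs_Re_le_cmod[of "b' - 2"] by (intro norm_add_ge_Re) (auto simp: fixpt_def)
  then have "norm (b - b') * 3 \<le> norm (b - b') * norm (b + b')" by (intro mult_left_mono) auto
  ultimately show ?thesis by simp
qed

section \<open>The real parameters\<close>

definition real_orbit :: "real \<Rightarrow> nat \<Rightarrow> real" where
  "real_orbit c k = ((\<lambda>x. x\<^sup>2 + c) ^^ k) 0"

lemma real_orbit_simps:
  "real_orbit c 0 = 0" "real_orbit c (Suc k) = (real_orbit c k)\<^sup>2 + c"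
  by (simp_all add: real_orbit_def)

lemma quadp_funpow_of_real: "(quadp (of_real c) ^^ k) 0 = of_real (real_orbit c k)"
  by (induction k) (simp_all add: quadp_def real_orbit_simps)

lemma continuous_on_real_orbit: "continuous_on S (\<lambda>c. real_orbit c k)"
  by (induction k) (auto simp: real_orbit_simps intro!: continuous_intros)

lemma real_orbit_minus_two: "real_orbit (-2) (Suc (Suc k)) = 2"
  by (induction k) (simp_all add: real_orbit_simps)

text \<open>Below -2 the critical orbit never returns to 0, so no root of any period lies
  there.\<close>

lemma abs_real_orbit_ge:
  assumes "c < -2" shows "-c \<le> \<bar>real_orbit c (Suc k)\<bar>"
proof (induction k)
  case (Suc k)
  have "(-c) * (-c) \<le> \<bar>real_orbit c (Suc k)\<bar> * \<bar>real_orbit c (Suc k)\<bar>"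
    using assms Suc by (intro mult_mono) auto
  then have "(-c) * (-c) \<le> (real_orbit c (Suc k))\<^sup>2"
    by (simp only: abs_mult_self_eq power2_eq_square)
  moreover have "(-c) * 2 \<le> (-c) * (-c)" using assms by (intro mult_left_mono) auto
  ultimately have "- c \<le> (real_orbit c (Suc k))\<^sup>2 + c" by linarith
  then show ?case unfolding real_orbit_simps(2)[of c "Suc k"] by linarith
qed (use assms in \<open>simp add: real_orbit_simps\<close>)

lemma finite_real_orbit_zeros: "finite {c. real_orbit c (Suc k) = 0}"
proof -
  define p :: "nat \<Rightarrow> real poly" where "p k = ((\<lambda>q. q\<^sup>2 + [:0, 1:]) ^^ k) 0" for k
  have p: "poly (p k) c = real_orbit c k" for k c
    by (induction k) (simp_all add: p_def real_orbit_simps)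
  \<comment> \<open>The critical orbit of -2 is 0, -2, 2, 2, ..., so -2 is never a root and the
    polynomial is nonzero.\<close>
  have "poly (p (Suc k)) (-2) \<noteq> 0"
    unfolding p by (cases k) (simp_all add: real_orbit_minus_two real_orbit_simps(1) real_orbit_simps(2)[of _ 0])
  then have "p (Suc k) \<noteq> 0" by auto
  then show ?thesis using poly_roots_finite[of "p (Suc k)"] by (simp add: p)
qed

text \<open>
  If the \<open>m\<close>-th iterate vanishes at \<open>c\<close>, then the next one equals \<open>c < 0\<close> there, but \<open>2\<close> at \<open>-2\<close>.
  Hence a minimal root for the period has a critical orbit that is positive from the second
  iterate on, which selects the branch \<^const>\<open>inv_branch\<close>.
\<close>

lemma real_orbit_zero_descent:
  assumes "real_orbit c (Suc (Suc k)) = 0" "-2 < c" "c < 0"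
  shows "\<exists>c'. -2 < c' \<and> c' \<le> c \<and> (0 < i \<longrightarrow> c' < c) \<and> real_orbit c' (Suc (Suc (k + i))) = 0"
proof (induction i)
  case 0
  then show ?case using assms by auto
next
  case (Suc i)
  then obtain c' where c': "-2 < c'" "c' \<le> c" "real_orbit c' (Suc (Suc (k + i))) = 0" by blast
  let ?f = "\<lambda>x. real_orbit x (Suc (Suc (k + Suc i)))"
  have f: "?f (-2) = 2" "?f c' = c'"
    using c'(3) by (simp_all add: real_orbit_minus_two real_orbit_simps(2)[of c' "Suc (Suc (k + i))"])
  have "\<exists>x\<ge>-2. x \<le> c' \<and> ?f x = 0"
    using f c' assms(3) by (intro IVT2' continuous_on_real_orbit) auto
  then obtain x where x: "-2 \<le> x" "x \<le> c'" "?f x = 0" by blast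
  have "x \<noteq> -2" "x \<noteq> c'" using f x(3) c' assms(3) by auto
  then show ?case using x c' by (intro exI[of _ x]) auto
qed

lemma cn_eq: "cn n = Min {c. real_orbit c (period n) = 0}"
  unfolding cn_def quadp_funpow_of_real by simp

lemma
  assumes "1 \<le> n"
  shows cn_zero: "real_orbit (cn n) (period n) = 0"
    and cn_gt: "-2 < cn n" and cn_less: "cn n < -1"
    and cn_orbit_pos: "2 \<le> k \<Longrightarrow> k < period n \<Longrightarrow> 0 < real_orbit (cn n) k"
proof -
  let ?Z = "{c. real_orbit c (period n) = 0}"
  have N: "period n = Suc (Suc (Suc (2 * n)))" by (simp add: period_def)
  have fin: "finite ?Z" unfolding N by (rule finite_real_orbit_zeros)
  \<comment> \<open>At -1 the second iterate vanishes; 2n + 1 descents from there reach the period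
    with a root strictly below -1.\<close>
  obtain c1 where c1: "c1 < -1" "real_orbit c1 (period n) = 0"
    using real_orbit_zero_descent[of "-1" 0 "Suc (2 * n)"] unfolding N by (auto simp: real_orbit_simps)
  have mem: "cn n \<in> ?Z" unfolding cn_eq by (rule Min_in) (use fin c1 in auto)
  then show zero: "real_orbit (cn n) (period n) = 0" by simp
  have le: "cn n \<le> c" if "real_orbit c (period n) = 0" for c
    unfolding cn_eq by (rule Min_le) (use fin that in auto)
  show less: "cn n < -1" using le[OF c1(2)] c1(1) by simp
  have "\<not> cn n < -2"
    using abs_real_orbit_ge[of "cn n" "Suc (Suc (2 * n))"] zero unfolding N by auto
  moreover have "cn n \<noteq> -2"
    using real_orbit_minus_two[of "Suc (2 * n)"] zero unfolding N by auto
  ultimately show gt: "-2 < cn n" by simp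
  show "0 < real_orbit (cn n) k" if k: "2 \<le> k" "k < period n" for k
  \<comment> \<open>Otherwise the k-th iterate, equal to 2 at -2, has a root in (-2,
    \<open>cn n\<close>], from which the descent yields a smaller root for the period, against
    minimality.\<close>
  proof (rule ccontr)
    assume neg: "\<not> 0 < real_orbit (cn n) k"
    obtain j where j: "k = Suc (Suc j)" using k(1) by (metis add_2_eq_Suc le_Suc_ex)
    have "\<exists>x\<ge>-2. x \<le> cn n \<and> real_orbit x k = 0"
      using neg gt unfolding j by (intro IVT2' continuous_on_real_orbit) (auto simp: real_orbit_minus_two)
    then obtain x where x: "-2 \<le> x" "x \<le> cn n" "real_orbit x k = 0" by blast
    have "x \<noteq> -2" using x(3) real_orbit_minus_two unfolding j by auto
    then obtain c' where "c' < x" "real_orbit c' (Suc (Suc (j + (period n - k)))) = 0"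
      using real_orbit_zero_descent[of x j "period n - k"] x less k unfolding j by auto
    moreover have "Suc (Suc (j + (period n - k))) = period n" using j k by simp
    ultimately show False using le x by fastforce
  qed
qed

lemma inv_branch_of_real_square:
  assumes "0 < x" "0 < x\<^sup>2 + c"
  shows "inv_branch (of_real c) (of_real ((x\<^sup>2 + c)\<^sup>2 + c)) = of_real x"
  using inv_branch_acp2[of "of_real x" "of_real c"] assms
  by (simp add: acp2 power2_eq_square)

text \<open>The critical orbit is run backwards from its return to 0, two iterates at a time. Both
  iterates passed are positive, so each backward step is \<open>inv_branch\<close>; after n steps
  the third iterate remains.\<close>

lemma inv_branch_funpow_cn:
  assumes "1 \<le> n"
  shows "(inv_branch (of_real (cn n)) ^^ n) 0 = third (of_real (cn n)) 0"
proof -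
  let ?c = "cn n"
  have *: "(inv_branch (of_real ?c) ^^ j) 0 = of_real (real_orbit ?c (period n - 2 * j))" if "j \<le> n" for j
    using that
  proof (induction j)
    case 0
    then show ?case using cn_zero[OF assms] by simp
  next
    case (Suc j)
    let ?k = "period n - 2 * Suc j"
    have k: "2 \<le> ?k" "Suc ?k < period n" "period n - 2 * j = Suc (Suc ?k)"
      using Suc.prems by (auto simp: period_def)
    have "0 < real_orbit ?c ?k" "0 < real_orbit ?c (Suc ?k)"
      using k by (auto intro!: cn_orbit_pos[OF assms])
    then show ?case
      using Suc.IH Suc.prems inv_branch_of_real_square[of "real_orbit ?c ?k" ?c]
      by (simp add: k(3) real_orbit_simps)
  qed
  have "period n - 2 * n = Suc (Suc (Suc 0))" by (simp add: period_def)
  then show ?thesis using *[OF order_refl] by (simp add: third_def real_orbit_simps)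
qed

text \<open>The distance of the critical orbit to the positive fixed point b at least doubles at
  each step from iterate 2 to iterate 2n + 3, where it equals b \<le> 2. So iterate 2 was within
  4^(-n) of b, and this bounds c + 2.\<close>

lemma cn_near_minus_two:
  assumes "1 \<le> n"
  shows "cn n + 2 \<le> 1 / 4 ^ n"
proof -
  define c where "c = cn n"
  have c: "-2 < c" "c < -1" using cn_gt cn_less assms by (auto simp: c_def)
  \<comment> \<open>The positive fixed point of x^2 + c; from c < -1, 11/5 < sqrt 5 gives b \<ge>
    8/5.\<close>
  define b where "b = (1 + sqrt (1 - 4 * c)) / 2"
  have "(11/5)\<^sup>2 \<le> 1 - 4 * c" using c by (simp add: power2_eq_square)
  then have "11/5 \<le> sqrt (1 - 4 * c)" by (rule real_le_rsqrt)
  moreover have "sqrt (1 - 4 * c) \<le> 3" using c by (intro real_le_lsqrt) auto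
  ultimately have b: "8/5 \<le> b" "b \<le> 2" by (auto simp: b_def)
  have "(sqrt (1 - 4 * c))\<^sup>2 = 1 - 4 * c" using c by simp
  then have cb: "c = b - b\<^sup>2" by (simp add: b_def power2_eq_square field_simps)
  let ?x = "real_orbit c"
  \<comment> \<open>A nonnegative next iterate forces the square of this one to be at least -c >
    1.\<close>
  have ge1: "1 \<le> ?x k" if "2 \<le> k" "Suc k \<le> period n" for k
  proof -
    have "0 \<le> ?x (Suc k)"
      using cn_orbit_pos[OF assms, of "Suc k"] cn_zero[OF assms] that
      by (cases "Suc k = period n") (auto simp: c_def)
    then have "1\<^sup>2 \<le> (?x k)\<^sup>2" using c by (simp add: real_orbit_simps)
    moreover have "0 < ?x k" using cn_orbit_pos[OF assms, of k] that by (simp add: c_def)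
    ultimately show ?thesis by (intro power2_le_imp_le[of 1]) auto
  qed
  have "2 ^ j * \<bar>b - ?x 2\<bar> \<le> \<bar>b - ?x (j + 2)\<bar>" if "j + 2 \<le> period n" for j
    using that
  proof (induction j)
    case (Suc j)
    have "b - ?x (Suc j + 2) = (b - ?x (j + 2)) * (b + ?x (j + 2))"
      using cb by (simp add: real_orbit_simps algebra_simps power2_eq_square)
    then have "\<bar>b - ?x (Suc j + 2)\<bar> = \<bar>b - ?x (j + 2)\<bar> * \<bar>b + ?x (j + 2)\<bar>" by (simp only: abs_mult)
    moreover have "\<bar>b - ?x (j + 2)\<bar> * 2 \<le> \<bar>b - ?x (j + 2)\<bar> * \<bar>b + ?x (j + 2)\<bar>"
      using ge1[of "j + 2"] Suc.prems b by (intro mult_left_mono) auto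
    moreover have "2 ^ j * \<bar>b - ?x 2\<bar> \<le> \<bar>b - ?x (j + 2)\<bar>" using Suc by simp
    ultimately show ?case unfolding power_Suc by linarith
  qed (simp add: numeral_2_eq_2)
  from this[of "2 * n + 1"] have "2 * (4 ^ n * \<bar>b - ?x 2\<bar>) \<le> b"
    using cn_zero[OF assms] b by (simp add: period_def c_def power_mult numeral_3_eq_3)
  then have le: "\<bar>b - ?x 2\<bar> \<le> 1 / 4 ^ n" using b by (simp add: field_simps)
  \<comment> \<open>With c = b - b^2 one has c + 2 = (2 - b) (1 + b), and b minus the second iterate
    is b^3 (2 - b).\<close>
  have "(c + 2) * b ^ 3 = (1 + b) * (b - ?x 2)"
    unfolding cb by (simp add: real_orbit_simps numeral_2_eq_2 numeral_3_eq_3 algebra_simps)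
  also have "\<dots> \<le> (1 + b) * \<bar>b - ?x 2\<bar>" using b by (intro mult_left_mono) auto
  also have "\<dots> \<le> b ^ 3 * \<bar>b - ?x 2\<bar>"
  proof (intro mult_right_mono)
    have "(8/5) * (8/5) * b \<le> b * b * b" using b by (intro mult_right_mono mult_mono) auto
    then show "1 + b \<le> b ^ 3" using b unfolding power3_eq_cube by linarith
  qed simp
  finally have "(c + 2) * b ^ 3 \<le> \<bar>b - ?x 2\<bar> * b ^ 3" by (simp only: mult.commute)
  then have "c + 2 \<le> \<bar>b - ?x 2\<bar>" using b by (simp add: mult_le_cancel_right)
  then show ?thesis using le c_def by simp
qed

section \<open>Expansions near the limit parameter\<close>

lemma fixed_point_branch_fixpt:
  assumes "fixed_point_branch \<beta>"
  shows "\<beta> (-2) = 2" and "\<forall>\<^sub>F c in nhds (-2). fixpt c (\<beta> c)"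
proof -
  show 2: "\<beta> (-2) = 2" using assms by (simp add: fixed_point_branch_def)
  have ev: "\<forall>\<^sub>F c in nhds (-2). isCont \<beta> c \<and> acp c (\<beta> c) = \<beta> c"
    using assms by (simp add: fixed_point_branch_def)
  then have "isCont \<beta> (-2)" by (auto dest: eventually_nhds_x_imp_x)
  then have "(\<beta> \<longlongrightarrow> 2) (nhds (-2))" 
    using tendsto_at_iff_tendsto_nhds[of \<beta> "-2"] 2 by (simp add: isCont_def)
  then have "\<forall>\<^sub>F c in nhds (-2). dist (\<beta> c) 2 < 1/8" by (rule tendstoD) simp
  with ev show "\<forall>\<^sub>F c in nhds (-2). fixpt c (\<beta> c)"
    by eventually_elim (auto simp: fixpt_def dist_norm)
qed

lemma multiplier_fixpt:
  assumes "fixpt c (\<beta> c)"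
  shows "multiplier \<beta> c = 4 * \<beta> c * cnj (\<beta> c)"
proof -
  have "(acp c ^^ 2) = (\<lambda>z. (z\<^sup>2 + cnj c)\<^sup>2 + c)" by (rule ext) (rule acp2)
  moreover have "((\<lambda>z. (z\<^sup>2 + cnj c)\<^sup>2 + c) has_field_derivative 4 * z * (z\<^sup>2 + cnj c)) (at z)" for z
    by (auto intro!: derivative_eq_intros)
  ultimately show ?thesis
    unfolding multiplier_def fixpt_cnj[OF assms, symmetric] by (simp only:) (rule DERIV_imp_deriv)
qed

lemma third_expansion:
  assumes "norm (c + 2) \<le> 1/5" "norm w \<le> 1"
  shows "norm (third c w - third c 0 + 16 * w) \<le> 70 * norm w * (norm (c + 2) + norm w)"
proof -
  define h where "h = c + 2"
  \<comment> \<open>\<open>third c w - third c 0\<close> is w times two factors that equal -4 and 4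
    at c = -2, w = 0; \<open>a\<close> and \<open>b\<close> are their deviations from these
    values.\<close>
  define a where "a = 2 * h + w"
  define b where "b = 2 * h * h - 8 * h + 2 * cnj h + 2 * h * w - 4 * w + w * w"
  have h: "norm h \<le> 1/5" using assms by (simp add: h_def)
  have c: "c = h - 2" by (simp add: h_def)
  have a: "norm a \<le> 2 * norm h + norm w"
    unfolding a_def by (rule order_trans[OF norm_triangle_ineq]) (simp add: norm_mult)
  have "norm b \<le> norm (2 * h * h) + norm (8 * h) + norm (2 * cnj h) + norm (2 * h * w) + norm (4 * w) + norm (w * w)"
    unfolding b_def by (intro norm_triangle_le add_mono norm_triangle_le_diff order_refl)
  also have "\<dots> = 2 * (norm h * norm h) + 10 * norm h + 2 * (norm h * norm w) + 4 * norm w + norm w * norm w"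
    by (simp add: norm_mult)
  also have "\<dots> \<le> 2 * (1/5 * norm h) + 10 * norm h + 2 * (1/5 * norm w) + 4 * norm w + 1 * norm w"
    using h assms(2) by (intro add_mono mult_left_mono mult_right_mono order_refl) auto
  also have "\<dots> \<le> 11 * norm h + 6 * norm w"
    using norm_ge_zero[of h] norm_ge_zero[of w] by linarith
  finally have b: "norm b \<le> 11 * norm h + 6 * norm w" .
  have "third c w - third c 0 + 16 * w = w * (4 * a - 4 * b + a * b)"
    unfolding third_def a_def b_def c by (simp add: power2_eq_square) algebra
  then have eq: "norm (third c w - third c 0 + 16 * w) = norm w * norm (4 * a - 4 * b + a * b)"
    by (simp add: norm_mult)
  have "norm (4 * a - 4 * b + a * b) \<le> norm (4 * a) + norm (4 * b) + norm (a * b)"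
    by (intro norm_triangle_le add_mono norm_triangle_ineq4 order_refl)
  also have "\<dots> = 4 * norm a + 4 * norm b + norm a * norm b" by (simp add: norm_mult)
  also have "\<dots> \<le> 4 * norm a + 4 * norm b + 3/2 * norm b"
    using a h assms(2) by (intro add_mono mult_right_mono order_refl) auto
  also have "\<dots> \<le> 70 * (norm h + norm w)" using a b norm_ge_zero[of h] norm_ge_zero[of w]
    unfolding distrib_left by linarith
  finally have "norm (4 * a - 4 * b + a * b) \<le> 70 * (norm h + norm w)" .
  from mult_left_mono[OF this, of "norm w"] show ?thesis
    unfolding eq h_def[symmetric] by (simp only: norm_ge_zero mult.left_commute mult.assoc)
qed

text \<open>To first order in r = c - c', \<open>third c 0\<close> changes by -15 r + 4 cnj r. The
  change d of the fixed point solves d = 4 cnj d + r, so d = -(r + 4 cnj r) / 15. Subtracting gives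
  the coefficients -224/15 and 64/15.\<close>

lemma third_fixpt_expansion:
  assumes "fixpt c b" "fixpt c' b'" "norm (c + 2) \<le> H" "norm (c' + 2) \<le> H" "H \<le> 1/5"
  shows "norm ((third c 0 - b) - (third c' 0 - b') - (- 224/15 * (c - c') + 64/15 * cnj (c - c')))
     \<le> 71 * H * norm (c - c')"
proof -
  define h h' r where "h = c + 2" and "h' = c' + 2" and "r = c - c'"
  have hh: "norm h \<le> H" "norm h' \<le> H" using assms by (auto simp: h_def h'_def)
  have c: "c = h - 2" "c' = h' - 2" "h = h' + r" by (auto simp: h_def h'_def r_def)
  have H: "0 \<le> H" using hh norm_ge_zero order_trans by blast
  \<comment> \<open>The values of c^2 + cnj c at the two parameters have difference cnj r - 4 r +
    \<open>e1\<close> and sum 4 + \<open>e2\<close>; their product is the difference of the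
    squares.\<close>
  define e1 where "e1 = (h + h') * r"
  define e2 where "e2 = cnj h + cnj h' - 4 * h - 4 * h' + h * h + h' * h'"
  have e1: "norm e1 \<le> 2 * H * norm r"
    unfolding e1_def norm_mult by (intro mult_right_mono norm_triangle_le) (use hh in auto)
  have "norm e2 \<le> norm (cnj h) + norm (cnj h') + norm (4 * h) + norm (4 * h') + norm (h * h) + norm (h' * h')"
    unfolding e2_def by (intro norm_triangle_le norm_triangle_le_diff add_mono order_refl)
  also have "\<dots> = norm h + norm h' + 4 * norm h + 4 * norm h' + norm h * norm h + norm h' * norm h'"
    by (simp add: norm_mult)
  also have "\<dots> \<le> H + H + 4 * H + 4 * H + 1/5 * H + 1/5 * H"
    using hh assms(5) by (intro add_mono mult_mono order_refl) auto
  also have "\<dots> \<le> 11 * H" using H by simp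
  finally have e2: "norm e2 \<le> 11 * H" .
  define E where "E = 4 * e1 + e2 * (cnj r - 4 * r + e1)"
  have third: "third c 0 - third c' 0 = - 15 * r + 4 * cnj r + E"
    unfolding third_def E_def e1_def e2_def c by (simp add: power2_eq_square) algebra
  have "norm (cnj r - 4 * r + e1) \<le> norm (cnj r) + norm (4 * r) + norm e1"
    by (intro norm_triangle_le add_mono norm_triangle_ineq4 order_refl)
  also have "\<dots> \<le> norm r + 4 * norm r + 2/5 * norm r"
    using e1 mult_right_mono[OF assms(5), of "norm r"] by (simp add: norm_mult)
  finally have 1: "norm (cnj r - 4 * r + e1) \<le> 27/5 * norm r" by simp
  have "norm E \<le> 4 * norm e1 + norm e2 * norm (cnj r - 4 * r + e1)"
    unfolding E_def by (rule order_trans[OF norm_triangle_ineq]) (simp add: norm_mult)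
  also have "\<dots> \<le> 4 * (2 * H * norm r) + 11 * H * (27/5 * norm r)"
    using e1 e2 1 H by (intro add_mono mult_mono) auto
  also have "\<dots> \<le> 70 * H * norm r" using mult_nonneg_nonneg[OF H norm_ge_zero[of r]] by simp
  finally have E: "norm E \<le> 70 * H * norm r" .
  define d f where "d = b - b'" and "f = b + b' - 4"
  have d: "norm d \<le> norm r / 2" using fixpt_Lipschitz[OF assms(1,2)] by (simp add: d_def r_def)
  have "norm (b - 2) \<le> H / 2" "norm (b' - 2) \<le> H / 2"
    using fixpt_Lipschitz[OF assms(1) fixpt_chat] fixpt_Lipschitz[OF assms(2) fixpt_chat] assms(3,4) by auto
  then have f: "norm f \<le> H"
    using norm_triangle_ineq[of "b - 2" "b' - 2"] by (simp add: f_def algebra_simps)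
  have deq: "d = cnj d * cnj (4 + f) + r"
    using assms(1,2) unfolding fixpt_def acp_def d_def f_def r_def by (simp add: algebra_simps power2_eq_square)
  \<comment> \<open>The equation is only real linear in d. Substituting its conjugate eliminates cnj
    d and leaves the coefficient 1 - 16 = -15.\<close>
  then have "cnj d = d * (4 + f) + cnj r"
    by (metis complex_cnj_add complex_cnj_cnj complex_cnj_mult)
  with deq have "d = (d * (4 + f) + cnj r) * 4 + cnj d * cnj f + r"
    by (simp add: algebra_simps)
  then have d2: "d = - (r + 4 * cnj r + 4 * (d * f) + cnj (d * f)) / 15"
    by (simp add: field_simps add_eq_0_iff)
  have "norm (4 * (d * f) + cnj (d * f)) \<le> 5 * (norm d * norm f)"
    by (rule order_trans[OF norm_triangle_ineq]) (simp add: norm_mult)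
  also have "\<dots> \<le> 5 * (norm r / 2 * H)" using d f by (intro mult_left_mono mult_mono) auto
  finally have F: "norm ((4 * (d * f) + cnj (d * f)) / 15) \<le> H * norm r"
    using mult_nonneg_nonneg[OF H norm_ge_zero[of r]] by (simp add: norm_divide field_simps)
  have "(third c 0 - b) - (third c' 0 - b') - (- 224/15 * r + 64/15 * cnj r)
      = (third c 0 - third c' 0) - d - (- 224/15 * r + 64/15 * cnj r)" by (simp add: d_def)
  also have "\<dots> = E + (4 * (d * f) + cnj (d * f)) / 15"
    unfolding third by (subst d2) (simp add: field_simps)
  finally show ?thesis
    using norm_triangle_le[OF add_mono[OF E F]] by (simp add: r_def algebra_simps)
qed

section \<open>Pulling back through n inverse branches\<close>

lemma continuous_on_slope:
  assumes "norm (c + 2) \<le> 1/5" "y \<in> disc"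
  shows "continuous_on disc (\<lambda>x. slope c n x y)"
  unfolding continuous_on_def
proof
  fix x assume x: "x \<in> disc"
  have "((\<lambda>x'. slope c n x' y / slope c n x y - 1) \<longlongrightarrow> 0) (at x within disc)"
  proof (rule Lim_null_comparison)
    show "\<forall>\<^sub>F x' in at x within disc. norm (slope c n x' y / slope c n x y - 1) \<le> exp (2 * norm (x' - x)) - 1"
      using slope_distortion[OF assms(1) _ assms(2) assms(1) x assms(2), of _ n]
      by (auto simp: eventually_at_filter)
    show "((\<lambda>x'. exp (2 * norm (x' - x)) - 1) \<longlongrightarrow> 0) (at x within disc)"
      by (auto intro!: tendsto_eq_intros)
  qed
  from tendsto_mult[OF tendsto_add[OF this tendsto_const[of 1]] tendsto_const[of "slope c n x y"]]
  show "((\<lambda>x'. slope c n x' y) \<longlongrightarrow> slope c n x y) (at x within disc)"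
    using slope_nonzero[OF assms(1) x assms(2)] by simp
qed

lemma inverse_near_one:
  fixes z :: complex
  assumes "norm (z - 1) \<le> e" "e \<le> 1/2"
  shows "norm (1 / z - 1) \<le> 2 * e" and "norm (1 / z) \<le> 2"
proof -
  have "1 \<le> norm z + norm (z - 1)" using norm_triangle_ineq4[of z "z - 1"] by simp
  then have z: "1/2 \<le> norm z" using assms by linarith
  have "norm (1 / z) = 1 / norm z" by (simp add: norm_divide)
  also have "\<dots> \<le> 1 / (1/2)" using z by (intro frac_le) auto
  finally show "norm (1 / z) \<le> 2" by simp
  have "1 / z - 1 = - ((z - 1) * (1 / z))"
  proof -
    have "z \<noteq> 0" using z by auto
    then show ?thesis by (simp add: field_simps)
  qed
  then have "norm (1 / z - 1) = norm (z - 1) * norm (1 / z)" by (simp only: norm_minus_cancel norm_mult)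
  also have "\<dots> \<le> e * 2" using assms \<open>norm (1 / z) \<le> 2\<close> order_trans[OF norm_ge_zero assms(1)] by (intro mult_mono) auto
  finally show "norm (1 / z - 1) \<le> 2 * e" by simp
qed

text \<open>
  Brouwer's theorem gives a point \<open>u\<close> near \<open>0\<close> that \<open>n\<close> inverse branches carry to \<open>y\<close>, so that \<open>u\<close>
  is the forward image of \<open>y\<close>.
\<close>

lemma forward_orbit_near_zero:
  fixes c y E :: complex and n :: nat
  assumes "norm (c + 2) \<le> H" "real n * H \<le> 1/40" "1 \<le> n"
    and E: "E = (y - (inv_branch c ^^ n) 0) / slope (-2) n 0 0" and small: "norm E \<le> 1/32"
  shows "norm ((acp c ^^ (2 * n)) y - E) \<le> norm E * (16 * norm E + 20 * (real n * H))"
proof -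
  let ?Q = "slope (-2) n 0 0"
  have H: "0 \<le> H" using assms(1) norm_ge_zero order_trans by blast
  have "1 * H \<le> real n * H" using assms(3) H by (intro mult_right_mono) auto
  then have H5: "H \<le> 1/5" using assms(2) by simp
  have c: "norm (c + 2) \<le> 1/5" using assms(1) H5 by simp
  have disc: "cball 0 (1/16) \<subseteq> disc"
    unfolding disc_def by (simp add: cball_subset_ball_iff dist_norm)
  then have 0: "0 \<in> disc" by auto
  have Q: "?Q \<noteq> 0" using 0 by (intro slope_nonzero) auto
  have dist: "norm (slope c n u 0 / ?Q - 1) \<le> 2 * (2 * norm u + 5 * (real n * H))"
    if "norm u \<le> 1/16" for u
  proof (intro slope_distortion_linear)
    have "real n * norm (c - -2) \<le> real n * H" using assms(1) by (intro mult_left_mono) auto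
    then show "2 * (norm (u - 0) + norm (0 - 0 :: complex)) + 5 * real n * norm (c - -2) \<le> 2 * norm u + 5 * (real n * H)"
      by simp
    show "2 * norm u + 5 * (real n * H) \<le> 1" using that assms(2) by simp
  qed (use that disc c 0 in auto)
  \<comment> \<open>With |u| \<le> 1/16 and n H \<le> 1/40, the bound in \<open>dist\<close> is at
    most 2 (1/8 + 1/8) = 1/2, just what \<open>inverse_near_one\<close> requires.\<close>
  have inv: "norm (?Q / slope c n u 0 - 1) \<le> 2 * (2 * (2 * norm u + 5 * (real n * H)))"
       "norm (?Q / slope c n u 0) \<le> 2" if "norm u \<le> 1/16" for u
    using inverse_near_one[OF dist[OF that]] that assms(2) by simp_all
  \<comment> \<open>u = \<open>F u\<close> says that u times its secant slope is y minus the
    pullback of 0, that is, that u pulls back to y. The bound |\<open>F u\<close>| \<le> 2 |E| \<le>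
    1/16 makes the ball invariant.\<close>
  define F where "F u = E * ?Q / slope c n u 0" for u
  have F: "norm (F u) \<le> 2 * norm E" if "norm u \<le> 1/16" for u
    using mult_left_mono[OF inv(2)[OF that], of "norm E"]
    unfolding F_def times_divide_eq_right[symmetric] norm_mult by simp
  obtain u where u: "norm u \<le> 1/16" "F u = u"
  proof (rule brouwer_ball[of "1/16" 0 F])
    show "continuous_on (cball 0 (1/16)) F"
      unfolding F_def using slope_nonzero[OF c _ 0] disc
      by (intro continuous_intros continuous_on_subset[OF continuous_on_slope[OF c 0]]) auto
    show "F \<in> cball 0 (1/16) \<rightarrow> cball 0 (1/16)" using F small by fastforce
  qed auto
  have su: "slope c n u 0 \<noteq> 0" using u disc by (intro slope_nonzero c 0) auto
  have "(inv_branch c ^^ n) u - (inv_branch c ^^ n) 0 = u * slope c n u 0"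
    using inv_branch_funpow_secant[OF c _ 0, of u n] u disc by auto
  also have "\<dots> = E * ?Q" using u(2) su by (simp add: F_def field_simps)
  also have "\<dots> = y - (inv_branch c ^^ n) 0" using Q by (simp add: E)
  finally have "(acp c ^^ (2 * n)) y = u" using acp2_funpow_inv_branch[of n c u] by simp
  then have "(acp c ^^ (2 * n)) y - E = E * (?Q / slope c n u 0 - 1)"
    using u(2) by (simp add: F_def algebra_simps)
  then have "norm ((acp c ^^ (2 * n)) y - E) = norm E * norm (?Q / slope c n u 0 - 1)" 
    by (simp add: norm_mult)
  also have "\<dots> \<le> norm E * (2 * (2 * (2 * norm u + 5 * (real n * H))))"
    by (intro mult_left_mono inv u) auto
  also have "\<dots> \<le> norm E * (16 * norm E + 20 * (real n * H))"
    using F[OF u(1)] u(2) by (intro mult_left_mono) auto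
  finally show ?thesis .
qed

text \<open>Through the fixed point, the pullback of 0 is b - b * \<open>slope c n 0 b\<close>.
  Subtracting the relation at c', where the critical orbit closes up, leaves the two expansions and
  a difference of b * slope terms; the latter is of order n |c - c'| times the small slope at
  -2.\<close>

lemma third_minus_critical_orbit:
  assumes b: "fixpt c b" "fixpt c' b'" and H: "norm (c + 2) \<le> H" "norm (c' + 2) \<le> H" "real n * H \<le> 1/40" "1 \<le> n"
    and w: "norm w \<le> 1" and crit: "(inv_branch c' ^^ n) 0 = third c' 0"
  shows "norm (third c w - (inv_branch c ^^ n) 0 - (- 16 * w + (- 224/15 * (c - c') + 64/15 * cnj (c - c'))))
    \<le> 70 * norm w * (H + norm w) + 71 * H * norm (c - c')
      + 40 * exp 7 * real n * norm (c - c') * norm (slope (-2) n 0 0)"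
proof -
  let ?Q = "slope (-2) n 0 0"
  have H0: "0 \<le> H" using H norm_ge_zero order_trans by blast
  have "1 * H \<le> real n * H" using H H0 by (intro mult_right_mono) auto
  then have H5: "H \<le> 1/40" using H by simp
  have c: "norm (c + 2) \<le> 1/5" "norm (c' + 2) \<le> 1/5" "norm (-2 + 2 :: complex) \<le> 1/5" using H H5 by auto
  have 0: "0 \<in> disc" by (simp add: disc_def)
  have bd: "b \<in> disc" "b' \<in> disc" using b fixpt_disc by auto
  have *: "(inv_branch x ^^ n) 0 = z - z * slope x n 0 z" if "fixpt x z" "norm (x + 2) \<le> 1/5" for x z
    using inv_branch_funpow_secant[OF that(2) 0 fixpt_disc[OF that(1)], of n] inv_branch_funpow_fixpt[OF that(1), of n]
    by (simp add: algebra_simps)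
  define r where "r = norm (c - c')"
  have "r \<le> 2 * H" using norm_triangle_ineq4[of "c + 2" "c' + 2"] H by (simp add: r_def)
  then have nr: "real n * r \<le> 1/20" using mult_left_mono[of r "2 * H" "real n"] H(3) by (simp add: mult.left_commute)
  have "1 * r \<le> real n * r" using H by (intro mult_right_mono) (auto simp: r_def)
  then have rn: "r \<le> real n * r" by simp
  have bb: "norm (b - b') \<le> r / 2" using fixpt_Lipschitz[OF b] by (simp add: r_def)
  then have bn: "norm (b - b') \<le> real n * r" using rn norm_ge_zero[of "c - c'"] unfolding r_def by linarith
  have 1: "norm (slope c n 0 b / slope c' n 0 b' - 1) \<le> 2 * (6 * (real n * r))"
    using nr bb rn by (intro slope_distortion_linear c 0 bd) (auto simp: r_def)
  \<comment> \<open>The base points b' and 0 are far apart, so this quotient is bounded rather than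
    near 1: the exponent is at most 2 * 5/2 + 5/40 < 7.\<close>
  have 2: "norm (slope c' n 0 b' / ?Q) \<le> exp 7"
  proof -
    have *: "norm (slope c' n 0 b' / ?Q - 1) \<le> exp (2 * (norm (0 - 0 :: complex) + norm (b' - 0)) + 5 * real n * norm (c' - -2)) - 1"
      by (intro slope_distortion c 0 bd)
    have "norm b' \<le> 5/2" using norm_disc[OF bd(2)] by simp
    moreover have "real n * norm (c' - -2) \<le> 1/40"
      using mult_left_mono[OF H(2), of "real n"] H(3) by simp
    ultimately have "2 * (norm (0 - 0 :: complex) + norm (b' - 0)) + 5 * real n * norm (c' - -2) \<le> 7"
      by simp
    then have "exp (2 * (norm (0 - 0 :: complex) + norm (b' - 0)) + 5 * real n * norm (c' - -2)) \<le> exp 7"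
      by (simp only: exp_le_cancel_iff)
    with * have "norm (slope c' n 0 b' / ?Q - 1) \<le> exp 7 - 1" by linarith
    then show ?thesis using norm_triangle_ineq[of "slope c' n 0 b' / ?Q - 1" 1] by simp
  qed
  have Q: "?Q \<noteq> 0" using 0 c by (intro slope_nonzero) auto
  have q': "slope c' n 0 b' \<noteq> 0" using 0 c bd by (intro slope_nonzero) auto
  have "b * slope c n 0 b - b' * slope c' n 0 b' = slope c' n 0 b' * (b * (slope c n 0 b / slope c' n 0 b' - 1) + (b - b'))"
    using q' by (simp add: field_simps)
  then have "norm (b * slope c n 0 b - b' * slope c' n 0 b') \<le>
     norm (slope c' n 0 b') * (norm b * norm (slope c n 0 b / slope c' n 0 b' - 1) + norm (b - b'))"
    using norm_triangle_ineq[of "b * (slope c n 0 b / slope c' n 0 b' - 1)" "b - b'"] 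
    by (simp add: norm_mult mult_left_mono)
  also have "\<dots> \<le> (exp 7 * norm ?Q) * (5/2 * (2 * (6 * (real n * r))) + real n * r)"
    using 1 2 Q bn norm_disc[OF bd(1)]
    by (intro mult_mono add_mono) (auto simp: norm_divide field_simps r_def)
  also have "\<dots> \<le> 40 * exp 7 * real n * r * norm ?Q"
    by (simp add: r_def algebra_simps)
  finally have 3: "norm (b * slope c n 0 b - b' * slope c' n 0 b') \<le> 40 * exp 7 * real n * r * norm ?Q" .
  have 4: "norm (third c w - third c 0 + 16 * w) \<le> 70 * norm w * (H + norm w)"
    by (rule order_trans[OF third_expansion[OF c(1) w]]) (use H in \<open>intro mult_left_mono, auto\<close>)
  have 5: "norm ((third c 0 - b) - (third c' 0 - b') - (- 224/15 * (c - c') + 64/15 * cnj (c - c'))) \<le> 71 * H * r"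
    unfolding r_def using H5 by (intro third_fixpt_expansion b H) auto
  have "third c w - (inv_branch c ^^ n) 0 - (- 16 * w + (- 224/15 * (c - c') + 64/15 * cnj (c - c')))
    = (third c w - third c 0 + 16 * w)
      + ((third c 0 - b) - (third c' 0 - b') - (- 224/15 * (c - c') + 64/15 * cnj (c - c')))
      + (b * slope c n 0 b - b' * slope c' n 0 b')"
    using *[OF b(1) c(1)] *[OF b(2) c(2)] crit by (simp add: algebra_simps)
  then show ?thesis
    using norm_triangle_le[OF add_mono[OF norm_triangle_le[OF add_mono[OF 4 5]] 3]] by (simp only: r_def)
qed

section \<open>The linearizing coordinate\<close>

text \<open>The functional equation is put in backward form, in which it holds on all of T; the
  forward form breaks down after continuation, since at c = -2 it would equate K 2 = 0 with 16 K 0 =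
  16.\<close>

definition linearized :: "complex set \<Rightarrow> complex \<Rightarrow> complex \<Rightarrow> (complex \<Rightarrow> complex) \<Rightarrow> bool" where
  "linearized T c b K \<longleftrightarrow> norm (c + 2) \<le> 1/5 \<and> fixpt c b \<and> b \<in> T \<and>
     inv_branch c ` T \<subseteq> T \<and> K holomorphic_on T \<and> K b = 0 \<and> K 0 = 1 \<and>
     (\<forall>z\<in>T. K z = 4 * b * cnj b * K (inv_branch c z))"

lemma nonpos_Reals_csqrt_Re: "w \<in> \<real>\<^sub>\<le>\<^sub>0 \<Longrightarrow> Re (csqrt w) = 0"
  by (auto simp: complex_nonpos_Reals_iff)

lemma holomorphic_on_inv_branch:
  assumes "norm (c + 2) \<le> 1/5" shows "inv_branch c holomorphic_on disc"
proof -
  have 1: "z - c \<notin> \<real>\<^sub>\<le>\<^sub>0" if "z \<in> disc" for z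
    using Re_csqrt_half_step[OF assms that] nonpos_Reals_csqrt_Re by fastforce
  have 2: "csqrt (z - c) - cnj c \<notin> \<real>\<^sub>\<le>\<^sub>0" if "z \<in> disc" for z
    using Re_csqrt_half_step[OF cnj_near[OF assms] csqrt_half_step_disc[OF assms that]] nonpos_Reals_csqrt_Re by fastforce
  show ?thesis unfolding inv_branch_def[abs_def]
    by (intro holomorphic_intros 1 2)
qed

lemma inv_branch_segment:
  assumes "x \<in> closed_segment 0 2" shows "inv_branch (-2) x \<in> closed_segment 0 2"
proof -
  have seg: "z \<in> closed_segment (0::complex) 2 \<longleftrightarrow> (\<exists>s. 0 \<le> s \<and> s \<le> 2 \<and> z = of_real s)" for z
  proof
    assume "z \<in> closed_segment 0 2"
    then obtain u where "0 \<le> u" "u \<le> 1" "z = of_real (2 * u)" by (auto simp: in_segment scaleR_conv_of_real)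
    then show "\<exists>s. 0 \<le> s \<and> s \<le> 2 \<and> z = of_real s" by (intro exI[of _ "2 * u"]) auto
  next
    assume "\<exists>s. 0 \<le> s \<and> s \<le> 2 \<and> z = of_real s"
    then obtain s where "0 \<le> s" "s \<le> 2" "z = of_real s" by blast
    then show "z \<in> closed_segment 0 2" unfolding in_segment
      by (intro exI[of _ "s/2"]) (auto simp: scaleR_conv_of_real)
  qed
  obtain s where s: "0 \<le> s" "s \<le> 2" "x = of_real s" using assms seg by blast
  have "csqrt (x - -2) = of_real (sqrt (s + 2))"
    using s by (subst csqrt_of_real_nonneg) auto
  moreover have "csqrt (of_real (sqrt (s + 2)) - cnj (-2)) = of_real (sqrt (sqrt (s + 2) + 2))"
    using s by (subst csqrt_of_real_nonneg) auto
  ultimately have "inv_branch (-2) x = of_real (sqrt (sqrt (s + 2) + 2))"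
    by (simp only: inv_branch_def)
  moreover have "sqrt (s + 2) \<le> 2" using s by (intro real_le_lsqrt) auto
  then have "sqrt (sqrt (s + 2) + 2) \<le> 2" using s by (intro real_le_lsqrt) auto
  ultimately show ?thesis unfolding seg using s by (intro exI[of _ "sqrt (sqrt (s + 2) + 2)"]) auto
qed

text \<open>T is the e-neighbourhood of [0, 2]. The branch at -2 preserves the segment, so for |c +
  2| < e a point of T moves to within e/5 + 4e/5 = e of the segment: one T is invariant for all such
  c.\<close>

lemma linearizer_family_linearized:
  assumes \<beta>: "fixed_point_branch \<beta>" and Koe: "linearizer_family \<beta> Koe"
  obtains T where "open T" "connected T" "T \<subseteq> disc" "0 \<in> T" "2 \<in> T"
    "\<forall>\<^sub>F c in nhds (-2). linearized T c (\<beta> c) (Koe c)"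
proof -
  let ?S = "closed_segment 0 2 :: complex set"
  obtain V where V: "open V" "?S \<subseteq> V"
    and ev: "\<forall>\<^sub>F c in nhds (-2). Koe c holomorphic_on V \<and> \<beta> c \<in> V \<and> Koe c (\<beta> c) = 0 \<and> Koe c 0 = 1 \<and>
           (\<forall>\<^sub>F z in nhds (\<beta> c). Koe c ((acp c ^^ 2) z) = multiplier \<beta> c * Koe c z)"
    using Koe unfolding linearizer_family_def by blast
  obtain e0 where e0: "e0 > 0" "(\<Union>x\<in>?S. ball x e0) \<subseteq> V"
    using compact_subset_open_imp_ball_epsilon_subset[OF compact_segment V] by blast
  define e where "e = min e0 (1/5)"
  have e: "0 < e" "e \<le> 1/5" "e \<le> e0" using e0 by (auto simp: e_def)
  define T where "T = (\<Union>x\<in>?S. \<Union>y\<in>ball 0 e. {x + y})"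
  have T: "z \<in> T \<longleftrightarrow> (\<exists>x\<in>?S. norm (z - x) < e)" for z
  proof
    assume "\<exists>x\<in>?S. norm (z - x) < e"
    then obtain x where "x \<in> ?S" "norm (z - x) < e" by blast
    then show "z \<in> T" unfolding T_def by (intro UN_I[of x] UN_I[of "z - x"]) auto
  next
    assume "z \<in> T"
    then obtain x y where "x \<in> ?S" "norm y < e" "z = x + y" by (auto simp: T_def)
    then show "\<exists>x\<in>?S. norm (z - x) < e" by (intro bexI[of _ x]) auto
  qed
  have "convex T" unfolding T_def by (intro convex_sums) auto
  then have conn: "connected T" by (rule convex_connected)
  have op: "open T" unfolding T_def by (intro open_sums) auto
  have TV: "T \<subseteq> V"
    using e0 e(3) by (auto simp: T dist_norm norm_minus_commute subset_iff) (metis less_le_trans)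
  have Sd: "?S \<subseteq> cball 1 1" by (intro closed_segment_subset) (auto simp: dist_norm)
  have Td: "T \<subseteq> disc"
  proof
    fix z assume "z \<in> T"
    then obtain x where x: "x \<in> ?S" "norm (z - x) < e" using T by blast
    have "norm (1 - z) \<le> norm (1 - x) + norm (z - x)" using norm_triangle_ineq4[of "1 - x" "z - x"] by simp
    then show "z \<in> disc" using x(2) subsetD[OF Sd x(1)] e by (simp add: disc_def dist_norm)
  qed
  have SD: "?S \<subseteq> disc" using Sd by (auto simp: disc_def)
  have "0 \<in> T" unfolding T using e by (intro bexI[of _ 0]) auto
  moreover have "2 \<in> T" unfolding T using e by (intro bexI[of _ 2]) auto
  ultimately have nice: "0 \<in> T" "2 \<in> T" .
  have "\<forall>\<^sub>F c in nhds (-2). dist c (-2) < e" using e by (intro eventually_nhds_metric[THEN iffD2]) auto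
  with ev fixed_point_branch_fixpt(2)[OF \<beta>]
  have "\<forall>\<^sub>F c in nhds (-2). linearized T c (\<beta> c) (Koe c)"
  proof eventually_elim
    case (elim c)
    have c: "norm (c + 2) < e" using elim by (simp add: dist_norm)
    then have c5: "norm (c + 2) \<le> 1/5" using e by simp
    have fx: "fixpt c (\<beta> c)" using elim by simp
    have hol: "Koe c holomorphic_on T" using elim TV holomorphic_on_subset by blast
    have "norm (\<beta> c - 2) < e" using fixpt_Lipschitz[OF fx fixpt_chat] c e by simp
    then have bT: "\<beta> c \<in> T" unfolding T by (intro bexI[of _ 2]) auto
    have inv: "inv_branch c ` T \<subseteq> T"
    proof
      fix w assume "w \<in> inv_branch c ` T"
      then obtain z where z: "z \<in> T" "w = inv_branch c z" by blast
      then obtain x where x: "x \<in> ?S" "norm (z - x) < e" using T by blast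
      have "norm (inv_branch c z - inv_branch (-2) x) \<le> norm (z - x) / 5 + 4/5 * norm (c - -2)"
        using z x Td SD c5 by (intro inv_branch_diff) auto
      also have "\<dots> < e" using x(2) c by simp
      finally show "w \<in> T" unfolding T z(2) using inv_branch_segment[OF x(1)] by blast
    qed
    have holG: "inv_branch c holomorphic_on T"
      using holomorphic_on_inv_branch[OF c5] Td holomorphic_on_subset by blast
    obtain U where U: "open U" "\<beta> c \<in> U" "\<And>z. z \<in> U \<Longrightarrow> Koe c ((acp c ^^ 2) z) = multiplier \<beta> c * Koe c z"
      using elim unfolding eventually_nhds by blast
    have "isCont (inv_branch c) (\<beta> c)"
      using holomorphic_on_imp_continuous_on[OF holG] op bT continuous_on_interior interior_open by metis
    then have "(inv_branch c \<longlongrightarrow> \<beta> c) (nhds (\<beta> c))"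
      using tendsto_at_iff_tendsto_nhds[of "inv_branch c" "\<beta> c"] inv_branch_fixpt[OF fx] by (simp add: isCont_def)
    then have "\<forall>\<^sub>F z in nhds (\<beta> c). inv_branch c z \<in> U" using U by (intro topological_tendstoD)
    then obtain W where W: "open W" "\<beta> c \<in> W" "\<And>z. z \<in> W \<Longrightarrow> inv_branch c z \<in> U"
      unfolding eventually_nhds by blast
    \<comment> \<open>Near the fixed point this is the forward equation at
      \<open>inv_branch c z\<close>; the identity theorem extends it to T.\<close>
    have "Koe c z = multiplier \<beta> c * Koe c (inv_branch c z)" if "z \<in> T" for z
    proof (rule analytic_continuation_open[of "W \<inter> T" T "Koe c" "\<lambda>z. multiplier \<beta> c * Koe c (inv_branch c z)"])
      show "(\<lambda>z. multiplier \<beta> c * Koe c (inv_branch c z)) holomorphic_on T"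
        using holomorphic_on_compose_gen[OF holG hol inv] by (intro holomorphic_intros) (simp add: o_def)
      show "Koe c z = multiplier \<beta> c * Koe c (inv_branch c z)" if "z \<in> W \<inter> T" for z
        using U(3)[OF W(3)] that acp2_inv_branch by simp
    qed (use op conn W bT hol that in auto)
    then show ?case
      using elim c5 fx bT inv hol multiplier_fixpt[of c \<beta>, OF fx] by (simp add: linearized_def)
  qed
  with op conn Td nice show thesis by (rule that)
qed

lemma linearized_funpow:
  assumes "linearized T c b K" "z \<in> T"
  shows "(inv_branch c ^^ n) z \<in> T" and "K z = (4 * b * cnj b) ^ n * K ((inv_branch c ^^ n) z)"
proof (induction n)
  case (Suc n)
  { case 1 then show ?case using Suc(1) assms by (auto simp: linearized_def) }
  { case 2 then show ?case using Suc assms by (simp add: linearized_def mult_ac) }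
qed (use assms in auto)

lemma funpow_tendsto_fixpt:
  assumes "norm (c + 2) \<le> 1/5" "fixpt c b" "z \<in> disc"
  shows "(\<lambda>n. (inv_branch c ^^ n) z) \<longlonglongrightarrow> b"
    and "norm ((inv_branch c ^^ n) z - b) \<le> norm (z - b) / 5 ^ n"
proof -
  have *: "norm ((inv_branch c ^^ n) z - b) \<le> norm (z - b) / 5 ^ n" for n
    using inv_branch_funpow_diff[OF assms(1,3) assms(1) fixpt_disc[OF assms(2)], of n]
      inv_branch_funpow_fixpt[OF assms(2), of n] by simp
  then show "norm ((inv_branch c ^^ n) z - b) \<le> norm (z - b) / 5 ^ n" .
  have "(\<lambda>n. norm (z - b) / 5 ^ n) \<longlonglongrightarrow> 0" by real_asymp
  then have "(\<lambda>n. (inv_branch c ^^ n) z - b) \<longlonglongrightarrow> 0"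
    by (rule Lim_null_comparison[rotated]) (use * in auto)
  then show "(\<lambda>n. (inv_branch c ^^ n) z) \<longlonglongrightarrow> b" by (simp add: LIM_zero_iff)
qed

text \<open>Koenigs' limit, with the powers of the multiplier absorbed into a quotient of slopes
  that the distortion bound controls.\<close>

lemma linearized_quotient_tendsto:
  assumes lin: "linearized T c b K" and "open T" "T \<subseteq> disc" and z: "z \<in> T" "z \<noteq> b"
  shows "(\<lambda>n. K ((inv_branch c ^^ n) z) / ((inv_branch c ^^ n) z - b)) \<longlonglongrightarrow> deriv K b"
    and "K z = (z - b) * (slope c n z b / slope c n b b) * (K ((inv_branch c ^^ n) z) / ((inv_branch c ^^ n) z - b))"
proof -
  have c: "norm (c + 2) \<le> 1/5" and b: "fixpt c b" "b \<in> T" "K holomorphic_on T" "K b = 0"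
    using lin by (auto simp: linearized_def)
  have zd: "z \<in> disc" "b \<in> disc" using z assms(3) b by auto
  have eq: "(inv_branch c ^^ n) z - b = (z - b) * slope c n z b" for n
    using inv_branch_funpow_secant[OF c zd, of n] inv_branch_funpow_fixpt[OF b(1)] by simp
  have nz: "slope c n z b \<noteq> 0" "slope c n b b \<noteq> 0" for n using slope_nonzero c zd by auto
  then have ne: "(inv_branch c ^^ n) z - b \<noteq> 0" for n unfolding eq using z by auto
  have "(K has_field_derivative deriv K b) (at b)"
    using holomorphic_derivI[OF b(3) assms(2) b(2)] .
  then have "((\<lambda>x. (K x - K b) / (x - b)) \<longlongrightarrow> deriv K b) (at b)"
    by (simp add: has_field_derivative_iff)
  moreover have "filterlim (\<lambda>n. (inv_branch c ^^ n) z) (at b) sequentially"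
    using funpow_tendsto_fixpt(1)[OF c b(1) zd(1)] ne by (simp add: filterlim_at)
  ultimately show "(\<lambda>n. K ((inv_branch c ^^ n) z) / ((inv_branch c ^^ n) z - b)) \<longlonglongrightarrow> deriv K b"
    using filterlim_compose[of "\<lambda>x. (K x - K b) / (x - b)"] b(4) by fastforce
  have "K z = (4 * b * cnj b) ^ n * K ((inv_branch c ^^ n) z)"
    using linearized_funpow(2)[OF lin z(1)] .
  also have "(4 * b * cnj b) ^ n = 1 / slope c n b b" by (simp add: slope_fixpt[OF b(1)])
  finally show "K z = (z - b) * (slope c n z b / slope c n b b) * (K ((inv_branch c ^^ n) z) / ((inv_branch c ^^ n) z - b))"
    using nz z unfolding eq by simp
qed

text \<open>A first-order expansion whose error depends only on |z - b| and K'(b), hence is uniform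
  in c; this is why it comes from distortion and not from Taylor's theorem.\<close>

lemma linearized_expansion:
  assumes lin: "linearized T c b K" and T: "open T" "T \<subseteq> disc" and z: "z \<in> T"
  shows "norm (K z - (z - b) * deriv K b) \<le> norm (z - b) * norm (deriv K b) * (exp (2 * norm (z - b)) - 1)"
proof (cases "z = b")
  case True
  then show ?thesis using lin by (simp add: linearized_def)
next
  case False
  have c: "norm (c + 2) \<le> 1/5" and b: "b \<in> disc" using lin T by (auto simp: linearized_def)
  define q where "q n = K ((inv_branch c ^^ n) z) / ((inv_branch c ^^ n) z - b)" for n
  have q: "q \<longlonglongrightarrow> deriv K b" and Kz: "K z = (z - b) * (slope c n z b / slope c n b b) * q n" for n
    using linearized_quotient_tendsto[OF lin T z False] unfolding q_def by auto
  show ?thesis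
  proof (rule tendsto_le[OF sequentially_bot])
    show "(\<lambda>n. norm (z - b) * norm (q n) * (exp (2 * norm (z - b)) - 1)) \<longlonglongrightarrow>
        norm (z - b) * norm (deriv K b) * (exp (2 * norm (z - b)) - 1)"
      by (intro tendsto_intros q)
    show "(\<lambda>n. norm (K z - (z - b) * q n)) \<longlonglongrightarrow> norm (K z - (z - b) * deriv K b)"
      by (intro tendsto_intros q)
    show "\<forall>\<^sub>F n in sequentially. norm (K z - (z - b) * q n) \<le> norm (z - b) * norm (q n) * (exp (2 * norm (z - b)) - 1)"
    proof (intro always_eventually allI)
      fix n
      have "K z - (z - b) * q n = (z - b) * q n * (slope c n z b / slope c n b b - 1)"
        by (subst Kz[of n]) (simp add: algebra_simps)
      moreover have "norm (slope c n z b / slope c n b b - 1) \<le> exp (2 * norm (z - b)) - 1"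
        using slope_distortion[OF c subsetD[OF T(2) z] b c b b, of n] by simp
      ultimately show "norm (K z - (z - b) * q n) \<le> norm (z - b) * norm (q n) * (exp (2 * norm (z - b)) - 1)"
        by (simp add: norm_mult mult_left_mono)
    qed
  qed
qed

text \<open>The normalization K 0 = 1 determines K'(b): Koenigs' limit at z = 0 says that the slope
  quotients converge to -1 / (b K'(b)). The rate holds because the tail after m steps starts at
  distance at most 3 / 5^m from b.\<close>

lemma linearized_deriv:
  assumes lin: "linearized T c b K" and T: "open T" "T \<subseteq> disc" "0 \<in> T"
  shows "deriv K b \<noteq> 0"
    and "norm ((- 1 / (b * deriv K b)) / (slope c m 0 b / slope c m b b) - 1) \<le> exp (6 / 5 ^ m) - 1"
proof -
  have c: "norm (c + 2) \<le> 1/5" and bf: "fixpt c b" and b: "b \<in> disc" and K0: "K 0 = 1"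
    using lin T by (auto simp: linearized_def)
  have b0: "b \<noteq> 0" using fixpt_Re[OF bf] by auto
  have 0: "0 \<in> disc" using T by auto
  define s where "s n = slope c n 0 b / slope c n b b" for n
  have s0: "s n \<noteq> 0" for n using slope_nonzero[OF c 0 b] slope_nonzero[OF c b b] by (simp add: s_def)
  define q where "q n = K ((inv_branch c ^^ n) 0) / ((inv_branch c ^^ n) 0 - b)" for n
  have q: "q \<longlonglongrightarrow> deriv K b" and qs: "1 = - b * s n * q n" for n
    using linearized_quotient_tendsto[OF lin T(1,2,3) b0[symmetric]] K0 unfolding q_def s_def by auto
  then have s_eq: "q n = - 1 / (b * s n)" for n 
  proof -
    have "q n * (b * s n) = - 1" using arg_cong[OF qs[of n], of uminus] by (simp add: mult_ac)
    then show ?thesis using b0 s0[of n] by (metis nonzero_eq_divide_eq mult_eq_0_iff)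
  qed
  have bd: "norm (s (m + j) / s m - 1) \<le> exp (6 / 5 ^ m) - 1" for m j
  proof -
    let ?x = "(inv_branch c ^^ m) 0"
    have x: "?x \<in> disc" by (rule inv_branch_funpow_disc[OF c 0])
    have "s (m + j) / s m = slope c j ?x b / slope c j b b"
      using slope_nonzero[OF c 0 b] slope_nonzero[OF c b b]
      by (simp add: s_def slope_add inv_branch_funpow_fixpt[OF bf])
    then have "norm (s (m + j) / s m - 1) \<le> exp (2 * norm (?x - b)) - 1"
      using slope_distortion[OF c x b c b b, of j] by simp
    also have "\<dots> \<le> exp (6 / 5 ^ m) - 1"
    proof -
      have "norm (?x - b) \<le> norm b / 5 ^ m" using funpow_tendsto_fixpt(2)[OF c bf 0, of m] by simp
      also have "\<dots> \<le> 3 / 5 ^ m" using norm_disc[OF b] by (intro divide_right_mono) auto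
      finally show ?thesis by simp
    qed
    finally show ?thesis .
  qed
  \<comment> \<open>If K'(b) = 0 then \<open>q\<close> tends to 0, while \<open>s\<close> stays
    bounded by distortion; but |b s q| = 1.\<close>
  show k0: "deriv K b \<noteq> 0"
  proof
    assume "deriv K b = 0"
    have "(\<lambda>j. norm (b * s (0 + j)) * norm (q j)) \<longlonglongrightarrow> 0"
    proof (rule Lim_null_comparison[where g = "\<lambda>j. (5/2 * exp 6 * norm (s 0)) * norm (q j)"])
      show "(\<lambda>j. 5/2 * exp 6 * norm (s 0) * norm (q j)) \<longlonglongrightarrow> 0"
        using q \<open>deriv K b = 0\<close> by (auto intro!: tendsto_eq_intros)
      show "\<forall>\<^sub>F j in sequentially. norm (norm (b * s (0 + j)) * norm (q j)) \<le> 5/2 * exp 6 * norm (s 0) * norm (q j)"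
      proof (intro always_eventually allI)
        fix j
        have "norm (s (0 + j) / s 0) \<le> exp 6" using norm_triangle_ineq[of "s (0 + j) / s 0 - 1" 1] bd[of 0 j] by simp
        then have "norm (s (0 + j)) \<le> exp 6 * norm (s 0)" using s0[of 0] by (simp add: norm_divide field_simps)
        then have "norm (b * s (0 + j)) \<le> 5/2 * (exp 6 * norm (s 0))"
          unfolding norm_mult using norm_disc[OF b] by (intro mult_mono) auto
        from mult_right_mono[OF this, of "norm (q j)"]
        show "norm (norm (b * s (0 + j)) * norm (q j)) \<le> 5/2 * exp 6 * norm (s 0) * norm (q j)"
          by (simp add: abs_mult mult.assoc)
      qed
    qed
    moreover have "norm (b * s (0 + j)) * norm (q j) = 1" for j
    proof -
      have "norm (b * s j) * norm (q j) = norm (- b * s j * q j)" by (simp add: norm_mult)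
      also have "- b * s j * q j = 1" using qs[of j] by simp
      finally show ?thesis by simp
    qed
    ultimately show False by (simp add: LIMSEQ_const_iff)
  qed
  have "(\<lambda>j. - 1 / (b * q j)) \<longlonglongrightarrow> - 1 / (b * deriv K b)"
    using k0 b0 by (intro tendsto_intros q) auto
  moreover have "- 1 / (b * q j) = s j" for j using b0 s0[of j] by (simp add: s_eq)
  ultimately have "s \<longlonglongrightarrow> - 1 / (b * deriv K b)" by simp
  then have "(\<lambda>j. s (j + m)) \<longlonglongrightarrow> - 1 / (b * deriv K b)" by (rule LIMSEQ_ignore_initial_segment)
  then have "(\<lambda>j. norm (s (j + m) / s m - 1)) \<longlonglongrightarrow> norm (- 1 / (b * deriv K b) / s m - 1)"
    using s0 by (intro tendsto_intros) auto
  then have "norm (- 1 / (b * deriv K b) / s m - 1) \<le> exp (6 / 5 ^ m) - 1"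
    by (rule LIMSEQ_le_const2) (use bd[of m] in \<open>auto simp: add.commute\<close>)
  then show "norm ((- 1 / (b * deriv K b)) / (slope c m 0 b / slope c m b b) - 1) \<le> exp (6 / 5 ^ m) - 1"
    by (simp add: s_def)
qed

section \<open>Coefficients at the limit parameter\<close>

text \<open>Every nonconstant term carries a factor |h|, so the increment is at most |h| / s times
  the absolute sum at radius s.\<close>

lemma real_analytic_at_tendsto:
  assumes "real_analytic_at F c0" shows "(F \<longlongrightarrow> F c0) (nhds c0)"
proof -
  obtain a r where r: "r > 0" and sum: "\<And>h. norm h < r \<Longrightarrow>
      ((\<lambda>(j, k). a j k * h ^ j * cnj h ^ k) has_sum F (c0 + h)) UNIV"
    using assms unfolding real_analytic_at_def by blast
  define s where "s = r / 2"
  have s: "0 < s" "s < r" using r by (auto simp: s_def)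
  define g where "g = (\<lambda>(j, k). norm (a j k) * s ^ j * s ^ k)"
  have "(\<lambda>(j, k). a j k * of_real s ^ j * cnj (of_real s) ^ k) summable_on UNIV"
    using sum[of "of_real s"] s by (auto simp: summable_on_def)
  then have "(\<lambda>p. norm ((\<lambda>(j, k). a j k * of_real s ^ j * cnj (of_real s) ^ k) p)) summable_on UNIV"
    using summable_on_iff_abs_summable_on_complex by blast
  moreover have "(\<lambda>p. norm ((\<lambda>(j, k). a j k * of_real s ^ j * cnj (of_real s) ^ k) p)) = g"
    using s by (auto simp: g_def norm_mult norm_power)
  ultimately have "g summable_on UNIV" by simp
  then obtain M where M: "(g has_sum M) UNIV" by (auto simp: summable_on_def)
  have F0: "((\<lambda>p. if p = (0::nat, 0::nat) then a 0 0 else 0) has_sum a 0 0) UNIV"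
    by (rule has_sum_finite_neutralI[of "{(0, 0)}"]) auto
  have "F c0 = a 0 0"
  proof (rule has_sum_unique[OF _ F0])
    have "(\<lambda>(j, k). a j k * 0 ^ j * cnj 0 ^ k) = (\<lambda>p. if p = (0::nat, 0::nat) then a 0 0 else 0)"
      by (auto simp: fun_eq_iff power_0_left)
    then show "((\<lambda>p. if p = (0::nat, 0::nat) then a 0 0 else 0) has_sum F c0) UNIV"
      using sum[of 0] r by simp
  qed
  have bd: "norm (F (c0 + h) - F c0) \<le> norm h / s * M" if h: "norm h < s" for h
  proof -
    define f where "f p = (case p of (j, k) \<Rightarrow> a j k * h ^ j * cnj h ^ k) - (if p = (0::nat, 0::nat) then a 0 0 else 0)" for p
    have "((\<lambda>p. (case p of (j, k) \<Rightarrow> a j k * h ^ j * cnj h ^ k) + - (if p = (0::nat, 0::nat) then a 0 0 else 0))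
        has_sum (F (c0 + h) + - F c0)) UNIV"
      unfolding \<open>F c0 = a 0 0\<close> using sum[of h] h s F0 by (intro has_sum_add has_sum_uminusI) auto
    then have f: "(f has_sum (F (c0 + h) - F c0)) UNIV"
      unfolding f_def by simp
    have le: "norm (f p) \<le> norm h / s * g p" for p
    proof (cases p)
      case (Pair j k)
      show ?thesis
      proof (cases "p = (0, 0)")
        case True
        then show ?thesis using s by (simp add: f_def g_def)
      next
        case False
        then obtain m where m: "j + k = Suc m" using Pair by (metis Suc_pred add_is_0 neq0_conv)
        have "norm (f p) = norm (a j k) * norm h ^ (j + k)"
          using False Pair by (auto simp: f_def norm_mult norm_power power_add)
        also have "\<dots> \<le> norm (a j k) * (norm h * s ^ m)"
          unfolding m power_Suc using h by (intro mult_left_mono power_mono) auto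
        also have "\<dots> = norm h / s * (norm (a j k) * s ^ (j + k))"
          unfolding m using s by simp
        finally show ?thesis using Pair by (simp add: g_def power_add mult.assoc)
      qed
    qed
    have gs: "((\<lambda>p. norm h / s * g p) has_sum norm h / s * M) UNIV"
      using M by (rule has_sum_cmult_right)
    then have "(\<lambda>p. norm (f p)) summable_on UNIV"
      by (rule summable_on_comparison_test[OF has_sum_imp_summable]) (rule le, rule norm_ge_zero)
    then obtain n where n: "((\<lambda>p. norm (f p)) has_sum n) UNIV" by (auto simp: summable_on_def)
    have "norm (F (c0 + h) - F c0) \<le> n" by (rule norm_has_sum_bound[OF n f])
    also have "n \<le> norm h / s * M" by (rule has_sum_mono[OF n gs]) (rule le)
    finally show ?thesis .
  qed
  have "((\<lambda>c. F c - F c0) \<longlongrightarrow> 0) (nhds c0)"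
  proof (rule Lim_null_comparison)
    have "\<forall>\<^sub>F c in nhds c0. dist c c0 < s" using s by (intro eventually_nhds_metric[THEN iffD2]) auto
    then show "\<forall>\<^sub>F c in nhds c0. norm (F c - F c0) \<le> norm (c - c0) / s * M"
    proof eventually_elim
      case (elim c)
      then show ?case using bd[of "c - c0"] by (simp add: dist_norm)
    qed
    have "((\<lambda>c. norm (c - c0) / s * M) \<longlongrightarrow> norm (c0 - c0) / s * M) (nhds c0)"
      using s by (intro tendsto_intros filterlim_ident) auto
    then show "((\<lambda>c. norm (c - c0) / s * M) \<longlongrightarrow> 0) (nhds c0)" by simp
  qed
  then show ?thesis by (simp add: LIM_zero_iff)
qed

lemma expansion_coeffs_0:
  assumes "expansion_coeffs Koe A"
  shows "\<forall>\<^sub>F c in nhds (-2). A 0 c = Koe c (third c 0)"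
  using assms unfolding expansion_coeffs_def
proof eventually_elim
  case (elim c)
  then have "(\<lambda>i. A i c * cnj 0 ^ i) sums Koe c ((acp c ^^ 3) 0)" by (rule eventually_nhds_x_imp_x)
  then show ?case by (simp add: acp3)
qed

lemma sums_divide_shift:
  fixes a :: "nat \<Rightarrow> complex"
  assumes "(\<lambda>n. a n * x ^ n) sums y" "a 0 = 0" "x \<noteq> 0"
  shows "(\<lambda>n. a (Suc n) * x ^ n) sums (y / x)"
proof -
  have "(\<lambda>n. a (Suc n) * x ^ Suc n) sums y"
    using assms(1,2) sums_Suc_iff[of "\<lambda>n. a n * x ^ n" y] by simp
  then have "(\<lambda>n. a (Suc n) * x ^ Suc n / x) sums (y / x)" by (rule sums_divide)
  then show ?thesis using assms(3) by simp
qed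

text \<open>The leading coefficients are peeled off by dividing by x. The auxiliary functions take
  the next coefficient as value at 0, so that the shifted series represents them there too.\<close>

lemma even_power_series_coeff:
  fixes a :: "nat \<Rightarrow> complex"
  assumes s: "0 < s" and sums: "\<And>x. norm x < s \<Longrightarrow> (\<lambda>n. a n * x ^ n) sums W (x\<^sup>2)"
    and W: "(W has_field_derivative D) (at 0)" "W 0 = 0"
  shows "a 2 = D"
proof -
  have a0: "a 0 = 0" using sums[of 0] s W(2) by simp
  have D: "((\<lambda>x. W (x\<^sup>2) / x\<^sup>2) \<longlongrightarrow> D) (at 0)"
  proof -
    have "((\<lambda>u. W u / u) \<longlongrightarrow> D) (at 0)" using W by (simp add: has_field_derivative_iff)
    moreover have "filterlim (\<lambda>x::complex. x\<^sup>2) (at 0) (at 0)"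
      by (auto simp: filterlim_at eventually_at_filter intro!: tendsto_eq_intros)
    ultimately show ?thesis by (rule filterlim_compose)
  qed
  define f1 where "f1 x = (if x = 0 then a 1 else W (x\<^sup>2) / x)" for x
  have f1: "(\<lambda>n. a (Suc n) * x ^ n) sums f1 x" if "norm x < s" for x
    using sums_divide_shift[OF sums[OF that] a0] by (auto simp: f1_def)
  have "(f1 \<longlongrightarrow> a 1) (at 0)" using powser_limit_0[OF s f1] by simp
  moreover have "(f1 \<longlongrightarrow> 0) (at 0)"
  proof (rule Lim_transform_eventually)
    show "((\<lambda>x. x * (W (x\<^sup>2) / x\<^sup>2)) \<longlongrightarrow> 0) (at 0)"
      by (rule tendsto_eq_intros D refl)+ simp
    show "\<forall>\<^sub>F x in at 0. x * (W (x\<^sup>2) / x\<^sup>2) = f1 x"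
      by (auto simp: eventually_at_filter f1_def power2_eq_square)
  qed
  ultimately have a1: "a 1 = 0" using tendsto_unique[OF at_neq_bot] by blast
  define f2 where "f2 x = (if x = 0 then a 2 else W (x\<^sup>2) / x\<^sup>2)" for x
  have f2: "(\<lambda>n. a (Suc (Suc n)) * x ^ n) sums f2 x" if "norm x < s" for x
    using sums_divide_shift[of "\<lambda>n. a (Suc n)", OF f1[OF that]] a1
    by (auto simp: f2_def f1_def power2_eq_square numeral_2_eq_2)
  have "(f2 \<longlongrightarrow> a 2) (at 0)" using powser_limit_0[OF s f2] by (simp add: numeral_2_eq_2)
  moreover have "(f2 \<longlongrightarrow> D) (at 0)"
    by (rule Lim_transform_eventually[OF D]) (auto simp: eventually_at_filter f2_def)
  ultimately show ?thesis using tendsto_unique[OF at_neq_bot] by blast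
qed

lemma linearized_second_coeff:
  assumes lin: "linearized T (-2) 2 K" and T: "open T" "2 \<in> T"
    and A: "\<forall>\<^sub>F z in nhds 0. (\<lambda>i. A i * cnj z ^ i) sums K ((acp (-2) ^^ 3) z)"
  shows "A 2 = - 16 * deriv K 2"
proof -
  obtain s where s: "0 < s" and sums: "\<And>z. norm z < s \<Longrightarrow> (\<lambda>i. A i * cnj z ^ i) sums K ((acp (-2) ^^ 3) z)"
    using A unfolding eventually_nhds_metric dist_norm by auto
  have "third (-2) 0 = 2" by (simp add: third_def)
  have "(K has_field_derivative deriv K 2) (at (third (-2) 0))"
    unfolding \<open>third (-2) 0 = 2\<close> using lin T by (intro holomorphic_derivI[of K T]) (auto simp: linearized_def)
  moreover have "(third (-2) has_field_derivative -16) (at 0)"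
    unfolding third_def[abs_def] by (auto intro!: derivative_eq_intros)
  ultimately have "((\<lambda>u. K (third (-2) u)) has_field_derivative deriv K 2 * -16) (at 0)"
    by (rule DERIV_chain2)
  then have "A 2 = deriv K 2 * -16"
  proof (rule even_power_series_coeff[OF s, rotated])
    show "K (third (-2) 0) = 0" using lin \<open>third (-2) 0 = 2\<close> by (simp add: linearized_def)
    show "(\<lambda>n. A n * x ^ n) sums K (third (-2) (x\<^sup>2))" if "norm x < s" for x
      using sums[of "cnj x"] that by (simp add: acp3)
  qed
  then show ?thesis by simp
qed

section \<open>Derivatives of the linearizer at the limit parameter and near it\<close>

lemma inv_branch_funpow_has_field_derivative:
  assumes "norm (c + 2) \<le> 1/5" "x \<in> disc"
  shows "((inv_branch c ^^ n) has_field_derivative slope c n x x) (at x)"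
  unfolding has_field_derivative_iff
proof (rule Lim_transform_eventually)
  have op: "open disc" by (simp add: disc_def)
  then have "isCont (\<lambda>y. slope c n y x) x"
    using continuous_on_slope[OF assms, of n] assms(2) continuous_on_eq_continuous_at by blast
  then show "((\<lambda>y. slope c n y x) \<longlongrightarrow> slope c n x x) (at x)" by (simp add: isCont_def)
  have "\<forall>\<^sub>F y in at x. y \<in> disc" using op assms(2) by (rule eventually_at_in_open')
  then show "\<forall>\<^sub>F y in at x. slope c n y x = ((inv_branch c ^^ n) y - (inv_branch c ^^ n) x) / (y - x)"
    using eventually_neq_at_within[of x x UNIV]
  proof eventually_elim
    case (elim y)
    then show ?case using inv_branch_funpow_secant[OF assms(1) _ assms(2), of y n] by simp
  qed
qed

text \<open>The iterated functional equation, differentiated at 0. It expresses the contraction of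
  the n-th pullback at 0 by Koe'(0).\<close>

lemma linearized_deriv_zero:
  assumes lin: "linearized T (-2) 2 K" and T: "open T" "T \<subseteq> disc" "0 \<in> T"
  shows "deriv K 0 = 16 ^ n * slope (-2) n 0 0 * deriv K ((inv_branch (-2) ^^ n) 0)"
proof -
  let ?G = "inv_branch (-2) ^^ n"
  have "(K has_field_derivative deriv K (?G 0)) (at (?G 0))"
    using lin linearized_funpow(1)[OF lin T(3), of n] T(1) by (intro holomorphic_derivI[of K T]) (auto simp: linearized_def)
  moreover have "(?G has_field_derivative slope (-2) n 0 0) (at 0)"
    using T by (intro inv_branch_funpow_has_field_derivative) auto
  ultimately have "((\<lambda>z. K (?G z)) has_field_derivative deriv K (?G 0) * slope (-2) n 0 0) (at 0)"
    by (rule DERIV_chain2)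
  then have "((\<lambda>z. 16 ^ n * K (?G z)) has_field_derivative 16 ^ n * (deriv K (?G 0) * slope (-2) n 0 0)) (at 0)"
    by (rule DERIV_cmult)
  then have "(K has_field_derivative 16 ^ n * (deriv K (?G 0) * slope (-2) n 0 0)) (at 0)"
  proof (rule has_field_derivative_transform_within_open[OF _ T(1,3)])
    show "16 ^ n * K (?G z) = K z" if "z \<in> T" for z
      using linearized_funpow(2)[OF lin that, of n] by simp
  qed
  then show ?thesis by (simp add: DERIV_imp_deriv mult_ac)
qed

lemma has_field_derivative_local_Lipschitz:
  fixes f :: "complex \<Rightarrow> complex"
  assumes "(f has_field_derivative D) (at x)"
  shows "\<forall>\<^sub>F y in nhds x. norm (f y - f x) \<le> (norm D + 1) * norm (y - x)"
proof -
  have "((\<lambda>y. norm ((f y - f x) / (y - x))) \<longlongrightarrow> norm D) (at x)"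
    using assms unfolding has_field_derivative_iff by (rule tendsto_norm)
  then have "\<forall>\<^sub>F y in at x. norm ((f y - f x) / (y - x)) < norm D + 1" by (rule order_tendstoD) simp
  then show ?thesis unfolding eventually_at_filter
  proof eventually_elim
    case (elim y)
    then show ?case by (cases "y = x") (auto simp: norm_divide field_simps)
  qed
qed

lemma linearized_deriv_bigo:
  assumes lin: "linearized T (-2) 2 K" and T: "open T" "T \<subseteq> disc" "0 \<in> T" "2 \<in> T"
  shows "(\<lambda>n. norm (deriv K ((inv_branch (-2) ^^ n) 0) / deriv K 2 - 1)) \<in> O(\<lambda>n. 1 / 5 ^ n)"
proof -
  let ?x = "\<lambda>n. (inv_branch (-2) ^^ n) 0"
  have 0: "0 \<in> disc" using T by auto
  have k: "deriv K 2 \<noteq> 0" using linearized_deriv[OF lin T(1-3)] by simp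
  have "(deriv K has_field_derivative deriv (deriv K) 2) (at 2)"
    using lin T by (intro holomorphic_derivI[of _ T] holomorphic_deriv) (auto simp: linearized_def)
  from has_field_derivative_local_Lipschitz[OF this]
  have "\<forall>\<^sub>F n in sequentially. norm (deriv K (?x n) - deriv K 2) \<le> (norm (deriv (deriv K) 2) + 1) * norm (?x n - 2)"
    by (rule eventually_compose_filterlim) (use funpow_tendsto_fixpt(1)[OF _ fixpt_chat 0] in simp)
  then have "\<forall>\<^sub>F n in sequentially. norm (deriv K (?x n) / deriv K 2 - 1)
     \<le> ((norm (deriv (deriv K) 2) + 1) * 2 / norm (deriv K 2)) * norm (1 / 5 ^ n :: real)"
  proof eventually_elim
    case (elim n)
    have "norm (?x n - 2) \<le> 2 / 5 ^ n" using funpow_tendsto_fixpt(2)[OF _ fixpt_chat 0, of n] by simp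
    then have "norm (deriv K (?x n) - deriv K 2) \<le> (norm (deriv (deriv K) 2) + 1) * (2 / 5 ^ n)"
      by (intro order_trans[OF elim] mult_left_mono) auto
    then have "norm (deriv K (?x n) - deriv K 2) / norm (deriv K 2) \<le> (norm (deriv (deriv K) 2) + 1) * (2 / 5 ^ n) / norm (deriv K 2)"
      by (intro divide_right_mono) auto
    moreover have "deriv K (?x n) / deriv K 2 - 1 = (deriv K (?x n) - deriv K 2) / deriv K 2"
      using k by (simp add: diff_divide_distrib)
    ultimately show ?case by (simp add: norm_divide mult.commute)
  qed
  then show ?thesis by (intro bigoI[where c = "(norm (deriv (deriv K) 2) + 1) * 2 / norm (deriv K 2)"]) simp
qed

text \<open>
  The number of iterates is tied to the parameter: after \<open>j\<close> iterates at \<open>c j\<close> the linearizer is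
  resolved up to \<open>5 ^ -j\<close>, while the distortion between \<open>c j\<close> and \<open>-2\<close> is of order
  \<open>j * norm (c j + 2)\<close>, which tends to \<open>0\<close>.
\<close>

lemma nearby_deriv_tendsto:
  assumes c: "\<And>j. norm (c j + 2) \<le> 1 / (real j + 1)\<^sup>2"
    and lin: "\<forall>\<^sub>F j in sequentially. linearized T (c j) (b j) (K j)" and lin0: "linearized T (-2) 2 K0"
    and T: "open T" "T \<subseteq> disc" "0 \<in> T"
  shows "(\<lambda>j. deriv (K j) (b j)) \<longlonglongrightarrow> deriv K0 2"
proof -
  define s where "s c b m = slope c m 0 b / slope c m b b" for c b m
  \<comment> \<open>\<open>X\<close> and \<open>W\<close> compare the limiting slope quotients at
    \<open>c j\<close> and -2 with their j-th approximations; \<open>Y\<close> and \<open>Z\<close>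
    compare these approximations across parameters. All four tend to 1, and solving for K'(b) gives
    2 K0'(2) W Z / (b X Y).\<close>
  define X where "X j = (- 1 / (b j * deriv (K j) (b j))) / s (c j) (b j) j" for j
  define W where "W j = (- 1 / (2 * deriv K0 2)) / s (-2) 2 j" for j
  define Y where "Y j = slope (c j) j 0 (b j) / slope (-2) j 0 2" for j
  define Z where "Z j = slope (c j) j (b j) (b j) / slope (-2) j 2 2" for j
  have exp: "(\<lambda>j. exp (6 / 5 ^ j) - 1 :: real) \<longlonglongrightarrow> 0" by real_asymp
  have e2: "(\<lambda>j. exp (7 * (real j + 1) / (real j + 1)\<^sup>2) - 1 :: real) \<longlonglongrightarrow> 0" by real_asymp
  have 0: "0 \<in> disc" "2 \<in> disc" using T fixpt_disc[OF fixpt_chat] by auto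
  have "(\<lambda>j. X j - 1) \<longlonglongrightarrow> 0"
    using lin by (intro Lim_null_comparison[OF _ exp]) (auto elim!: eventually_mono simp: X_def s_def dest: linearized_deriv(2)[OF _ T])
  then have X: "X \<longlonglongrightarrow> 1" by (simp add: LIM_zero_iff)
  have "(\<lambda>j. W j - 1) \<longlonglongrightarrow> 0"
    by (intro Lim_null_comparison[OF _ exp] always_eventually allI) (use linearized_deriv(2)[OF lin0 T] in \<open>simp add: W_def s_def\<close>)
  then have W: "W \<longlonglongrightarrow> 1" by (simp add: LIM_zero_iff)
  have YZ: "\<forall>\<^sub>F j in sequentially. norm (Y j - 1) \<le> exp (7 * (real j + 1) / (real j + 1)\<^sup>2) - 1
     \<and> norm (Z j - 1) \<le> exp (7 * (real j + 1) / (real j + 1)\<^sup>2) - 1 \<and> norm (b j - 2) \<le> 1 / (real j + 1)\<^sup>2"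
    using lin
  proof eventually_elim
    case (elim j)
    then have cj: "norm (c j + 2) \<le> 1/5" and b: "fixpt (c j) (b j)" by (auto simp: linearized_def)
    let ?e = "1 / (real j + 1)\<^sup>2"
    have bd: "norm (b j - 2) \<le> ?e / 2" using fixpt_Lipschitz[OF b fixpt_chat] c[of j] by simp
    have "5 * real j * norm (c j - -2) \<le> 5 * real j * ?e" using c[of j] by (intro mult_left_mono) auto
    then have le: "2 * (norm (b j - 2) + norm (b j - 2)) + 5 * real j * norm (c j - -2) \<le> 7 * (real j + 1) / (real j + 1)\<^sup>2"
    proof -
      have "2 * (norm (b j - 2) + norm (b j - 2)) + 5 * real j * norm (c j - -2) \<le> 2 * ?e + 5 * real j * ?e"
        using mult_left_mono[OF bd, of 4]
        by (intro add_mono \<open>5 * real j * norm (c j - -2) \<le> 5 * real j * ?e\<close>) simp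
      also have "\<dots> = (2 + 5 * real j) / (real j + 1)\<^sup>2" by (simp add: add_divide_distrib)
      also have "\<dots> \<le> 7 * (real j + 1) / (real j + 1)\<^sup>2" by (intro divide_right_mono) auto
      finally show ?thesis .
    qed
    have 1: "norm (Y j - 1) \<le> exp (2 * (norm (0 - 0 :: complex) + norm (b j - 2)) + 5 * real j * norm (c j - -2)) - 1"
      unfolding Y_def by (intro slope_distortion cj 0 fixpt_disc[OF b]) simp
    have 2: "norm (Z j - 1) \<le> exp (2 * (norm (b j - 2) + norm (b j - 2)) + 5 * real j * norm (c j - -2)) - 1"
      unfolding Z_def by (intro slope_distortion cj 0 fixpt_disc[OF b]) simp
    have le': "2 * (norm (0 - 0 :: complex) + norm (b j - 2)) + 5 * real j * norm (c j - -2) \<le> 7 * (real j + 1) / (real j + 1)\<^sup>2"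
      by (rule order_trans[OF _ le]) simp
    have half: "x / 2 \<le> x" if "0 \<le> x" for x :: real using that by simp
    have mono: "exp x - 1 \<le> exp y - 1" if "x \<le> y" for x y :: real using that by simp
    show ?case
    proof (intro conjI)
      show "norm (Y j - 1) \<le> exp (7 * (real j + 1) / (real j + 1)\<^sup>2) - 1" by (rule order_trans[OF 1 mono[OF le']])
      show "norm (Z j - 1) \<le> exp (7 * (real j + 1) / (real j + 1)\<^sup>2) - 1" by (rule order_trans[OF 2 mono[OF le]])
      show "norm (b j - 2) \<le> ?e" by (rule order_trans[OF bd half]) simp
    qed
  qed
  have "(\<lambda>j. Y j - 1) \<longlonglongrightarrow> 0" by (rule Lim_null_comparison[OF _ e2]) (use YZ in eventually_elim, auto)
  then have Y: "Y \<longlonglongrightarrow> 1" by (simp add: LIM_zero_iff)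
  have "(\<lambda>j. Z j - 1) \<longlonglongrightarrow> 0" by (rule Lim_null_comparison[OF _ e2]) (use YZ in eventually_elim, auto)
  then have Z: "Z \<longlonglongrightarrow> 1" by (simp add: LIM_zero_iff)
  have "(\<lambda>j. 1 / (real j + 1)\<^sup>2) \<longlonglongrightarrow> 0" by real_asymp
  then have "(\<lambda>j. b j - 2) \<longlonglongrightarrow> 0" by (rule Lim_null_comparison[rotated]) (use YZ in eventually_elim, auto)
  then have b: "b \<longlonglongrightarrow> 2" by (simp add: LIM_zero_iff)
  have "(\<lambda>j. 2 * deriv K0 2 * W j * Z j / (b j * X j * Y j)) \<longlonglongrightarrow> 2 * deriv K0 2 * 1 * 1 / (2 * 1 * 1)"
    by (intro tendsto_intros X W Y Z b) auto
  moreover have "\<forall>\<^sub>F j in sequentially. 2 * deriv K0 2 * W j * Z j / (b j * X j * Y j) = deriv (K j) (b j)"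
    using lin
  proof eventually_elim
    case (elim j)
    then have cj: "norm (c j + 2) \<le> 1/5" and b: "fixpt (c j) (b j)" by (auto simp: linearized_def)
    have "b j \<noteq> 0" using fixpt_Re[OF b] by auto
    moreover have "deriv (K j) (b j) \<noteq> 0" "deriv K0 2 \<noteq> 0"
      using linearized_deriv(1)[OF elim T] linearized_deriv(1)[OF lin0 T] by auto
    moreover have "slope (c j) j 0 (b j) \<noteq> 0" "slope (c j) j (b j) (b j) \<noteq> 0" "slope (-2) j 0 2 \<noteq> 0" "slope (-2) j 2 2 \<noteq> 0"
      by (intro slope_nonzero cj 0 fixpt_disc[OF b]; simp)+
    ultimately show ?case by (simp add: X_def Y_def Z_def W_def s_def)
  qed
  ultimately show ?thesis by (simp add: tendsto_cong)
qed

text \<open>The directional derivative of A0 at -2 is computed twice along c = -2 + r v: from the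
  decomposition, and from A0 being approximately (\<open>third c 0\<close> - b) K'(b). The steps r =
  1 / (j + 1)^2 fit \<open>nearby_deriv_tendsto\<close>.\<close>

lemma center_derivatives_direction:
  assumes \<beta>: "fixed_point_branch \<beta>"
    and lin: "\<forall>\<^sub>F c in nhds (-2). linearized T c (\<beta> c) (Koe c)"
    and T: "open T" "T \<subseteq> disc" "0 \<in> T" "2 \<in> T"
    and A0: "\<forall>\<^sub>F c in nhds (-2). A0 c = Koe c (third c 0)"
    and dec: "center_decomposition A0 B Bs"
    and v: "norm v = 1"
  shows "v * B (-2) + cnj v * Bs (-2) = (- 224/15 * v + 64/15 * cnj v) * deriv (Koe (-2)) 2"
proof -
  have B: "(B \<longlongrightarrow> B (-2)) (nhds (-2))" "(Bs \<longlongrightarrow> Bs (-2)) (nhds (-2))"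
    and A0B: "\<forall>\<^sub>F c in nhds (-2). A0 c = (c - -2) * B c + cnj (c - -2) * Bs c"
    using dec real_analytic_at_tendsto by (auto simp: center_decomposition_def)
  define r where "r j = 1 / (real j + 1)\<^sup>2" for j
  define c where "c j = -2 + of_real (r j) * v" for j
  define b where "b j = \<beta> (c j)" for j
  define d where "d j = third (c j) 0 - b j" for j
  define k where "k j = deriv (Koe (c j)) (b j)" for j
  have r: "r \<longlonglongrightarrow> 0" unfolding r_def by real_asymp
  have r0: "0 < r j" for j by (simp add: r_def)
  have c: "norm (c j + 2) = r j" for j using r0[of j] v by (simp add: c_def norm_mult)
  have "(\<lambda>j. c j) \<longlonglongrightarrow> -2 + of_real 0 * v" unfolding c_def by (intro tendsto_intros r)
  then have cl: "filterlim c (nhds (-2)) sequentially" by simp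
  have lin0: "linearized T (-2) 2 (Koe (-2))"
    using eventually_nhds_x_imp_x[OF lin] fixed_point_branch_fixpt(1)[OF \<beta>] by simp
  have linj: "\<forall>\<^sub>F j in sequentially. linearized T (c j) (b j) (Koe (c j))"
    unfolding b_def by (rule eventually_compose_filterlim[OF lin cl])
  have k: "k \<longlonglongrightarrow> deriv (Koe (-2)) 2"
    unfolding k_def using c by (intro nearby_deriv_tendsto[OF _ linj lin0 T(1-3)]) (simp add: r_def)
  have "\<forall>\<^sub>F j in sequentially. norm (d j / of_real (r j) - (- 224/15 * v + 64/15 * cnj v)) \<le> 71 * r j"
    using linj
  proof eventually_elim
    case (elim j)
    then have "norm ((third (c j) 0 - b j) - (third (-2) 0 - 2) - (- 224/15 * (c j - -2) + 64/15 * cnj (c j - -2))) \<le> 71 * r j * norm (c j - -2)"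
      using c[of j] r0[of j] by (intro third_fixpt_expansion fixpt_chat) (auto simp: linearized_def)
    moreover have "(third (c j) 0 - b j) - (third (-2) 0 - 2) - (- 224/15 * (c j - -2) + 64/15 * cnj (c j - -2))
       = of_real (r j) * (d j / of_real (r j) - (- 224/15 * v + 64/15 * cnj v))"
      using r0[of j] by (simp add: d_def c_def third_def field_simps)
    ultimately have "r j * norm (d j / of_real (r j) - (- 224/15 * v + 64/15 * cnj v)) \<le> r j * (71 * r j)"
      using r0[of j] c[of j] by (simp add: norm_mult)
    then show ?case using r0[of j] by (simp add: mult_le_cancel_left)
  qed
  moreover have "(\<lambda>j. 71 * r j) \<longlonglongrightarrow> 0" using r by (auto intro!: tendsto_eq_intros)
  ultimately have "(\<lambda>j. d j / of_real (r j) - (- 224/15 * v + 64/15 * cnj v)) \<longlonglongrightarrow> 0"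
    by (rule Lim_null_comparison)
  then have dr: "(\<lambda>j. d j / of_real (r j)) \<longlonglongrightarrow> - 224/15 * v + 64/15 * cnj v" by (simp add: LIM_zero_iff)
  have "(\<lambda>j. of_real (r j) * (d j / of_real (r j))) \<longlonglongrightarrow> of_real 0 * (- 224/15 * v + 64/15 * cnj v)"
    by (intro tendsto_mult dr tendsto_of_real r)
  then have d: "d \<longlonglongrightarrow> 0" using r0 by (simp add: less_imp_neq[symmetric])
  have "isCont (\<lambda>c. third c 0) (-2)" unfolding third_def by (intro continuous_intros)
  then have "((\<lambda>c. third c 0) \<longlongrightarrow> 2) (nhds (-2))"
    using tendsto_at_iff_tendsto_nhds[of "\<lambda>c. third c 0" "-2"] by (simp add: isCont_def third_def)
  then have "\<forall>\<^sub>F c in nhds (-2). third c 0 \<in> T" using T by (intro topological_tendstoD)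
  then have "\<forall>\<^sub>F j in sequentially. third (c j) 0 \<in> T" by (rule eventually_compose_filterlim[OF _ cl])
  moreover note linj
  moreover have "\<forall>\<^sub>F j in sequentially. A0 (c j) = Koe (c j) (third (c j) 0)"
    by (rule eventually_compose_filterlim[OF A0 cl])
  ultimately have "\<forall>\<^sub>F j in sequentially. norm (A0 (c j) / of_real (r j) - d j / of_real (r j) * k j)
     \<le> norm (d j / of_real (r j)) * norm (k j) * (exp (2 * norm (d j)) - 1)"
  proof eventually_elim
    case (elim j)
    have "norm (A0 (c j) - d j * k j) \<le> norm (d j) * norm (k j) * (exp (2 * norm (d j)) - 1)"
      using linearized_expansion[OF elim(2) T(1,2) elim(1)] elim(3) by (simp add: d_def k_def)
    then have "norm (A0 (c j) - d j * k j) / r j \<le> norm (d j) * norm (k j) * (exp (2 * norm (d j)) - 1) / r j"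
      using r0[of j] by (intro divide_right_mono) auto
    moreover have "A0 (c j) / of_real (r j) - d j / of_real (r j) * k j = (A0 (c j) - d j * k j) / of_real (r j)"
      by (simp add: diff_divide_distrib)
    ultimately show ?case using r0[of j] by (simp add: norm_divide)
  qed
  moreover have "(\<lambda>j. norm (d j / of_real (r j)) * norm (k j) * (exp (2 * norm (d j)) - 1))
      \<longlonglongrightarrow> norm (- 224/15 * v + 64/15 * cnj v) * norm (deriv (Koe (-2)) 2) * (exp (2 * norm (0::complex)) - 1)"
    by (intro tendsto_intros dr k d)
  then have "(\<lambda>j. norm (d j / of_real (r j)) * norm (k j) * (exp (2 * norm (d j)) - 1)) \<longlonglongrightarrow> 0" by simp
  ultimately have 1: "(\<lambda>j. A0 (c j) / of_real (r j) - d j / of_real (r j) * k j) \<longlonglongrightarrow> 0"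
    by (rule Lim_null_comparison)
  have "(\<lambda>j. A0 (c j) / of_real (r j) - d j / of_real (r j) * k j + d j / of_real (r j) * k j)
     \<longlonglongrightarrow> 0 + (- 224/15 * v + 64/15 * cnj v) * deriv (Koe (-2)) 2"
    by (intro tendsto_intros 1 dr k)
  then have 2: "(\<lambda>j. A0 (c j) / of_real (r j)) \<longlonglongrightarrow> (- 224/15 * v + 64/15 * cnj v) * deriv (Koe (-2)) 2"
    by simp
  have 3: "(\<lambda>j. v * B (c j) + cnj v * Bs (c j)) \<longlonglongrightarrow> v * B (-2) + cnj v * Bs (-2)"
    by (intro tendsto_intros filterlim_compose[OF B(1) cl] filterlim_compose[OF B(2) cl])
  have 4: "\<forall>\<^sub>F j in sequentially. A0 (c j) / of_real (r j) = v * B (c j) + cnj v * Bs (c j)"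
    using eventually_compose_filterlim[OF A0B cl]
  proof eventually_elim
    case (elim j)
    then show ?case using r0[of j] by (simp add: c_def field_simps)
  qed
  show ?thesis by (rule LIMSEQ_unique[OF 3 Lim_transform_eventually[OF 2 4]])
qed

text \<open>The directions 1 and i separate the two Wirtinger derivatives.\<close>

lemma center_derivatives:
  assumes "fixed_point_branch \<beta>"
    and "\<forall>\<^sub>F c in nhds (-2). linearized T c (\<beta> c) (Koe c)"
    and "open T" "T \<subseteq> disc" "0 \<in> T" "2 \<in> T"
    and "\<forall>\<^sub>F c in nhds (-2). A0 c = Koe c (third c 0)"
    and "center_decomposition A0 B Bs"
  shows "B (-2) = - 224/15 * deriv (Koe (-2)) 2" and "Bs (-2) = 64/15 * deriv (Koe (-2)) 2"
proof -
  let ?k = "deriv (Koe (-2)) 2"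
  have 1: "B (-2) + Bs (-2) = - 224/15 * ?k + 64/15 * ?k"
    using center_derivatives_direction[OF assms, of 1] by (simp add: algebra_simps)
  have "\<i> * (B (-2) - Bs (-2)) = \<i> * (- 224/15 * ?k - 64/15 * ?k)"
    using center_derivatives_direction[OF assms, of \<i>] by (simp add: algebra_simps)
  then have 2: "B (-2) - Bs (-2) = - 224/15 * ?k - 64/15 * ?k" by (simp only: mult_cancel_left) simp
  have "B (-2) = ((B (-2) + Bs (-2)) + (B (-2) - Bs (-2))) / 2" by simp
  then show "B (-2) = - 224/15 * ?k" unfolding 1 2 by simp
  have "Bs (-2) = ((B (-2) + Bs (-2)) - (B (-2) - Bs (-2))) / 2" by simp
  then show "Bs (-2) = 64/15 * ?k" unfolding 1 2 by simp
qed

section \<open>Renormalization\<close>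

text \<open>The argument condition says Arg \<alpha> + Arg x = -2 Arg \<alpha> modulo 2 pi. The
  resulting identity makes the coefficient of (cnj Z)^2 equal to 1 in the limit.\<close>

lemma scaling_constant_cube:
  assumes "scaling_constant x \<alpha>"
  shows "norm \<alpha> = norm x" and "\<alpha> * x = (cnj \<alpha>)\<^sup>2"
proof -
  show n: "norm \<alpha> = norm x" using assms by (simp add: scaling_constant_def)
  obtain k :: int where k: "3 * Arg \<alpha> = - Arg x + 2 * pi * of_int k"
    using assms by (auto simp: scaling_constant_def)
  have polar: "z = of_real (norm z) * cis (Arg z)" for z
    using rcis_cmod_Arg[of z] by (simp add: rcis_def)
  have "cis (Arg \<alpha> + Arg x) = cis (- Arg \<alpha> + - Arg \<alpha> + 2 * pi * of_int k)"
    using k by (intro arg_cong[where f = cis]) simp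
  also have "\<dots> = cis (- Arg \<alpha>) * cis (- Arg \<alpha>) * cis (2 * pi * of_int k)"
    by (simp only: cis_mult)
  also have "cis (2 * pi * of_int k) = 1" by (rule cis_multiple_2pi) simp
  finally have "cis (Arg \<alpha>) * cis (Arg x) = (cis (- Arg \<alpha>))\<^sup>2"
    by (simp add: cis_mult power2_eq_square)
  moreover have "\<alpha> * x = of_real (norm x) ^ 2 * (cis (Arg \<alpha>) * cis (Arg x))"
    by (subst (1) polar[of \<alpha>], subst (1) polar[of x]) (simp add: n power2_eq_square mult_ac)
  moreover have "cnj \<alpha> = of_real (norm x) * cis (- Arg \<alpha>)"
    by (subst polar[of \<alpha>]) (simp add: n cis_cnj)
  ultimately show "\<alpha> * x = (cnj \<alpha>)\<^sup>2" by (simp add: power_mult_distrib)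
qed

section \<open>Asymptotic tools\<close>

lemma bigo_le:
  "\<forall>\<^sub>F x in F. norm (f x) \<le> norm (g x) \<Longrightarrow> g \<in> O[F](h) \<Longrightarrow> f \<in> O[F](h)"
  by (rule landau_o.big_trans[OF landau_o.big_mono])

lemma norm_le_norm_real: "0 \<le> x \<Longrightarrow> x \<le> y \<Longrightarrow> norm x \<le> norm (y :: real)"
  by simp

lemma eventually_le_of_bigo:
  fixes f g :: "'a \<Rightarrow> real"
  assumes "f \<in> O[F](g)" "(g \<longlongrightarrow> 0) F" "0 < e"
  shows "\<forall>\<^sub>F x in F. f x \<le> e"
proof -
  obtain C where C: "C > 0" "\<forall>\<^sub>F x in F. norm (f x) \<le> C * norm (g x)" using assms(1) by (elim landau_o.bigE)
  have "((\<lambda>x. C * norm (g x)) \<longlongrightarrow> C * norm (0::real)) F" by (intro tendsto_intros assms(2))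
  then have "\<forall>\<^sub>F x in F. C * norm (g x) < e" using assms(3) by (intro order_tendstoD) auto
  with C(2) show ?thesis by eventually_elim auto
qed

lemma linear_times_exp_le:
  assumes "0 < d" shows "real n * exp (- d * real n) \<le> 2 / d * exp (- (d / 2) * real n)"
proof -
  have "d / 2 * real n \<le> exp (d / 2 * real n)"
    using exp_ge_add_one_self[of "d / 2 * real n"] by linarith
  then have "real n \<le> 2 / d * exp (d / 2 * real n)" using assms by (simp add: field_simps)
  then have "real n * exp (- d * real n) \<le> 2 / d * exp (d / 2 * real n) * exp (- d * real n)"
    by (intro mult_right_mono) auto
  also have "\<dots> = 2 / d * exp (- (d / 2) * real n)" by (simp add: algebra_simps flip: exp_add)
  finally show ?thesis .
qed

text \<open>\<open>rho\<close> applies the adjugate of the real linear map r -> b r + bs cnj r to k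
  t. The cnj t terms cancel, and its determinant |b|^2 - |bs|^2 is left.\<close>

lemma rho_linear_form:
  "b * rho k b bs t + bs * cnj (rho k b bs t) = k * of_real ((norm b)\<^sup>2 - (norm bs)\<^sup>2) * t"
  unfolding rho_def of_real_diff complex_norm_square by (simp add: algebra_simps)

text \<open>
  A bound along this filter is a bound for large \<open>n\<close> that is uniform over the admissible
  \<open>Z\<close> and \<open>t\<close>.
\<close>

definition growth_filter :: "(nat \<Rightarrow> real) \<Rightarrow> (nat \<Rightarrow> real) \<Rightarrow> (nat \<times> complex \<times> complex) filter" where
  "growth_filter X Y = inf (filtercomap fst sequentially)
     (principal {p. norm (fst (snd p)) \<le> X (fst p) \<and> norm (snd (snd p)) \<le> Y (fst p)})"

lemma eventually_growth_filter:
  "eventually P (growth_filter X Y) \<longleftrightarrow>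
     (\<forall>\<^sub>F n in sequentially. \<forall>Z t. norm Z \<le> X n \<longrightarrow> norm t \<le> Y n \<longrightarrow> P (n, Z, t))"
proof
  assume "eventually P (growth_filter X Y)"
  then obtain R where R: "eventually R sequentially"
    "\<And>p. R (fst p) \<Longrightarrow> norm (fst (snd p)) \<le> X (fst p) \<and> norm (snd (snd p)) \<le> Y (fst p) \<Longrightarrow> P p"
    unfolding growth_filter_def eventually_inf_principal eventually_filtercomap by auto
  show "\<forall>\<^sub>F n in sequentially. \<forall>Z t. norm Z \<le> X n \<longrightarrow> norm t \<le> Y n \<longrightarrow> P (n, Z, t)"
    using R(1) by eventually_elim (use R(2) in auto)
next
  assume *: "\<forall>\<^sub>F n in sequentially. \<forall>Z t. norm Z \<le> X n \<longrightarrow> norm t \<le> Y n \<longrightarrow> P (n, Z, t)"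
  show "eventually P (growth_filter X Y)"
    unfolding growth_filter_def eventually_inf_principal eventually_filtercomap
    by (rule exI, rule conjI[OF *]) auto
qed

lemma filterlim_fst_growth_filter: "filterlim fst sequentially (growth_filter X Y)"
  unfolding growth_filter_def by (rule filterlim_mono[OF filterlim_filtercomap order_refl]) simp

lemma bigo_fst_growth_filter:
  "f \<in> O(g) \<Longrightarrow> (\<lambda>p. f (fst p)) \<in> O[growth_filter X Y](\<lambda>p. g (fst p))"
  by (rule landau_o.big.compose[OF _ filterlim_fst_growth_filter])

lemma eventually_fst_growth_filter:
  "eventually P sequentially \<Longrightarrow> \<forall>\<^sub>F p in growth_filter X Y. P (fst p)"
  by (rule eventually_compose_filterlim[OF _ filterlim_fst_growth_filter])

lemma cn_tendsto: "(\<lambda>n. complex_of_real (cn n)) \<longlonglongrightarrow> -2"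
proof -
  have "(\<lambda>n. cn n - -2) \<longlonglongrightarrow> 0"
  proof (rule Lim_null_comparison)
    show "\<forall>\<^sub>F n in sequentially. norm (cn n - -2) \<le> 1 / 4 ^ n"
      using eventually_ge_at_top[of 1]
    proof eventually_elim
      case (elim n)
      then show ?case using cn_near_minus_two[of n] cn_gt[of n] by simp
    qed
    show "(\<lambda>n. 1 / 4 ^ n :: real) \<longlonglongrightarrow> 0" by real_asymp
  qed
  then have "cn \<longlonglongrightarrow> -2" by (subst (asm) LIM_zero_iff)
  then have "(\<lambda>n. complex_of_real (cn n)) \<longlonglongrightarrow> of_real (-2)" by (rule tendsto_of_real)
  then show ?thesis by simp
qed

text \<open>S is a common scale for |Z|^2 and |t|. In powers of n, \<alpha> has order 16^n, the
  slope Q 16^(-n) and K at most 256^(-n); w and the parameter increment r are at most of order S /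
  256^n, and E of order S / 16^n. The relative errors are O(n / 4^n), the size of n |c + 2|; the
  quadratic error S^2 / 16^n is no larger than S / 4^n because S \<le> 4^n.\<close>

lemma renormalization_bigo:
  fixes \<beta> :: "complex \<Rightarrow> complex" and \<alpha> mu :: "nat \<Rightarrow> complex" and a k :: complex and S X Y :: "nat \<Rightarrow> real"
  assumes \<beta>: "\<forall>\<^sub>F c in nhds (-2). fixpt c (\<beta> c)"
    and k: "k \<noteq> 0" and a: "a \<noteq> 0"
    and mu: "\<And>n. a = 16 ^ n * slope (-2) n 0 0 * k * mu n" "(\<lambda>n. norm (mu n - 1)) \<in> O(\<lambda>n. 1 / 5 ^ n)"
    and \<alpha>: "\<And>n. 1 \<le> n \<Longrightarrow> norm (\<alpha> n) = 16 ^ n * norm (16 * k / a)"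
      "\<And>n. 1 \<le> n \<Longrightarrow> \<alpha> n * (16 ^ n * (- 16 * k) / a) = (cnj (\<alpha> n))\<^sup>2"
    and b: "b0 = - 224/15 * k" "b0s = 64/15 * k"
    and S: "\<And>n. 0 \<le> S n" "\<And>n. S n \<le> 4 ^ n" "(\<lambda>n. (X n)\<^sup>2) \<in> O(S)" "Y \<in> O(S)"
    and kn_eq: "\<And>n. 1 \<le> n \<Longrightarrow> K n = a / (\<alpha> n * (4 * \<beta> (cn n) * cnj (\<beta> (cn n))) ^ n)"
  shows "(\<lambda>(n, Z, t). norm (renorm n (\<alpha> n) (of_real (cn n) + rho (K n) b0 b0s t) Z
            - (cnj Z)\<^sup>2 - of_real ((norm b0)\<^sup>2 - (norm b0s)\<^sup>2) * t))
     \<in> O[growth_filter X Y](\<lambda>p. real (fst p) / 4 ^ fst p * S (fst p))"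
proof -
  define F where "F = growth_filter X Y"
  define Z t :: "nat \<times> complex \<times> complex \<Rightarrow> complex" where "Z p = fst (snd p)" and "t p = snd (snd p)" for p
  define Q where "Q n = slope (-2) n 0 0" for n
  define c' where "c' n = complex_of_real (cn n)" for n
  define b' where "b' n = \<beta> (c' n)" for n
  \<comment> \<open>\<open>K\<close> is built with the multiplier at \<open>cn n\<close>, the
    linearizer identities with 16; \<open>nu\<close> is the n-th power of the quotient, and tends to
    1 as a slope quotient at two fixed points.\<close>
  define nu where "nu n = (16 / (4 * b' n * cnj (b' n))) ^ n" for n
  define D where "D = (norm b0)\<^sup>2 - (norm b0s)\<^sup>2"
  have pos: "\<forall>\<^sub>F n in sequentially. 1 \<le> (n::nat)" by (rule eventually_ge_at_top)
  note seq = bigo_fst_growth_filter[where X = X and Y = Y, folded F_def]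
  note evn = eventually_fst_growth_filter[where X = X and Y = Y, folded F_def]

  have Q0: "Q n \<noteq> 0" for n using mu(1)[of n] a by (auto simp: Q_def)
  have mu0: "mu n \<noteq> 0" for n using mu(1)[of n] a by auto
  have \<alpha>0: "\<alpha> n \<noteq> 0" if "1 \<le> n" for n using \<alpha>(1)[OF that] k a by auto
  have norm_Q: "norm (1 / Q n) = 16 ^ n * norm (k / a * mu n)" for n
  proof -
    have "1 / Q n = 16 ^ n * (k / a * mu n)" using mu(1)[of n] Q0[of n] a by (simp add: Q_def field_simps)
    then show ?thesis by (simp only: norm_mult norm_power norm_numeral)
  qed
  have mu_lim: "\<forall>\<^sub>F n in sequentially. norm (mu n - 1) \<le> 1/2"
    by (rule eventually_le_of_bigo[OF mu(2)]) (real_asymp, simp)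
  have O_mu: "(\<lambda>n. norm (mu n)) \<in> O(\<lambda>n. 1)"
  proof (rule bigoI[where c = 2])
    show "\<forall>\<^sub>F n in sequentially. norm (norm (mu n)) \<le> 2 * norm (1::real)"
      using mu_lim
    proof eventually_elim
      case (elim n)
      then show ?case using norm_triangle_ineq[of "mu n - 1" 1] by simp
    qed
  qed
  have O_invmu: "(\<lambda>n. norm (1 / mu n)) \<in> O(\<lambda>n. 1)"
  proof (rule bigoI[where c = 2])
    show "\<forall>\<^sub>F n in sequentially. norm (norm (1 / mu n)) \<le> 2 * norm (1::real)"
      using mu_lim by eventually_elim (use inverse_near_one(2) in auto)
  qed
  have O_invQ: "(\<lambda>n. norm (1 / Q n)) \<in> O(\<lambda>n. 16 ^ n)"
  proof -
    have "(\<lambda>n. 16 ^ n * (norm (k / a) * norm (mu n))) \<in> O(\<lambda>n. 16 ^ n * (1 * 1))"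
      by (intro landau_o.big.mult O_mu) simp_all
    then show ?thesis unfolding norm_Q norm_mult by simp
  qed
  have O_Q: "(\<lambda>n. norm (Q n)) \<in> O(\<lambda>n. 1 / 16 ^ n)"
  proof -
    have "Q n = a / k * (1 / mu n) * (1 / 16 ^ n)" for n
      using mu(1)[of n] k mu0[of n] by (simp add: Q_def field_simps)
    then have eq: "norm (Q n) = norm (a / k) * norm (1 / mu n) * (1 / 16 ^ n)" for n
      by (metis norm_mult norm_divide norm_one norm_power norm_numeral)
    have "(\<lambda>n. norm (a / k) * norm (1 / mu n) * (1 / 16 ^ n)) \<in> O(\<lambda>n. 1 * 1 * (1 / 16 ^ n))"
      by (intro landau_o.big.mult O_invmu) simp_all
    then show ?thesis unfolding eq by simp
  qed
  have O_\<alpha>: "(\<lambda>n. norm (\<alpha> n)) \<in> O(\<lambda>n. 16 ^ n)"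
    by (rule bigoI[where c = "norm (16 * k / a)"])
       (use pos in eventually_elim, simp add: \<alpha>(1) mult.commute)
  have O_inv\<alpha>: "(\<lambda>n. norm (1 / \<alpha> n)) \<in> O(\<lambda>n. 1 / 16 ^ n)"
    by (rule bigoI[where c = "1 / norm (16 * k / a)"])
       (use pos in eventually_elim, simp add: \<alpha>(1) norm_divide mult.commute)

  have c'_near: "norm (c' n + 2) \<le> 1 / 4 ^ n" if "1 \<le> n" for n
  proof -
    have "c' n + 2 = of_real (cn n + 2)" by (simp add: c'_def)
    then have "norm (c' n + 2) = \<bar>cn n + 2\<bar>" by (simp only: norm_of_real)
    then show ?thesis using cn_near_minus_two[OF that] cn_gt[OF that] by simp
  qed
  have c'_lim: "c' \<longlonglongrightarrow> -2" unfolding c'_def by (rule cn_tendsto)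
  have b'_fix: "\<forall>\<^sub>F n in sequentially. fixpt (c' n) (b' n)"
    unfolding b'_def by (rule eventually_compose_filterlim[OF \<beta> c'_lim])

  have O_nu: "(\<lambda>n. norm (nu n - 1)) \<in> O(\<lambda>n. real n / 4 ^ n)"
  proof (rule bigoI[where c = 14])
    have "(\<lambda>n. 7 * real n / 4 ^ n) \<longlonglongrightarrow> 0" by real_asymp
    then have "\<forall>\<^sub>F n in sequentially. 7 * real n / 4 ^ n < 1" by (rule order_tendstoD) simp
    then show "\<forall>\<^sub>F n in sequentially. norm (norm (nu n - 1)) \<le> 14 * norm (real n / 4 ^ n)"
      using b'_fix pos
    proof eventually_elim
      case (elim n)
      have "1 \<le> n" using elim by simp
      have "(1::real) / 4 ^ n \<le> real n / 4 ^ n" using elim by (intro divide_right_mono) auto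
      moreover have "real n / 4 ^ n \<le> 1/5" using elim(1) by (simp add: field_simps)
      ultimately have c: "norm (c' n + 2) \<le> 1/5"
        using c'_near[OF \<open>1 \<le> n\<close>] by (blast intro: order_trans)
      have "norm (b' n - 2) \<le> real n / 4 ^ n / 2"
        using fixpt_Lipschitz[OF elim(2) fixpt_chat] c'_near[OF \<open>1 \<le> n\<close>] \<open>1 / 4 ^ n \<le> real n / 4 ^ n\<close> by simp
      moreover have "real n * norm (c' n - -2) \<le> real n * (1 / 4 ^ n)"
        using c'_near[OF \<open>1 \<le> n\<close>] by (intro mult_left_mono) auto
      ultimately have "2 * (norm (b' n - 2) + norm (b' n - 2)) + 5 * real n * norm (c' n - -2) \<le> 7 * real n / 4 ^ n"
        by (simp add: field_simps)
      then have "norm (slope (c' n) n (b' n) (b' n) / slope (-2) n 2 2 - 1) \<le> 2 * (7 * real n / 4 ^ n)"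
        using elim by (intro slope_distortion_linear c fixpt_disc[OF elim(2)] fixpt_disc[OF fixpt_chat]) auto
      moreover have "slope (c' n) n (b' n) (b' n) / slope (-2) n 2 2 = nu n"
        unfolding slope_fixpt[OF elim(2)] slope_fixpt[OF fixpt_chat] nu_def power_divide by simp
      ultimately show ?case by simp
    qed
  qed
  have nu_lim: "\<forall>\<^sub>F n in sequentially. norm (nu n - 1) \<le> 1"
    by (rule eventually_le_of_bigo[OF O_nu]) (real_asymp, simp)
  have O_nu1: "(\<lambda>n. norm (nu n)) \<in> O(\<lambda>n. 1)"
  proof (rule bigoI[where c = 2])
    show "\<forall>\<^sub>F n in sequentially. norm (norm (nu n)) \<le> 2 * norm (1::real)"
      using nu_lim
    proof eventually_elim
      case (elim n)
      then show ?case using norm_triangle_ineq[of "nu n - 1" 1] by simp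
    qed
  qed
  have O_munu: "(\<lambda>n. norm (mu n * nu n - 1)) \<in> O(\<lambda>n. real n / 4 ^ n)"
  proof (rule bigo_le)
    show "\<forall>\<^sub>F n in sequentially. norm (norm (mu n * nu n - 1)) \<le> norm (norm (mu n - 1) * norm (nu n) + norm (nu n - 1))"
    proof (intro always_eventually allI)
      fix n
      have "mu n * nu n - 1 = (mu n - 1) * nu n + (nu n - 1)" by (simp add: algebra_simps)
      then have "norm (mu n * nu n - 1) \<le> norm (mu n - 1) * norm (nu n) + norm (nu n - 1)"
        by (metis norm_mult norm_triangle_ineq)
      then show "norm (norm (mu n * nu n - 1)) \<le> norm (norm (mu n - 1) * norm (nu n) + norm (nu n - 1))" by simp
    qed
    have "(\<lambda>n. norm (mu n - 1) * norm (nu n)) \<in> O(\<lambda>n. 1 / 5 ^ n * 1)"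
      by (intro landau_o.big.mult mu O_nu1)
    also have "(\<lambda>n. 1 / 5 ^ n * 1 :: real) \<in> O(\<lambda>n. real n / 4 ^ n)" by real_asymp
    finally show "(\<lambda>n. norm (mu n - 1) * norm (nu n) + norm (nu n - 1)) \<in> O(\<lambda>n. real n / 4 ^ n)"
      by (intro sum_in_bigo O_nu)
  qed
  have K_eq: "K n = a * nu n / (\<alpha> n * 16 ^ n)" if "1 \<le> n" for n
    unfolding kn_eq[OF that] nu_def b'_def c'_def power_divide by simp
  have O_K: "(\<lambda>n. norm (K n)) \<in> O(\<lambda>n. 1 / 256 ^ n)"
  proof (rule bigo_le)
    show "\<forall>\<^sub>F n in sequentially. norm (norm (K n)) \<le> norm (norm a * norm (nu n) * norm (1 / \<alpha> n) * (1 / 16 ^ n))"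
      using pos by eventually_elim (simp add: K_eq norm_mult norm_divide norm_power)
    have "(\<lambda>n. norm a * norm (nu n) * norm (1 / \<alpha> n) * (1 / 16 ^ n)) \<in> O(\<lambda>n. 1 * 1 * (1 / 16 ^ n) * (1 / 16 ^ n))"
      by (intro landau_o.big.mult O_nu1 O_inv\<alpha>) simp_all
    then show "(\<lambda>n. norm a * norm (nu n) * norm (1 / \<alpha> n) * (1 / 16 ^ n)) \<in> O(\<lambda>n. 1 / 256 ^ n)"
      by (simp flip: power_mult_distrib)
  qed

  define N where "N p = fst p" for p :: "nat \<times> complex \<times> complex"
  define s where "s p = S (N p)" for p
  define r where "r p = rho (K (N p)) b0 b0s (t p)" for p
  define w where "w p = (cnj (Z p / \<alpha> (N p)))\<^sup>2" for p
  \<comment> \<open>One bound for the distances of both \<open>cn n\<close> and the perturbed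
    parameter from -2.\<close>
  define H where "H p = 1 / 4 ^ N p + norm (r p)" for p
  have inF: "\<forall>\<^sub>F p in F. norm (Z p) \<le> X (N p) \<and> norm (t p) \<le> Y (N p)"
    unfolding F_def eventually_growth_filter by (simp add: Z_def t_def N_def)
  have posF: "\<forall>\<^sub>F p in F. 1 \<le> N p" unfolding N_def by (rule evn[OF pos])
  have O_s4: "s \<in> O[F](\<lambda>p. 4 ^ N p)"
    by (rule landau_o.big_mono) (use S in \<open>simp add: s_def\<close>)
  have O_Z: "(\<lambda>p. (norm (Z p))\<^sup>2) \<in> O[F](s)"
  proof (rule bigo_le)
    show "\<forall>\<^sub>F p in F. norm ((norm (Z p))\<^sup>2) \<le> norm ((X (N p))\<^sup>2)"
      using inF by eventually_elim (simp add: power_mono)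
    show "(\<lambda>p. (X (N p))\<^sup>2) \<in> O[F](s)" unfolding s_def N_def by (rule seq[OF S(3)])
  qed
  have O_t: "(\<lambda>p. norm (t p)) \<in> O[F](s)"
  proof (rule bigo_le)
    show "\<forall>\<^sub>F p in F. norm (norm (t p)) \<le> norm (Y (N p))"
      using inF by eventually_elim auto
    show "(\<lambda>p. Y (N p)) \<in> O[F](s)" unfolding s_def N_def by (rule seq[OF S(4)])
  qed
  have O_r: "(\<lambda>p. norm (r p)) \<in> O[F](\<lambda>p. 1 / 256 ^ N p * s p)"
  proof (rule bigo_le)
    show "\<forall>\<^sub>F p in F. norm (norm (r p)) \<le> norm (norm (K (N p)) * norm (t p) * (norm b0 + norm b0s))"
    proof (intro always_eventually allI)
      fix p
      have "norm (r p) \<le> norm (K (N p) * cnj b0 * t p) + norm (cnj (K (N p)) * b0s * cnj (t p))"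
        unfolding r_def rho_def by (rule norm_triangle_ineq4)
      also have "\<dots> = norm (K (N p)) * norm (t p) * (norm b0 + norm b0s)"
        by (simp add: norm_mult algebra_simps)
      finally show "norm (norm (r p)) \<le> norm (norm (K (N p)) * norm (t p) * (norm b0 + norm b0s))" by simp
    qed
    have "(\<lambda>p. norm (K (N p)) * norm (t p) * (norm b0 + norm b0s)) \<in> O[F](\<lambda>p. 1 / 256 ^ N p * s p * 1)"
      unfolding N_def by (intro landau_o.big.mult seq[OF O_K] O_t) simp
    then show "(\<lambda>p. norm (K (N p)) * norm (t p) * (norm b0 + norm b0s)) \<in> O[F](\<lambda>p. 1 / 256 ^ N p * s p)" by simp
  qed
  have small: "(\<lambda>p. 1 / 256 ^ N p * s p) \<in> O[F](\<lambda>p. 1 / 4 ^ N p)"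
  proof -
    have 1: "(\<lambda>p. 1 / 256 ^ N p * s p) \<in> O[F](\<lambda>p. 1 / 256 ^ N p * 4 ^ N p)"
      by (intro landau_o.big.mult O_s4) simp
    have "1 / 256 ^ n * 4 ^ n \<le> (1 / 4 ^ n :: real)" for n
    proof -
      have "(4::real) ^ n * 4 ^ n \<le> 256 ^ n" by (simp add: power_mono flip: power_mult_distrib)
      then show ?thesis by (simp add: field_simps)
    qed
    then have 2: "(\<lambda>p. 1 / 256 ^ N p * 4 ^ N p :: real) \<in> O[F](\<lambda>p. 1 / 4 ^ N p)"
      by (intro landau_o.big_mono always_eventually allI) simp
    show ?thesis by (rule landau_o.big_trans[OF 1 2])
  qed
  have O_H: "H \<in> O[F](\<lambda>p. 1 / 4 ^ N p)"
    unfolding H_def by (intro sum_in_bigo landau_o.big_trans[OF O_r small]) simp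
  have O_w: "(\<lambda>p. norm (w p)) \<in> O[F](\<lambda>p. 1 / 256 ^ N p * s p)"
  proof -
    have "norm (w p) = norm (1 / \<alpha> (N p)) * norm (1 / \<alpha> (N p)) * (norm (Z p))\<^sup>2" for p
      by (simp add: w_def norm_mult norm_divide power2_eq_square)
    moreover have "(\<lambda>p. norm (1 / \<alpha> (N p)) * norm (1 / \<alpha> (N p)) * (norm (Z p))\<^sup>2)
       \<in> O[F](\<lambda>p. 1 / 16 ^ N p * (1 / 16 ^ N p) * s p)"
      unfolding N_def by (intro landau_o.big.mult seq[OF O_inv\<alpha>] O_Z)
    ultimately show ?thesis by (simp flip: power_mult_distrib)
  qed
  have O_nH: "(\<lambda>p. real (N p) * H p) \<in> O[F](\<lambda>p. real (N p) * (1 / 4 ^ N p))"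
    by (intro landau_o.big.mult O_H) simp
  have nH_lim: "((\<lambda>p. real (N p) * (1 / 4 ^ N p)) \<longlongrightarrow> 0) F"
    unfolding N_def by (rule filterlim_compose[OF _ filterlim_fst_growth_filter[where X = X and Y = Y, folded F_def]]) real_asymp
  have nH: "\<forall>\<^sub>F p in F. real (N p) * H p \<le> 1/40"
    by (rule eventually_le_of_bigo[OF O_nH nH_lim]) simp
  have four_lim: "((\<lambda>p. 1 / 4 ^ N p :: real) \<longlongrightarrow> 0) F"
    unfolding N_def by (rule filterlim_compose[OF _ filterlim_fst_growth_filter[where X = X and Y = Y, folded F_def]]) real_asymp
  have w1: "\<forall>\<^sub>F p in F. norm (w p) \<le> 1"
    by (rule eventually_le_of_bigo[OF landau_o.big_trans[OF O_w small] four_lim]) simp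

  define c where "c p = c' (N p) + r p" for p
  have c_near: "\<forall>\<^sub>F p in F. norm (c p + 2) \<le> H p \<and> norm (c' (N p) + 2) \<le> H p"
    using posF
  proof eventually_elim
    case (elim p)
    have "norm (c p + 2) \<le> norm (c' (N p) + 2) + norm (r p)"
      using norm_triangle_ineq[of "c' (N p) + 2" "r p"] by (simp add: c_def algebra_simps)
    moreover have "norm (c' (N p) + 2) \<le> H p"
      unfolding H_def by (intro add_increasing2 c'_near[OF elim]) simp
    ultimately show ?case using c'_near[OF elim] by (simp add: H_def)
  qed
  have b_fix: "\<forall>\<^sub>F p in F. fixpt (c p) (\<beta> (c p))"
  proof (rule eventually_compose_filterlim[OF \<beta>])
    have "((\<lambda>p. c p - -2) \<longlongrightarrow> 0) F"
    proof (rule Lim_null_comparison)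
      show "\<forall>\<^sub>F p in F. norm (c p - -2) \<le> H p" using c_near by eventually_elim simp
      obtain C where C: "\<forall>\<^sub>F p in F. norm (H p) \<le> C * norm (1 / 4 ^ N p :: real)" using O_H by (elim landau_o.bigE)
      have "((\<lambda>p. C * norm (1 / 4 ^ N p :: real)) \<longlongrightarrow> C * norm (0::real)) F" by (intro tendsto_intros four_lim)
      then have "((\<lambda>p. C * norm (1 / 4 ^ N p :: real)) \<longlongrightarrow> 0) F" by simp
      then show "(H \<longlongrightarrow> 0) F" by (rule Lim_null_comparison[OF C])
    qed
    then show "filterlim c (nhds (-2)) F" by (subst (asm) LIM_zero_iff)
  qed

  \<comment> \<open>\<open>E\<close> is the first-order prediction for the forward image, and
    \<open>L\<close> the linear part of its numerator.\<close>
  define E where "E p = (third (c p) (w p) - (inv_branch (c p) ^^ N p) 0) / Q (N p)" for p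
  define L where "L p = - 16 * w p + (- 224/15 * r p + 64/15 * cnj (r p))" for p
  define R where "R p = 70 * norm (w p) * (H p + norm (w p)) + 71 * H p * norm (r p)
      + 40 * exp 7 * real (N p) * norm (r p) * norm (Q (N p))" for p
  \<comment> \<open>Here the constants cancel: the scaling condition normalizes the Z term,
    \<open>rho_linear_form\<close> the t term, and a / (16^n k Q) is \<open>mu\<close>.\<close>
  have L: "\<alpha> (N p) * (L p / Q (N p)) = mu (N p) * (cnj (Z p))\<^sup>2 + mu (N p) * nu (N p) * (of_real D * t p)"
    if "1 \<le> N p" for p
  proof -
    let ?n = "N p"
    have a_eq: "a = 16 ^ ?n * Q ?n * k * mu ?n" using mu(1)[of ?n] by (simp add: Q_def)
    have "\<alpha> ?n * (- 16 * w p) / Q ?n = - 16 * \<alpha> ?n * (cnj (Z p))\<^sup>2 / ((cnj (\<alpha> ?n))\<^sup>2 * Q ?n)"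
      by (simp add: w_def power_divide)
    also have "\<dots> = a / (16 ^ ?n * k * Q ?n) * (cnj (Z p))\<^sup>2"
      unfolding \<alpha>(2)[OF that, symmetric] using \<alpha>0[OF that] k a Q0[of ?n] by (simp add: field_simps)
    also have "a / (16 ^ ?n * k * Q ?n) = mu ?n" using k Q0[of ?n] by (subst a_eq) simp
    finally have 1: "\<alpha> ?n * (- 16 * w p) / Q ?n = mu ?n * (cnj (Z p))\<^sup>2" .
    have "k * (- 224/15 * r p + 64/15 * cnj (r p)) = b0 * r p + b0s * cnj (r p)"
      by (simp add: b algebra_simps)
    also have "\<dots> = K ?n * (of_real D * t p)"
      unfolding r_def rho_linear_form D_def by simp
    finally have "- 224/15 * r p + 64/15 * cnj (r p) = K ?n * (of_real D * t p) / k"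
      using k by (simp add: field_simps)
    then have "\<alpha> ?n * (- 224/15 * r p + 64/15 * cnj (r p)) / Q ?n
        = a / (16 ^ ?n * k * Q ?n) * nu ?n * (of_real D * t p)"
      using \<alpha>0[OF that] k by (simp add: K_eq[OF that])
    also have "a / (16 ^ ?n * k * Q ?n) = mu ?n" using k Q0[of ?n] by (subst a_eq) simp
    finally have 2: "\<alpha> ?n * (- 224/15 * r p + 64/15 * cnj (r p)) / Q ?n = mu ?n * nu ?n * (of_real D * t p)" .
    have "\<alpha> ?n * (L p / Q ?n) = \<alpha> ?n * (- 16 * w p) / Q ?n + \<alpha> ?n * (- 224/15 * r p + 64/15 * cnj (r p)) / Q ?n"
      by (simp only: L_def distrib_left add_divide_distrib times_divide_eq_right)
    then show ?thesis unfolding 1 2 .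
  qed

  have O_R: "R \<in> O[F](\<lambda>p. real (N p) / 4 ^ N p * (1 / 256 ^ N p * s p))"
  proof -
    have le: "(\<lambda>p. 1 / 4 ^ N p :: real) \<in> O[F](\<lambda>p. real (N p) / 4 ^ N p)"
      unfolding N_def by (rule seq) real_asymp
    have "(\<lambda>p. H p + norm (w p)) \<in> O[F](\<lambda>p. real (N p) / 4 ^ N p)"
      by (intro sum_in_bigo landau_o.big_trans[OF O_H le] landau_o.big_trans[OF landau_o.big_trans[OF O_w small] le])
    then have "(\<lambda>p. 70 * norm (w p) * (H p + norm (w p))) \<in> O[F](\<lambda>p. 1 * (1 / 256 ^ N p * s p) * (real (N p) / 4 ^ N p))"
      by (intro landau_o.big.mult O_w) simp
    then have 1: "(\<lambda>p. 70 * norm (w p) * (H p + norm (w p))) \<in> O[F](\<lambda>p. real (N p) / 4 ^ N p * (1 / 256 ^ N p * s p))"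
      by (simp only: mult_1_left mult.commute[of "1 / _ * _"])
    have "(\<lambda>p. 71 * H p * norm (r p)) \<in> O[F](\<lambda>p. 1 * (real (N p) / 4 ^ N p) * (1 / 256 ^ N p * s p))"
      by (intro landau_o.big.mult O_r landau_o.big_trans[OF O_H le]) simp
    then have 2: "(\<lambda>p. 71 * H p * norm (r p)) \<in> O[F](\<lambda>p. real (N p) / 4 ^ N p * (1 / 256 ^ N p * s p))"
      by (simp only: mult_1_left)
    have "(\<lambda>n. 1 / 16 ^ n :: real) \<in> O(\<lambda>n. 1 / 4 ^ n)" by real_asymp
    from landau_o.big_trans[OF O_Q this] have "(\<lambda>p. norm (Q (N p))) \<in> O[F](\<lambda>p. 1 / 4 ^ N p)"
      unfolding N_def by (rule seq)
    then have "(\<lambda>p. 40 * exp 7 * real (N p) * norm (r p) * norm (Q (N p))) \<in> O[F](\<lambda>p. 1 * real (N p) * (1 / 256 ^ N p * s p) * (1 / 4 ^ N p))"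
      by (intro landau_o.big.mult O_r) simp_all
    moreover have "1 * x * y * (1 / z) = x / z * y" for x y z :: real by simp
    ultimately have 3: "(\<lambda>p. 40 * exp 7 * real (N p) * norm (r p) * norm (Q (N p))) \<in> O[F](\<lambda>p. real (N p) / 4 ^ N p * (1 / 256 ^ N p * s p))"
      by (simp only:)
    show ?thesis unfolding R_def by (intro sum_in_bigo 1 2 3)
  qed
  have E_L: "\<forall>\<^sub>F p in F. norm (E p - L p / Q (N p)) \<le> R p * norm (1 / Q (N p))"
    using posF c_near nH w1 b_fix evn[OF b'_fix, folded N_def]
  proof eventually_elim
    case (elim p)
    have "norm (third (c p) (w p) - (inv_branch (c p) ^^ N p) 0
       - (- 16 * w p + (- 224/15 * (c p - c' (N p)) + 64/15 * cnj (c p - c' (N p)))))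
       \<le> 70 * norm (w p) * (H p + norm (w p)) + 71 * H p * norm (c p - c' (N p))
      + 40 * exp 7 * real (N p) * norm (c p - c' (N p)) * norm (slope (-2) (N p) 0 0)"
      using elim inv_branch_funpow_cn[OF elim(1), folded c'_def]
      by (intro third_minus_critical_orbit) auto
    then have "norm (third (c p) (w p) - (inv_branch (c p) ^^ N p) 0 - L p) \<le> R p"
      by (simp add: c_def L_def R_def Q_def)
    then have "norm (third (c p) (w p) - (inv_branch (c p) ^^ N p) 0 - L p) * norm (1 / Q (N p)) \<le> R p * norm (1 / Q (N p))"
      by (intro mult_right_mono) auto
    moreover have "E p - L p / Q (N p) = (third (c p) (w p) - (inv_branch (c p) ^^ N p) 0 - L p) * (1 / Q (N p))"
      by (simp add: E_def diff_divide_distrib)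
    ultimately show ?case by (simp only: norm_mult)
  qed
  have O_EL: "(\<lambda>p. norm (\<alpha> (N p)) * norm (E p - L p / Q (N p))) \<in> O[F](\<lambda>p. real (N p) / 4 ^ N p * s p)"
  proof (rule bigo_le)
    show "\<forall>\<^sub>F p in F. norm (norm (\<alpha> (N p)) * norm (E p - L p / Q (N p))) \<le> norm (norm (\<alpha> (N p)) * (R p * norm (1 / Q (N p))))"
      using E_L
    proof eventually_elim
      case (elim p)
      then have "norm (\<alpha> (N p)) * norm (E p - L p / Q (N p)) \<le> norm (\<alpha> (N p)) * (R p * norm (1 / Q (N p)))"
        by (intro mult_left_mono) auto
      then show ?case by (rule norm_le_norm_real[rotated]) simp
    qed
    have "(\<lambda>p. norm (\<alpha> (N p)) * (R p * norm (1 / Q (N p)))) \<in> O[F](\<lambda>p. 16 ^ N p * ((real (N p) / 4 ^ N p * (1 / 256 ^ N p * s p)) * 16 ^ N p))"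
      unfolding N_def by (intro landau_o.big.mult seq[OF O_\<alpha>] seq[OF O_invQ] O_R[unfolded N_def])
    moreover have "16 ^ n * ((real n / 4 ^ n * (1 / 256 ^ n * x)) * 16 ^ n) = real n / 4 ^ n * x" for n x
    proof -
      have "(16::real) ^ n * 16 ^ n = 256 ^ n" by (simp flip: power_mult_distrib)
      then show ?thesis by (simp add: field_simps)
    qed
    ultimately show "(\<lambda>p. norm (\<alpha> (N p)) * (R p * norm (1 / Q (N p)))) \<in> O[F](\<lambda>p. real (N p) / 4 ^ N p * s p)" by simp
  qed
  \<comment> \<open>E is recovered by dividing \<alpha> E by \<alpha>; the former is O(S) by the
    \<open>L\<close> identity and \<open>O_EL\<close>.\<close>
  have O_E: "(\<lambda>p. norm (E p)) \<in> O[F](\<lambda>p. 1 / 16 ^ N p * s p)"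
  proof (rule bigo_le)
    show "\<forall>\<^sub>F p in F. norm (norm (E p)) \<le> norm (norm (1 / \<alpha> (N p)) * (norm (\<alpha> (N p)) * norm (E p - L p / Q (N p))
        + (norm (mu (N p)) * (norm (Z p))\<^sup>2 + norm (mu (N p)) * norm (nu (N p)) * (norm D * norm (t p)))))"
      using posF
    proof eventually_elim
      case (elim p)
      let ?A = "norm (\<alpha> (N p)) * norm (E p - L p / Q (N p))"
      let ?B = "norm (mu (N p)) * (norm (Z p))\<^sup>2 + norm (mu (N p)) * norm (nu (N p)) * (norm D * norm (t p))"
      have "E p = 1 / \<alpha> (N p) * (\<alpha> (N p) * (E p - L p / Q (N p)) + \<alpha> (N p) * (L p / Q (N p)))"
        using \<alpha>0[OF elim] by (simp add: field_simps)
      then have "norm (E p) = norm (1 / \<alpha> (N p)) * norm (\<alpha> (N p) * (E p - L p / Q (N p)) + \<alpha> (N p) * (L p / Q (N p)))"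
        by (metis norm_mult)
      also have "\<dots> \<le> norm (1 / \<alpha> (N p)) * (?A + ?B)"
      proof (intro mult_left_mono norm_triangle_le add_mono)
        show "norm (\<alpha> (N p) * (L p / Q (N p))) \<le> ?B"
          unfolding L[OF elim] by (intro norm_triangle_le) (simp add: norm_mult norm_power)
      qed (auto simp: norm_mult)
      finally show ?case by (rule norm_le_norm_real[rotated]) simp
    qed
    have "(\<lambda>p. norm (\<alpha> (N p)) * norm (E p - L p / Q (N p))) \<in> O[F](s)"
    proof -
      have "(\<lambda>p. real (N p) / 4 ^ N p) \<in> O[F](\<lambda>p. 1)" unfolding N_def by (rule seq) real_asymp
      then have "(\<lambda>p. real (N p) / 4 ^ N p * s p) \<in> O[F](\<lambda>p. 1 * s p)" by (intro landau_o.big.mult) simp_all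
      then show ?thesis using landau_o.big_trans[OF O_EL] by simp
    qed
    moreover have "(\<lambda>p. norm (mu (N p)) * (norm (Z p))\<^sup>2) \<in> O[F](\<lambda>p. 1 * s p)"
      unfolding N_def by (intro landau_o.big.mult seq[OF O_mu] O_Z)
    moreover have "(\<lambda>p. norm (mu (N p)) * norm (nu (N p)) * (norm D * norm (t p))) \<in> O[F](\<lambda>p. 1 * 1 * (1 * s p))"
      unfolding N_def by (intro landau_o.big.mult seq[OF O_mu] seq[OF O_nu1] O_t) simp
    ultimately have "(\<lambda>p. norm (\<alpha> (N p)) * norm (E p - L p / Q (N p))
        + (norm (mu (N p)) * (norm (Z p))\<^sup>2 + norm (mu (N p)) * norm (nu (N p)) * (norm D * norm (t p)))) \<in> O[F](s)"
      by (intro sum_in_bigo) simp_all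
    then show "(\<lambda>p. norm (1 / \<alpha> (N p)) * (norm (\<alpha> (N p)) * norm (E p - L p / Q (N p))
        + (norm (mu (N p)) * (norm (Z p))\<^sup>2 + norm (mu (N p)) * norm (nu (N p)) * (norm D * norm (t p)))))
        \<in> O[F](\<lambda>p. 1 / 16 ^ N p * s p)"
      unfolding N_def by (intro landau_o.big.mult seq[OF O_inv\<alpha>])
  qed
  have small_E: "(\<lambda>p. 1 / 16 ^ N p * s p) \<in> O[F](\<lambda>p. 1 / 4 ^ N p)"
  proof -
    have 1: "(\<lambda>p. 1 / 16 ^ N p * s p) \<in> O[F](\<lambda>p. 1 / 16 ^ N p * 4 ^ N p)"
      by (intro landau_o.big.mult O_s4) simp
    have "1 / 16 ^ n * 4 ^ n = (1 / 4 ^ n :: real)" for n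
      by (simp add: field_simps flip: power_mult_distrib)
    then have 2: "(\<lambda>p. 1 / 16 ^ N p * 4 ^ N p :: real) \<in> O[F](\<lambda>p. 1 / 4 ^ N p)" by simp
    show ?thesis by (rule landau_o.big_trans[OF 1 2])
  qed
  have E_small: "\<forall>\<^sub>F p in F. norm (E p) \<le> 1/32"
    by (rule eventually_le_of_bigo[OF landau_o.big_trans[OF O_E small_E] four_lim]) simp

  define u where "u p = (acp (c p) ^^ (2 * N p)) (third (c p) (w p))" for p
  have u: "\<forall>\<^sub>F p in F. norm (u p - E p) \<le> norm (E p) * (16 * norm (E p) + 20 * (real (N p) * H p))"
    using posF c_near nH E_small
  proof eventually_elim
    case (elim p)
    then show ?case unfolding u_def by (intro forward_orbit_near_zero) (auto simp: E_def Q_def)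
  qed
  have O_u: "(\<lambda>p. norm (\<alpha> (N p)) * norm (u p - E p)) \<in> O[F](\<lambda>p. real (N p) / 4 ^ N p * s p)"
  proof (rule bigo_le)
    show "\<forall>\<^sub>F p in F. norm (norm (\<alpha> (N p)) * norm (u p - E p))
      \<le> norm (norm (\<alpha> (N p)) * (norm (E p) * (16 * norm (E p) + 20 * (real (N p) * H p))))"
      using u
    proof eventually_elim
      case (elim p)
      then have "norm (\<alpha> (N p)) * norm (u p - E p) \<le> norm (\<alpha> (N p)) * (norm (E p) * (16 * norm (E p) + 20 * (real (N p) * H p)))"
        by (intro mult_left_mono) auto
      then show ?case by (rule norm_le_norm_real[rotated]) simp
    qed
    have "(\<lambda>p. 1 / 4 ^ N p :: real) \<in> O[F](\<lambda>p. real (N p) / 4 ^ N p)"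
      unfolding N_def by (rule seq) real_asymp
    then have "(\<lambda>p. norm (E p)) \<in> O[F](\<lambda>p. real (N p) / 4 ^ N p)"
      using landau_o.big_trans[OF O_E small_E] landau_o.big_trans by blast
    then have "(\<lambda>p. 16 * norm (E p) + 20 * (real (N p) * H p)) \<in> O[F](\<lambda>p. real (N p) / 4 ^ N p)"
      using O_nH by (intro sum_in_bigo) simp_all
    then have "(\<lambda>p. norm (\<alpha> (N p)) * (norm (E p) * (16 * norm (E p) + 20 * (real (N p) * H p))))
      \<in> O[F](\<lambda>p. 16 ^ N p * ((1 / 16 ^ N p * s p) * (real (N p) / 4 ^ N p)))"
      unfolding N_def by (intro landau_o.big.mult seq[OF O_\<alpha>] O_E[unfolded N_def])
    then show "(\<lambda>p. norm (\<alpha> (N p)) * (norm (E p) * (16 * norm (E p) + 20 * (real (N p) * H p))))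
      \<in> O[F](\<lambda>p. real (N p) / 4 ^ N p * s p)" by (simp add: mult_ac)
  qed

  have O_ZZ: "(\<lambda>p. norm (mu (N p) - 1) * (norm (Z p))\<^sup>2) \<in> O[F](\<lambda>p. real (N p) / 4 ^ N p * s p)"
  proof -
    have "(\<lambda>n. 1 / 5 ^ n :: real) \<in> O(\<lambda>n. real n / 4 ^ n)" by real_asymp
    from landau_o.big_trans[OF mu(2) this] show ?thesis
      unfolding N_def by (intro landau_o.big.mult O_Z seq)
  qed
  have O_tt: "(\<lambda>p. norm (mu (N p) * nu (N p) - 1) * (norm D * norm (t p))) \<in> O[F](\<lambda>p. real (N p) / 4 ^ N p * s p)"
  proof -
    have "(\<lambda>p. norm D * norm (t p)) \<in> O[F](\<lambda>p. 1 * s p)" by (intro landau_o.big.mult O_t) simp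
    then show ?thesis unfolding N_def by (intro landau_o.big.mult seq[OF O_munu]) simp
  qed
  have "(\<lambda>p. norm (renorm (N p) (\<alpha> (N p)) (c p) (Z p) - (cnj (Z p))\<^sup>2 - of_real D * t p))
     \<in> O[F](\<lambda>p. real (N p) / 4 ^ N p * s p)"
  proof (rule bigo_le)
    show "\<forall>\<^sub>F p in F. norm (norm (renorm (N p) (\<alpha> (N p)) (c p) (Z p) - (cnj (Z p))\<^sup>2 - of_real D * t p))
       \<le> norm (norm (\<alpha> (N p)) * norm (u p - E p) + norm (\<alpha> (N p)) * norm (E p - L p / Q (N p))
         + norm (mu (N p) - 1) * (norm (Z p))\<^sup>2 + norm (mu (N p) * nu (N p) - 1) * (norm D * norm (t p)))"
      using posF
    proof eventually_elim
      case (elim p)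
      let ?n = "N p"
      have "renorm ?n (\<alpha> ?n) (c p) (Z p) = \<alpha> ?n * u p"
        by (simp add: renorm_def period_def funpow_add acp3 u_def w_def del: funpow.simps(2))
      \<comment> \<open>The error splits into the nonlinearity of the forward map, the remainder of
        the numerator, and the deviations of \<open>mu\<close> and \<open>mu nu\<close> from
        1.\<close>
      then have eq: "renorm ?n (\<alpha> ?n) (c p) (Z p) - (cnj (Z p))\<^sup>2 - of_real D * t p
         = \<alpha> ?n * (u p - E p) + \<alpha> ?n * (E p - L p / Q ?n)
           + (mu ?n - 1) * (cnj (Z p))\<^sup>2 + (mu ?n * nu ?n - 1) * (of_real D * t p)"
        using L[OF elim] by (simp add: algebra_simps)
      have "norm (v1 + v2 + v3 + v4) \<le> norm v1 + norm v2 + norm v3 + norm v4" for v1 v2 v3 v4 :: complex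
        by (intro norm_triangle_le add_mono order_refl)
      from this[of "\<alpha> ?n * (u p - E p)" "\<alpha> ?n * (E p - L p / Q ?n)"
          "(mu ?n - 1) * (cnj (Z p))\<^sup>2" "(mu ?n * nu ?n - 1) * (of_real D * t p)"]
      have "norm (renorm ?n (\<alpha> ?n) (c p) (Z p) - (cnj (Z p))\<^sup>2 - of_real D * t p)
        \<le> norm (\<alpha> ?n) * norm (u p - E p) + norm (\<alpha> ?n) * norm (E p - L p / Q ?n)
         + norm (mu ?n - 1) * (norm (Z p))\<^sup>2 + norm (mu ?n * nu ?n - 1) * (norm D * norm (t p))"
        unfolding eq by (simp only: norm_mult norm_power complex_mod_cnj norm_of_real real_norm_def)
      then show ?case by (rule norm_le_norm_real[OF norm_ge_zero])
    qed
    show "(\<lambda>p. norm (\<alpha> (N p)) * norm (u p - E p) + norm (\<alpha> (N p)) * norm (E p - L p / Q (N p))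
         + norm (mu (N p) - 1) * (norm (Z p))\<^sup>2 + norm (mu (N p) * nu (N p) - 1) * (norm D * norm (t p)))
      \<in> O[F](\<lambda>p. real (N p) / 4 ^ N p * s p)"
      by (intro sum_in_bigo O_u O_EL O_ZZ O_tt)
  qed
  then show ?thesis
    by (simp add: case_prod_unfold N_def c_def c'_def r_def s_def Z_def t_def D_def F_def)
qed

theorem theorem3p3:
  fixes \<beta> :: "complex \<Rightarrow> complex"
    and Koe :: "complex \<Rightarrow> complex \<Rightarrow> complex"
    and A :: "nat \<Rightarrow> complex \<Rightarrow> complex"
    and B Bs :: "complex \<Rightarrow> complex"
    and \<delta> \<gamma> :: real
    and \<alpha> :: "nat \<Rightarrow> complex"
    and b0 b0s :: complex
  assumes "fixed_point_branch \<beta>"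
    and "linearizer_family \<beta> Koe"
    and "expansion_coeffs Koe A"
    and "center_decomposition (A 0) B Bs"
    and "b0 = B chat" and "b0s = Bs chat"
    and "3 / 4 < \<delta>" and "\<delta> < 1"
    and "1 / 2 < \<gamma>" and "\<gamma> < 1"
    and "\<And>n. n \<ge> 1 \<Longrightarrow>
           scaling_constant (multiplier \<beta> chat ^ n * A 2 chat / koe_deriv Koe chat) (\<alpha> n)"
  shows "\<forall>C1>0. \<forall>C2>0. \<exists>C>0. \<exists>\<kappa>>0. \<forall>\<^sub>F n in sequentially. \<forall>Z t :: complex.
           norm Z \<le> C1 * Lam \<beta> powr ((1 - \<delta>) * real n) \<longrightarrow>
           norm t \<le> C2 * Lam \<beta> powr ((1 - \<gamma>) * real n) \<longrightarrow>
           norm (renorm n (\<alpha> n) (of_real (cn n) + rho (kn \<beta> Koe n (\<alpha> n)) b0 b0s t) Z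
                 - (cnj Z)\<^sup>2 - of_real ((norm b0)\<^sup>2 - (norm b0s)\<^sup>2) * t)
             \<le> C * exp (- \<kappa> * real n)"
proof (intro allI impI)
  fix C1 C2 :: real
  assume C1: "0 < C1" and C2: "0 < C2"
  obtain T where T: "open T" "T \<subseteq> disc" "0 \<in> T" "2 \<in> T"
    and lin: "\<forall>\<^sub>F c in nhds (-2). linearized T c (\<beta> c) (Koe c)"
    using linearizer_family_linearized[OF assms(1,2)] by metis
  note fixpts = fixed_point_branch_fixpt[OF assms(1)]
  have lin0: "linearized T (-2) 2 (Koe (-2))"
    using eventually_nhds_x_imp_x[OF lin] fixpts(1) by simp
  define k where "k = deriv (Koe (-2)) 2"
  define a where "a = koe_deriv Koe (-2)"
  define mu where "mu n = deriv (Koe (-2)) ((inv_branch (-2) ^^ n) 0) / k" for n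
  have k: "k \<noteq> 0" unfolding k_def by (rule linearized_deriv(1)[OF lin0 T(1-3)])
  have mu: "a = 16 ^ n * slope (-2) n 0 0 * k * mu n" for n
    using linearized_deriv_zero[OF lin0 T(1-3), of n] k by (simp add: a_def koe_deriv_def mu_def)
  have O_mu: "(\<lambda>n. norm (mu n - 1)) \<in> O(\<lambda>n. 1 / 5 ^ n)"
    unfolding mu_def k_def by (rule linearized_deriv_bigo[OF lin0 T])
  \<comment> \<open>\<open>mu n\<close> tends to 1, so some \<open>mu n\<close> is nonzero, and the
    factorization \<open>mu\<close> of a has no zero factor for this n.\<close>
  have a: "a \<noteq> 0"
  proof -
    have "\<forall>\<^sub>F n in sequentially. norm (mu n - 1) \<le> 1/2"
      by (rule eventually_le_of_bigo[OF O_mu]) (real_asymp, simp)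
    then obtain n where "norm (mu n - 1) \<le> 1/2" by (auto simp: eventually_sequentially)
    then have "mu n \<noteq> 0" by auto
    moreover have "slope (-2) n 0 0 \<noteq> 0" using T by (intro slope_nonzero) auto
    ultimately show ?thesis using k by (subst mu[of n]) simp
  qed
  have A2: "A 2 (-2) = - 16 * k"
    unfolding k_def using eventually_nhds_x_imp_x[OF assms(3)[unfolded expansion_coeffs_def]]
    by (intro linearized_second_coeff[OF lin0 T(1,4)])
  have mult: "multiplier \<beta> (-2) = 16"
    using multiplier_fixpt[of "-2" \<beta>] fixpts(1) fixpt_chat by simp
  have Lam: "Lam \<beta> = 16" by (simp add: Lam_def mult)
  have \<alpha>: "norm (\<alpha> n) = 16 ^ n * norm (16 * k / a)" "\<alpha> n * (16 ^ n * (- 16 * k) / a) = (cnj (\<alpha> n))\<^sup>2"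
    if "1 \<le> n" for n
    using scaling_constant_cube[OF assms(11)[OF that]]
    by (simp_all add: mult A2 norm_mult norm_divide norm_power flip: a_def)
  have b: "b0 = - 224/15 * k" "b0s = 64/15 * k"
    unfolding assms(5,6) k_def
    by (rule center_derivatives[OF assms(1) lin T expansion_coeffs_0[OF assms(3)] assms(4)])+
  \<comment> \<open>Since 16 = 4^2, the bounds on |Z|^2 and |t| grow like 4 to the powers 4 (1 -
    \<delta>) n and 2 (1 - \<gamma>) n.\<close>
  define \<theta> where "\<theta> = max (4 * (1 - \<delta>)) (2 * (1 - \<gamma>))"
  have \<theta>: "4 * (1 - \<delta>) \<le> \<theta>" "2 * (1 - \<gamma>) \<le> \<theta>" "\<theta> < 1"
    using assms(7-10) by (auto simp: \<theta>_def)
  define S :: "nat \<Rightarrow> real" where "S n = 4 powr (\<theta> * real n)" for n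
  define X where "X n = C1 * 16 powr ((1 - \<delta>) * real n)" for n
  define Y where "Y n = C2 * 16 powr ((1 - \<gamma>) * real n)" for n
  have sixteen: "(16::real) powr x = 4 powr (2 * x)" for x
    using powr_powr[of 4 2 x] by simp
  have S0: "0 \<le> S n" "S n \<le> 4 ^ n" for n
    using powr_mono[of "\<theta> * real n" "real n" 4] mult_right_mono[of \<theta> 1 "real n"] \<theta>(3)
    by (auto simp: S_def powr_realpow)
  have O_X: "(\<lambda>n. (X n)\<^sup>2) \<in> O(S)"
  proof (intro bigoI[where c = "C1\<^sup>2"] always_eventually allI)
    fix n
    have "(16 powr ((1 - \<delta>) * real n))\<^sup>2 = 4 powr (4 * (1 - \<delta>) * real n)"
      by (simp add: sixteen power2_eq_square algebra_simps flip: powr_add)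
    also have "\<dots> \<le> S n" unfolding S_def by (intro powr_mono mult_right_mono \<theta>) auto
    finally show "norm ((X n)\<^sup>2) \<le> C1\<^sup>2 * norm (S n)"
      using S0(1)[of n] by (simp add: X_def power_mult_distrib mult_left_mono)
  qed
  have O_Y: "Y \<in> O(S)"
  proof (intro bigoI[where c = C2] always_eventually allI)
    fix n
    have "16 powr ((1 - \<gamma>) * real n) \<le> S n"
      unfolding S_def sixteen mult.assoc[symmetric] by (intro powr_mono mult_right_mono \<theta>) auto
    then show "norm (Y n) \<le> C2 * norm (S n)"
      using C2 S0(1)[of n] by (simp add: Y_def mult_left_mono)
  qed
  define K where "K n = a / (\<alpha> n * (4 * \<beta> (cn n) * cnj (\<beta> (cn n))) ^ n)" for n
  have K: "\<forall>\<^sub>F n in sequentially. kn \<beta> Koe n (\<alpha> n) = K n"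
    using eventually_compose_filterlim[OF fixpts(2) cn_tendsto]
  proof eventually_elim
    case (elim n)
    then show ?case by (simp add: kn_def K_def a_def multiplier_fixpt)
  qed
  obtain C where C: "0 < C" and bound: "\<forall>\<^sub>F p in growth_filter X Y.
     norm (case p of (n, Z, t) \<Rightarrow> norm (renorm n (\<alpha> n) (of_real (cn n) + rho (K n) b0 b0s t) Z
            - (cnj Z)\<^sup>2 - of_real ((norm b0)\<^sup>2 - (norm b0s)\<^sup>2) * t))
     \<le> C * norm (real (fst p) / 4 ^ fst p * S (fst p))"
    by (rule landau_o.bigE[OF renormalization_bigo[OF fixpts(2) k a mu O_mu \<alpha> b S0 O_X O_Y K_def]])
  \<comment> \<open>S / 4^n = exp (-d n); half of this rate is spent on absorbing the factor
    n.\<close>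
  define d where "d = (1 - \<theta>) * ln 4"
  have d: "0 < d" using \<theta>(3) by (simp add: d_def)
  have decay: "norm (real n / 4 ^ n * S n) \<le> 2 / d * exp (- (d / 2) * real n)" for n
  proof -
    have *: "1 / 4 ^ n * S n = exp (- d * real n)"
      by (simp add: S_def d_def powr_def exp_diff algebra_simps exp_of_nat_mult flip: exp_minus)
    have "norm (real n / 4 ^ n * S n) = real n * (1 / 4 ^ n * S n)"
      using S0(1)[of n] by simp
    then have "norm (real n / 4 ^ n * S n) = real n * exp (- d * real n)"
      unfolding * .
    then show ?thesis using linear_times_exp_le[OF d, of n] by simp
  qed
  show "\<exists>C>0. \<exists>\<kappa>>0. \<forall>\<^sub>F n in sequentially. \<forall>Z t.
           norm Z \<le> C1 * Lam \<beta> powr ((1 - \<delta>) * real n) \<longrightarrow>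
           norm t \<le> C2 * Lam \<beta> powr ((1 - \<gamma>) * real n) \<longrightarrow>
           norm (renorm n (\<alpha> n) (of_real (cn n) + rho (kn \<beta> Koe n (\<alpha> n)) b0 b0s t) Z
                 - (cnj Z)\<^sup>2 - of_real ((norm b0)\<^sup>2 - (norm b0s)\<^sup>2) * t)
             \<le> C * exp (- \<kappa> * real n)"
  proof (intro exI conjI)
    show "0 < C * (2 / d)" "0 < d / 2" using C d by auto
    show "\<forall>\<^sub>F n in sequentially. \<forall>Z t.
           norm Z \<le> C1 * Lam \<beta> powr ((1 - \<delta>) * real n) \<longrightarrow>
           norm t \<le> C2 * Lam \<beta> powr ((1 - \<gamma>) * real n) \<longrightarrow>
           norm (renorm n (\<alpha> n) (of_real (cn n) + rho (kn \<beta> Koe n (\<alpha> n)) b0 b0s t) Z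
                 - (cnj Z)\<^sup>2 - of_real ((norm b0)\<^sup>2 - (norm b0s)\<^sup>2) * t)
             \<le> C * (2 / d) * exp (- (d / 2) * real n)"
      using bound[unfolded eventually_growth_filter] K
    proof eventually_elim
      case (elim n)
      show ?case
      proof (intro allI impI)
        fix Z t :: complex
        assume "norm Z \<le> C1 * Lam \<beta> powr ((1 - \<delta>) * real n)" "norm t \<le> C2 * Lam \<beta> powr ((1 - \<gamma>) * real n)"
        then have "norm (renorm n (\<alpha> n) (of_real (cn n) + rho (kn \<beta> Koe n (\<alpha> n)) b0 b0s t) Z
                 - (cnj Z)\<^sup>2 - of_real ((norm b0)\<^sup>2 - (norm b0s)\<^sup>2) * t) \<le> C * norm (real n / 4 ^ n * S n)"
          using elim unfolding Lam X_def Y_def by simp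
        also have "\<dots> \<le> C * (2 / d * exp (- (d / 2) * real n))"
          using C by (intro mult_left_mono decay) auto
        finally show "norm (renorm n (\<alpha> n) (of_real (cn n) + rho (kn \<beta> Koe n (\<alpha> n)) b0 b0s t) Z
                 - (cnj Z)\<^sup>2 - of_real ((norm b0)\<^sup>2 - (norm b0s)\<^sup>2) * t)
             \<le> C * (2 / d) * exp (- (d / 2) * real n)" by (simp only: mult.assoc)
      qed
    qed
  qed
qed

end
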